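(* Let $q$ be a prime power and let $\alpha,\beta\in\mathbb{F}_q^*$ with $\alpha+\beta=1$. For every $\varepsilon>0$ there exist $n_0(\varepsilon)$ and constants $c_1,c_2>0$ (which may depend on $\varepsilon$) such that the following holds. For every integer $n>n_0(\varepsilon)$ and all sets $\mathcal{A},\mathcal{B}\subset\mathcal{M}_n$ with $$\left(\#\mathcal{A}\,\#\mathcal{B}\right)^{1/2}\geq q^{(6/7+\varepsilon)n},$$ there exist at least $c_1\,\#\mathcal{A}\,\#\mathcal{B}/n$ pairs $(A,B)\in\mathcal{A}\times\mathcal{B}$ such that $$\operatorname{D}(\alpha A+\beta B)\geq n-\log_q\rho-\log_q\log_q\log_q\rho-\frac{c_2}{\log q}-1,$$ where $\rho=\dfrac{q^n}{(\#\mathcal{A}\,\#\mathcal{B})^{1/2}}$.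
   Context: $\mathbb{F}_q$ is the finite field with $q$ elements. $\mathcal{M}_n$ denotes the set of monic polynomials of degree $n$ in $\mathbb{F}_q[T]$. For $A\in\mathbb{F}_q[T]$, $\operatorname{D}(A)$ is the maximal degree of an irreducible divisor of $A$, with the convention $\operatorname{D}(a)=0$ for all $a\in\mathbb{F}_q$. $\log$ is the natural logarithm, and for $a\geq 2$, $\log_a(x)=\max\{\log(x)/\log(a),\,1\}$ (so iterated expressions such as $\log_q\log_q\log_q\rho$ use this convention at each step). *)

theory Defs
  imports Complex_Main "HOL-Algebra.Polynomial_Divisibility"
begin

text \<open>
  Finite fields are given as rings with an explicit carrier, not by a type class, so that constants
  can be chosen uniformly in the field.  Every finite field is isomorphic to one with carrier in
  any given infinite type.

  Polynomials over a ring \<open>R\<close> are elements of \<open>poly_ring R\<close>: coefficient lists with the leading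
  coefficient first, the zero polynomial being \<open>[]\<close>.  The degree of a polynomial is an
  abbreviation for \<open>length p - 1\<close>, so the zero polynomial also has degree 0.
\<close>

definition monic_polys :: "('a, 'b) ring_scheme \<Rightarrow> nat \<Rightarrow> 'a list set" where
  "monic_polys R n =
     {p \<in> carrier (poly_ring R). p \<noteq> [] \<and> lead_coeff p = \<one>\<^bsub>R\<^esub> \<and> degree p = n}"

text \<open>
  The first case covers exactly the constants, including 0 (which every irreducible polynomial
  divides).  Over a field, the set in the second case is finite and nonempty.
\<close>

definition max_irred_degree :: "('a, 'b) ring_scheme \<Rightarrow> 'a list \<Rightarrow> nat" where
  "max_irred_degree R A =
     (if degree A = 0 then 0
      else Max {degree P | P. P \<in> carrier (poly_ring R) \<and>
                              pirreducible\<^bsub>R\<^esub> (carrier R) P \<and> P pdivides\<^bsub>R\<^esub> A})"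

definition lin_comb :: "('a, 'b) ring_scheme \<Rightarrow> 'a \<Rightarrow> 'a list \<Rightarrow> 'a \<Rightarrow> 'a list \<Rightarrow> 'a list" where
  "lin_comb R \<alpha> A \<beta> B =
     (ring.poly_of_const R \<alpha> \<otimes>\<^bsub>poly_ring R\<^esub> A) \<oplus>\<^bsub>poly_ring R\<^esub>
     (ring.poly_of_const R \<beta> \<otimes>\<^bsub>poly_ring R\<^esub> B)"

text \<open>The logarithm to base \<open>a\<close>, truncated below at 1 also when it is iterated.\<close>

definition tlog :: "real \<Rightarrow> real \<Rightarrow> real" where
  "tlog a x = max (ln x / ln a) 1"

end

theory Submission
  imports Defs
begin

text \<open>
  Fix \<open>k\<close> slightly larger than \<open>log_q \<rho>\<close>, put \<open>d = n - k\<close>, and count the solutions of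
  \<open>\<alpha> A + \<beta> B = p C\<close> with \<open>p\<close> monic irreducible of degree \<open>d\<close> and \<open>C\<close> monic of degree \<open>k\<close>.
  Since \<open>2 d > n\<close>, a pair \<open>(A, B)\<close> admits at most one such factorization.

  Instead of characters we average over all linear functionals \<open>L\<close> of the coefficients below degree
  \<open>n\<close>.  For fixed \<open>p\<close>, the values \<open>L (p C)\<close> are either equidistributed or constant in \<open>C\<close>, the latter
  exactly if \<open>L (p F) = 0\<close> for all \<open>F\<close> of degree below \<open>k\<close>.  So the number of solutions deviates from its
  expected value by at most \<open>q ^ k * sqrt (#A #B)\<close> times the maximal number of such \<open>p\<close>, over \<open>L \<noteq> 0\<close>.

  This number is bounded by a sieve.  Continued fractions describe the affine space
  \<open>{F. L (F G) = 0 for all G with deg G < k}\<close> through a best denominator \<open>Q\<close> of \<open>L\<close>: either it contains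
  no irreducible polynomial of degree \<open>d\<close>, or it has dimension \<open>d - k\<close> and is equidistributed modulo
  all small moduli whose part composed of prime divisors of \<open>Q\<close> has degree at most about \<open>deg Q - k\<close>.
  Only the prime divisors of \<open>Q\<close> of larger degree are lost in the sieve, and they cost a factor
  of order \<open>log_q k\<close>.  This is the source of the iterated logarithm.
\<close>

subsection \<open>Bessel's inequality as a sieve\<close>

text \<open>Irreducible polynomials have density about \<open>1 / d\<close> in degree
  \<open>d\<close>, so the main term has size \<open>#A #B / n\<close>. The exceptional
  \<open>p\<close> lie in an affine space of \<open>q ^ (d - k)\<close> elements; counting all of
  these would lose that density and force \<open>q ^ k\<close> above \<open>n * \<rho>\<close>. The
  sieve must therefore save a factor of order \<open>n\<close>, up to the loss for the divisors of
  \<open>Q\<close>, and its level must be a fixed proportion of \<open>n\<close> for every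
  functional and every \<open>q\<close>.

  This dictates the parameters. \<open>Q\<close> is taken at level \<open>m\<close>, so its degree
  may reach \<open>m\<close>. The sieve needs products of two moduli, each with two parts of degree
  up to \<open>Z\<close>, and these must fit below \<open>m\<close> next to \<open>k\<close> and,
  together with \<open>Q\<close>, below \<open>d\<close>: hence \<open>4 * Z + k \<le> m\<close> and
  \<open>2 * m \<le> d + k = n\<close>. With \<open>m\<close> about \<open>n / 2\<close> and
  \<open>Z\<close> about \<open>n / 12\<close> this allows \<open>k\<close> up to about
  \<open>n / 6\<close>. The exponent 6/7 bounds \<open>log_q \<rho>\<close> by \<open>n / 7\<close>,
  and the gap between 1/7 and 1/6 pays for the lower order terms of \<open>k\<close>. Since every
  estimate is uniform, all constants are absolute.\<close>

lemma sum_prod_one_plus_indicator: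
  fixes c N :: "'i \<Rightarrow> real"
  assumes "finite V" "finite u" "\<And>i. i \<in> u \<Longrightarrow> N i > 1"
    and count: "\<And>w. w \<subseteq> u \<Longrightarrow> real (card {v\<in>V. \<forall>i\<in>w. E i v}) * (\<Prod>i\<in>w. N i) = card V"
  shows "(\<Sum>v\<in>V. \<Prod>i\<in>u. (1 + c i * of_bool (E i v))) = real (card V) * (\<Prod>i\<in>u. (1 + c i / N i))"
proof -
  have ind: "(\<Prod>i\<in>w. of_bool (E i v)) = (of_bool (\<forall>i\<in>w. E i v) :: real)" if "w \<subseteq> u" for w v
    using finite_subset[OF that assms(2)] by (induction w rule: finite_induct) auto
  have cnt: "(\<Sum>v\<in>V. of_bool (\<forall>i\<in>w. E i v)) = real (card V) / (\<Prod>i\<in>w. N i)" if "w \<subseteq> u" for w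
  proof -
    have "(\<Prod>i\<in>w. N i) \<noteq> 0"
      using that assms(2,3) finite_subset[OF that assms(2)] by (force simp: prod_zero_iff)
    moreover have "(\<Sum>v\<in>V. of_bool (\<forall>i\<in>w. E i v)) = real (card {v\<in>V. \<forall>i\<in>w. E i v})"
      using assms(1) by (simp add: Int_def)
    ultimately show ?thesis
      using count[OF that] by (simp add: field_simps)
  qed
  \<comment> \<open>Expanding over subsets of \<open>u\<close> leaves only joint events, and by
    \<open>count\<close> these are exactly independent, with probability \<open>1 / N i\<close>
    each.\<close>
  have "(\<Sum>v\<in>V. \<Prod>i\<in>u. (1 + c i * of_bool (E i v)))
      = (\<Sum>v\<in>V. \<Sum>w\<in>Pow u. (\<Prod>i\<in>w. c i) * of_bool (\<forall>i\<in>w. E i v))"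
  proof (rule sum.cong[OF refl])
    fix v
    have "(\<Prod>i\<in>u. (1 + c i * of_bool (E i v))) = (\<Prod>i\<in>u. (c i * of_bool (E i v) + 1))"
      by (simp add: add.commute)
    also have "\<dots> = (\<Sum>w\<in>Pow u. (\<Prod>i\<in>w. c i * of_bool (E i v)) * (\<Prod>i\<in>u-w. 1))"
      by (rule prod_add[OF assms(2)])
    also have "\<dots> = (\<Sum>w\<in>Pow u. (\<Prod>i\<in>w. c i) * of_bool (\<forall>i\<in>w. E i v))"
      by (intro sum.cong refl) (auto simp: prod.distrib ind simp del: of_bool_eq_0_iff)
    finally show "(\<Prod>i\<in>u. (1 + c i * of_bool (E i v))) = (\<Sum>w\<in>Pow u. (\<Prod>i\<in>w. c i) * of_bool (\<forall>i\<in>w. E i v))" .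
  qed
  also have "\<dots> = (\<Sum>w\<in>Pow u. (\<Prod>i\<in>w. c i) * (\<Sum>v\<in>V. of_bool (\<forall>i\<in>w. E i v)))"
    by (subst sum.swap) (simp add: sum_distrib_left)
  also have "\<dots> = (\<Sum>w\<in>Pow u. real (card V) * (\<Prod>i\<in>w. c i / N i))"
    by (intro sum.cong refl) (subst cnt, auto simp: prod_dividef)
  also have "\<dots> = real (card V) * (\<Prod>i\<in>u. (c i / N i + 1))"
    by (subst prod_add[OF assms(2)]) (simp add: sum_distrib_left)
  finally show ?thesis by (simp add: add.commute)
qed

text \<open>
  The functions \<open>f s\<close> in the proof are orthogonal on \<open>V\<close>, have squared norm \<open>card V * (\<Prod>i\<in>s. N i - 1)\<close>
  and are equal to 1 on the sifted set.
\<close>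

lemma bessel_sieve:
  fixes N :: "'i \<Rightarrow> real"
  assumes "finite V" "finite \<D>" and fin: "\<And>s. s \<in> \<D> \<Longrightarrow> finite s"
    and N: "\<And>s i. s \<in> \<D> \<Longrightarrow> i \<in> s \<Longrightarrow> N i > 1"
    and count: "\<And>s t w. s \<in> \<D> \<Longrightarrow> t \<in> \<D> \<Longrightarrow> w \<subseteq> s \<union> t \<Longrightarrow>
       real (card {v\<in>V. \<forall>i\<in>w. E i v}) * (\<Prod>i\<in>w. N i) = card V"
  shows "real (card {v\<in>V. \<forall>s\<in>\<D>. \<forall>i\<in>s. \<not> E i v}) * (\<Sum>s\<in>\<D>. \<Prod>i\<in>s. 1 / (N i - 1)) \<le> card V"
proof -
  define f where "f s v = (\<Prod>i\<in>s. (1 - N i * of_bool (E i v)))" for s v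
  define a where "a s = (\<Prod>i\<in>s. 1 / (N i - 1))" for s
  define G where "G = (\<Sum>s\<in>\<D>. a s)"
  define S where "S = {v\<in>V. \<forall>s\<in>\<D>. \<forall>i\<in>s. \<not> E i v}"
  define h where "h v = (\<Sum>s\<in>\<D>. a s * f s v)" for v
  have apos: "a s > 0" if "s \<in> \<D>" for s
    unfolding a_def using N[OF that] by (intro prod_pos) force
  have orth: "(\<Sum>v\<in>V. f s v * f t v) = (if s = t then card V / a s else 0)"
    if st: "s \<in> \<D>" "t \<in> \<D>" for s t
  proof -
    \<comment> \<open>Coefficient of the indicator in \<open>f s * f t\<close>:
      \<open>(1 - N i)^2 - 1\<close> at a common index, \<open>- N i\<close> at an index of only one
      of the sets. In the second case the factor has mean \<open>1 - 1 = 0\<close>, whence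
      orthogonality.\<close>
    define c where "c i = (if i \<in> s \<inter> t then N i * N i - 2 * N i else - N i)" for i
    have fu: "finite (s \<union> t)" using fin st by auto
    have N1: "N i > 1" if "i \<in> s \<union> t" for i using N st that by auto
    have "f s v * f t v = (\<Prod>i\<in>s\<union>t. (1 + c i * of_bool (E i v)))" for v
    proof -
      have 1: "f s v = (\<Prod>i\<in>s\<union>t. if i \<in> s then 1 - N i * of_bool (E i v) else 1)"
        unfolding f_def using fu by (intro prod.mono_neutral_cong_left) auto
      have 2: "f t v = (\<Prod>i\<in>s\<union>t. if i \<in> t then 1 - N i * of_bool (E i v) else 1)"
        unfolding f_def using fu by (intro prod.mono_neutral_cong_left) auto
      show ?thesis unfolding 1 2 prod.distrib[symmetric]
        by (intro prod.cong refl) (auto simp: c_def algebra_simps)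
    qed
    hence "(\<Sum>v\<in>V. f s v * f t v) = real (card V) * (\<Prod>i\<in>s\<union>t. (1 + c i / N i))"
      using sum_prod_one_plus_indicator[OF assms(1) fu N1, where E=E and c=c] count[OF st] by simp
    also have "\<dots> = (if s = t then card V / a s else 0)"
    proof (cases "s = t")
      case True
      have "(\<Prod>i\<in>s\<union>t. (1 + c i / N i)) = (\<Prod>i\<in>s. N i - 1)"
        using N1 True by (intro prod.cong) (force simp: c_def field_simps)+
      thus ?thesis using True by (simp add: a_def prod_dividef)
    next
      case False
      then obtain i where "i \<in> s \<union> t" "i \<notin> s \<inter> t" by auto
      hence "1 + c i / N i = 0" using N1[of i] by (auto simp: c_def)
      thus ?thesis using False fu \<open>i \<in> s \<union> t\<close> by (auto simp: prod_zero_iff)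
    qed
    finally show ?thesis .
  qed
  have "(\<Sum>v\<in>V. h v * h v) = (\<Sum>s\<in>\<D>. \<Sum>t\<in>\<D>. a s * a t * (\<Sum>v\<in>V. f s v * f t v))"
  proof -
    have "(\<Sum>v\<in>V. h v * h v) = (\<Sum>v\<in>V. \<Sum>s\<in>\<D>. \<Sum>t\<in>\<D>. a s * a t * (f s v * f t v))"
      unfolding h_def sum_product by (intro sum.cong refl) (simp add: algebra_simps)
    also have "\<dots> = (\<Sum>s\<in>\<D>. \<Sum>v\<in>V. \<Sum>t\<in>\<D>. a s * a t * (f s v * f t v))"
      by (rule sum.swap)
    also have "\<dots> = (\<Sum>s\<in>\<D>. \<Sum>t\<in>\<D>. \<Sum>v\<in>V. a s * a t * (f s v * f t v))"
      by (intro sum.cong refl sum.swap)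
    finally show ?thesis by (simp add: sum_distrib_left)
  qed
  also have "\<dots> = (\<Sum>s\<in>\<D>. \<Sum>t\<in>\<D>. if s = t then a s * card V else 0)"
    by (intro sum.cong refl) (use apos in \<open>auto simp: orth\<close>)
  also have "\<dots> = G * card V"
    using assms(2) by (simp add: G_def sum_distrib_right)
  finally have hh: "(\<Sum>v\<in>V. h v * h v) = G * card V" .
  have hS: "h v = G" if "v \<in> S" for v
    unfolding h_def G_def using that by (intro sum.cong refl) (auto simp: f_def S_def)
  \<comment> \<open>Off \<open>S\<close> nothing is known about \<open>h\<close> beyond positivity
    of its square. The weights \<open>a s\<close> are the reciprocal squared norms up to the factor
    \<open>card V\<close>, which makes the squared norm of \<open>h\<close> a multiple of its value
    \<open>G\<close> on \<open>S\<close>.\<close>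
  have "0 \<le> (\<Sum>v\<in>V-S. h v * h v)"
    by (intro sum_nonneg) simp
  also have "\<dots> = G * card V - (\<Sum>v\<in>S. h v * h v)"
    using hh assms(1) by (subst sum_diff) (auto simp: S_def)
  also have "(\<Sum>v\<in>S. h v * h v) = G * (card S * G)"
    by (simp add: hS)
  finally have "G * (card S * G) \<le> G * card V" by simp
  moreover have "G \<ge> 0" unfolding G_def using apos by (intro sum_nonneg) force
  ultimately have "card S * G \<le> card V"
    by (cases "G = 0") (auto simp: mult_le_cancel_left)
  thus ?thesis by (simp add: S_def G_def a_def)
qed

subsection \<open>Mertens estimates from unique factorization\<close>

lemma sum_mset_conv_sum_count:
  fixes f :: "'i \<Rightarrow> nat"
  assumes "finite J" "set_mset M \<subseteq> J"
  shows "(\<Sum>i\<in>#M. f i) = (\<Sum>i\<in>J. count M i * f i)"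
  using assms(2)
proof (induction M)
  case (add x M)
  have "(\<Sum>i\<in>J. count (add_mset x M) i * f i) = (\<Sum>i\<in>J. count M i * f i + (if i = x then f i else 0))"
    by (intro sum.cong) auto
  also have "\<dots> = (\<Sum>i\<in>J. count M i * f i) + f x"
    using assms(1) add.prems by (simp add: sum.distrib)
  finally show ?case using add by simp
qed simp

lemma sum_over_multiples:
  fixes d n :: nat and g :: "nat \<Rightarrow> 'b::comm_monoid_add"
  assumes "d \<ge> 1"
  shows "(\<Sum>j\<in>{1..n}. if j * d \<le> n then g (j * d) else 0) = (\<Sum>m\<in>{1..n}. if d dvd m then g m else 0)"
proof -
  have "(\<Sum>j\<in>{1..n}. if j * d \<le> n then g (j * d) else 0) = (\<Sum>j\<in>{j\<in>{1..n}. j * d \<le> n}. g (j * d))"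
    by (rule sum.inter_filter[symmetric]) simp
  also have "\<dots> = (\<Sum>m\<in>{m\<in>{1..n}. d dvd m}. g m)"
  proof (rule sum.reindex_bij_witness[where i = "\<lambda>m. m div d" and j = "\<lambda>j. j * d"])
    fix m assume m: "m \<in> {m\<in>{1..n}. d dvd m}"
    then obtain e where e: "m = d * e" by (auto elim: dvdE)
    have "e \<le> d * e" using assms by simp
    with m e assms show "m div d \<in> {j\<in>{1..n}. j * d \<le> n}"
      by (cases e) (auto simp: mult.commute)
  qed (use assms in auto)
  also have "\<dots> = (\<Sum>m\<in>{1..n}. if d dvd m then g m else 0)"
    by (rule sum.inter_filter) simp
  finally show ?thesis .
qed

text \<open>Every element of \<open>s\<close> occurs with multiplicity at least 1, so the sum over
  all such multisets is a product of geometric series \<open>x + x^2 + ... = x / (1 - x)\<close>.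
  Restricting to finite families turns this into an inequality and avoids infinite sums.\<close>

lemma sum_mset_with_support_le:
  fixes x :: "'i \<Rightarrow> real"
  assumes "finite s" "\<And>i. i \<in> s \<Longrightarrow> 0 < x i \<and> x i < 1"
    and "finite \<M>" "\<And>M. M \<in> \<M> \<Longrightarrow> set_mset M = s"
  shows "(\<Sum>M\<in>\<M>. \<Prod>i\<in>#M. x i) \<le> (\<Prod>i\<in>s. x i / (1 - x i))"
  using assms
proof (induction s arbitrary: \<M> rule: finite_induct)
  case empty
  then have "\<M> \<subseteq> {{#}}" by auto
  hence "(\<Sum>M\<in>\<M>. \<Prod>i\<in>#M. x i) \<le> (\<Sum>M\<in>{{#}}. \<Prod>i\<in>#M. x i)"
    by (intro sum_mono2) auto
  thus ?case by simp
next
  case (insert p s)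
  define \<phi> where "\<phi> M = (count M p, filter_mset (\<lambda>i. i \<noteq> p) M)" for M
  define \<N> where "\<N> = snd ` \<phi> ` \<M>"
  define K where "K = fst ` \<phi> ` \<M>"
  have split: "M = filter_mset (\<lambda>i. i \<noteq> p) M + replicate_mset (count M p) p" for M
    by (rule multiset_eqI) auto
  have inj: "inj_on \<phi> \<M>"
    by (rule inj_onI) (metis \<phi>_def split prod.inject)
  have x: "0 < x p" "x p < 1" using insert.prems by auto
  have nn: "0 \<le> (\<Prod>i\<in>#M. x i)" if "M \<in> \<N>" for M
  proof -
    have "\<forall>i\<in>#M. 0 \<le> x i"
      using that insert.prems(1,3) by (force simp: \<N>_def \<phi>_def)
    thus ?thesis by (induction M) auto
  qed
  have Kfin: "finite K" "finite \<N>" using insert.prems by (auto simp: K_def \<N>_def)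
  have K0: "0 \<notin> K"
  proof
    assume "0 \<in> K"
    then obtain M where "M \<in> \<M>" "count M p = 0" by (auto simp: K_def \<phi>_def)
    thus False using insert.prems(3)[of M] by (auto simp: count_eq_zero_iff)
  qed
  have "(\<Sum>M\<in>\<M>. \<Prod>i\<in>#M. x i) = (\<Sum>M\<in>\<M>. (\<lambda>(j,M). x p ^ j * (\<Prod>i\<in>#M. x i)) (\<phi> M))"
    by (intro sum.cong refl) (subst split, simp add: \<phi>_def image_replicate_mset)
  also have "\<dots> = (\<Sum>(j,M)\<in>\<phi> ` \<M>. x p ^ j * (\<Prod>i\<in>#M. x i))"
    by (subst sum.reindex[OF inj]) simp
  also have "\<dots> \<le> (\<Sum>(j,M)\<in>K \<times> \<N>. x p ^ j * (\<Prod>i\<in>#M. x i))"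
  proof (rule sum_mono2)
    show "\<phi> ` \<M> \<subseteq> K \<times> \<N>"
      unfolding K_def \<N>_def by (rule subset_fst_snd)
  qed (use x nn Kfin in \<open>auto intro!: mult_nonneg_nonneg\<close>)
  also have "\<dots> = (\<Sum>j\<in>K. x p ^ j) * (\<Sum>M\<in>\<N>. \<Prod>i\<in>#M. x i)"
    by (simp add: sum_product sum.cartesian_product)
  also have "\<dots> \<le> (x p / (1 - x p)) * (\<Prod>i\<in>s. x i / (1 - x i))"
  proof (rule mult_mono)
    have "K \<subseteq> {1..Max (insert 0 K)}"
      using K0 Kfin by (auto simp: Suc_le_eq intro: gr0I)
    hence "(\<Sum>j\<in>K. x p ^ j) \<le> (\<Sum>j\<in>{1..Max (insert 0 K)}. x p ^ j)"
      using x by (intro sum_mono2) auto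
    also have "\<dots> \<le> x p / (1 - x p)"
    proof -
      have "(1 - x p) * (\<Sum>j\<in>{1..m}. x p ^ j) = x p - x p ^ (m + 1)" for m
      proof (induction m)
        case (Suc m)
        have "(1 - x p) * (\<Sum>j\<in>{1..Suc m}. x p ^ j) = (1 - x p) * (\<Sum>j\<in>{1..m}. x p ^ j) + (1 - x p) * x p ^ Suc m"
          by (simp add: distrib_left)
        also have "\<dots> = x p - x p ^ (Suc m + 1)"
          unfolding Suc.IH by (simp add: left_diff_distrib)
        finally show ?case .
      qed simp
      moreover have "x p ^ (m + 1) \<ge> 0" for m using x by simp
      ultimately have "(1 - x p) * (\<Sum>j\<in>{1..m}. x p ^ j) \<le> x p" for m
        by (metis diff_ge_0_iff_ge diff_diff_eq2 add_diff_cancel_left')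
      thus ?thesis using x by (simp add: field_simps)
    qed
    finally show "(\<Sum>j\<in>K. x p ^ j) \<le> x p / (1 - x p)" .
    show "(\<Sum>M\<in>\<N>. \<Prod>i\<in>#M. x i) \<le> (\<Prod>i\<in>s. x i / (1 - x i))"
    proof (rule insert.IH)
      fix M assume "M \<in> \<N>"
      thus "set_mset M = s" using insert.prems(3) insert.hyps(2) by (auto simp: \<N>_def \<phi>_def)
    qed (use insert.prems Kfin in auto)
  qed (use x nn in \<open>auto intro!: sum_nonneg\<close>)
  finally show ?case using insert by simp
qed

text \<open>Unique factorization enters the estimates only through this count, that is, through the
  zeta function \<open>1 / (1 - q u)\<close>; no polynomials are involved. As \<open>q ^ n\<close>
  is not 0, the count also makes each set of multisets finite.\<close>

locale prime_system =
  fixes I :: "'i set" and dg :: "'i \<Rightarrow> nat" and q :: nat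
  assumes q_ge_2: "q \<ge> 2"
    and dg_pos: "i \<in> I \<Longrightarrow> dg i \<ge> 1"
    and card_multisets: "card {M. set_mset M \<subseteq> I \<and> (\<Sum>i\<in>#M. dg i) = n} = q ^ n"
begin

definition ms :: "nat \<Rightarrow> 'i multiset set" where
  "ms n = {M. set_mset M \<subseteq> I \<and> (\<Sum>i\<in>#M. dg i) = n}"

definition num :: "nat \<Rightarrow> nat" where "num n = card {i\<in>I. dg i = n}"

lemma q_pos [simp]: "q > 0" "real q > 0"
  using q_ge_2 by auto

lemma card_ms: "card (ms n) = q ^ n"
  using card_multisets by (simp add: ms_def)

lemma finite_ms [simp]: "finite (ms n)"
proof (rule ccontr)
  assume "infinite (ms n)"
  thus False using card_ms[of n] q_pos(1) by simp
qed

lemma finite_degree_eq [simp]: "finite {i\<in>I. dg i = n}"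
proof (rule finite_imageD)
  show "finite ((\<lambda>i. {#i#}) ` {i\<in>I. dg i = n})"
    by (rule finite_subset[OF _ finite_ms[of n]]) (auto simp: ms_def)
qed (auto intro: inj_onI)

lemma finite_degree_le [simp]: "finite {i\<in>I. dg i \<le> n}"
proof -
  have "{i\<in>I. dg i \<le> n} = (\<Union>m\<in>{..n}. {i\<in>I. dg i = m})" by auto
  thus ?thesis by simp
qed

lemma count_le_degree:
  assumes "M \<in> ms n" "i \<in># M"
  shows "count M i * dg i \<le> n" "dg i \<le> n" "count M i \<le> n"
proof -
  have "(\<Sum>i\<in>#M. dg i) = (\<Sum>i\<in>set_mset M. count M i * dg i)"
    by (rule sum_mset_conv_sum_count) auto
  hence "n = (\<Sum>i\<in>set_mset M. count M i * dg i)" using assms by (simp add: ms_def)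
  also have "\<dots> \<ge> count M i * dg i" using assms(2) by (intro member_le_sum) auto
  finally show 1: "count M i * dg i \<le> n" .
  have "count M i \<ge> 1" "dg i \<ge> 1" using assms dg_pos by (auto simp: ms_def Suc_le_eq)
  thus "dg i \<le> n" "count M i \<le> n"
    using 1 by (metis le_trans mult_le_mono1 nat_mult_1, metis le_trans mult_le_mono2 mult.right_neutral)
qed

lemma card_ms_count_ge:
  assumes "i \<in> I"
  shows "card {M\<in>ms n. j \<le> count M i} = (if j * dg i \<le> n then q ^ (n - j * dg i) else 0)"
proof (cases "j * dg i \<le> n")
  case True
  have "bij_betw (\<lambda>M. M + replicate_mset j i) (ms (n - j * dg i)) {M\<in>ms n. j \<le> count M i}"
  proof (rule bij_betw_byWitness[where f' = "\<lambda>M. M - replicate_mset j i"])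
    have sub: "replicate_mset j i \<subseteq># M" if "j \<le> count M i" for M
      using that by (simp add: subseteq_mset_def)
    show "\<forall>M\<in>{M\<in>ms n. j \<le> count M i}. M - replicate_mset j i + replicate_mset j i = M"
      using sub by auto
    show "(\<lambda>M. M - replicate_mset j i) ` {M \<in> ms n. j \<le> count M i} \<subseteq> ms (n - j * dg i)"
    proof clarify
      fix M assume M: "M \<in> ms n" "j \<le> count M i"
      have "(\<Sum>k\<in>#M - replicate_mset j i + replicate_mset j i. dg k) = n"
        using M sub by (simp add: ms_def)
      hence "(\<Sum>k\<in>#M - replicate_mset j i. dg k) + j * dg i = n"
        by (simp only: image_mset_union sum_mset.union image_replicate_mset sum_mset_replicate_mset) simp
      thus "M - replicate_mset j i \<in> ms (n - j * dg i)"
        using M by (auto simp: ms_def dest: in_diffD)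
    qed
    show "(\<lambda>M. M + replicate_mset j i) ` ms (n - j * dg i) \<subseteq> {M\<in>ms n. j \<le> count M i}"
    proof clarify
      fix M assume M: "M \<in> ms (n - j * dg i)"
      hence "(\<Sum>k\<in>#M + replicate_mset j i. dg k) = n"
        using True by (simp only: image_mset_union sum_mset.union image_replicate_mset sum_mset_replicate_mset) (simp add: ms_def)
      thus "M + replicate_mset j i \<in> ms n \<and> j \<le> count (M + replicate_mset j i) i"
        using M assms by (auto simp: ms_def split: if_splits)
    qed
  qed simp
  from bij_betw_same_card[OF this] show ?thesis using True by (simp add: card_ms)
next
  case False
  have "{M\<in>ms n. j \<le> count M i} = {}"
  proof clarsimp
    fix M assume M: "M \<in> ms n" "j \<le> count M i"
    hence "j * dg i \<le> count M i * dg i" by simp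
    moreover have "i \<in># M" using False M by (metis M(2) count_inI le_zero_eq mult_is_0 zero_le)
    ultimately show False using False count_le_degree(1)[OF M(1), of i] by linarith
  qed
  thus ?thesis using False by simp
qed

text \<open>The von Mangoldt function, summed over all prime powers of degree \<open>m\<close>.\<close>

definition lam :: "nat \<Rightarrow> nat" where
  "lam m = (\<Sum>i\<in>{i\<in>I. dg i \<le> m \<and> dg i dvd m}. dg i)"

text \<open>The convolution identity \<open>log = Lambda * 1\<close>, by double counting:
  \<open>n * q ^ n\<close> adds up the degrees of all multisets of degree \<open>n\<close>, a degree
  is a sum over the prime powers contained in the multiset, and a prime power of degree
  \<open>m\<close> is contained in \<open>q ^ (n - m)\<close> of them.\<close>

lemma sum_lam: "(\<Sum>m\<in>{1..n}. lam m * q ^ (n - m)) = n * q ^ n"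
proof -
  define J where "J = {i\<in>I. dg i \<le> n}"
  have J: "finite J" unfolding J_def by simp
  have "n * q ^ n = (\<Sum>M\<in>ms n. n)" by (simp add: card_ms)
  also have "\<dots> = (\<Sum>M\<in>ms n. \<Sum>i\<in>J. \<Sum>j\<in>{1..n}. if j \<le> count M i then dg i else 0)"
  proof (rule sum.cong[OF refl])
    fix M assume M: "M \<in> ms n"
    have "n = (\<Sum>i\<in>#M. dg i)" using M by (simp add: ms_def)
    also have "\<dots> = (\<Sum>i\<in>J. count M i * dg i)"
      using M count_le_degree(2)[OF M] by (intro sum_mset_conv_sum_count J) (auto simp: J_def ms_def)
    also have "\<dots> = (\<Sum>i\<in>J. \<Sum>j\<in>{1..n}. if j \<le> count M i then dg i else 0)"
    proof (rule sum.cong[OF refl])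
      fix i
      have "count M i \<le> n"
        using count_le_degree(3)[OF M, of i] by (cases "i \<in># M") (auto simp: not_in_iff)
      hence "{j\<in>{1..n}. j \<le> count M i} = {1..count M i}" by auto
      thus "count M i * dg i = (\<Sum>j\<in>{1..n}. if j \<le> count M i then dg i else 0)"
        by (simp flip: sum.inter_filter)
    qed
    finally show "n = \<dots>" .
  qed
  also have "\<dots> = (\<Sum>i\<in>J. \<Sum>M\<in>ms n. \<Sum>j\<in>{1..n}. if j \<le> count M i then dg i else 0)"
    by (rule sum.swap)
  also have "\<dots> = (\<Sum>i\<in>J. \<Sum>j\<in>{1..n}. \<Sum>M\<in>ms n. if j \<le> count M i then dg i else 0)"
    by (intro sum.cong refl sum.swap)
  also have "\<dots> = (\<Sum>i\<in>J. \<Sum>j\<in>{1..n}. if j * dg i \<le> n then dg i * q ^ (n - j * dg i) else 0)"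
    by (intro sum.cong refl, subst sum.inter_filter[symmetric])
       (auto simp: card_ms_count_ge J_def)
  also have "\<dots> = (\<Sum>i\<in>J. \<Sum>m\<in>{1..n}. if dg i dvd m then dg i * q ^ (n - m) else 0)"
  proof (rule sum.cong[OF refl])
    fix i assume "i \<in> J"
    thus "(\<Sum>j\<in>{1..n}. if j * dg i \<le> n then dg i * q ^ (n - j * dg i) else 0)
        = (\<Sum>m\<in>{1..n}. if dg i dvd m then dg i * q ^ (n - m) else 0)"
      using sum_over_multiples[of "dg i" n "\<lambda>m. dg i * q ^ (n - m)"] dg_pos by (auto simp: J_def)
  qed
  also have "\<dots> = (\<Sum>m\<in>{1..n}. \<Sum>i\<in>J. if dg i dvd m then dg i * q ^ (n - m) else 0)"
    by (rule sum.swap)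
  also have "\<dots> = (\<Sum>m\<in>{1..n}. lam m * q ^ (n - m))"
  proof (rule sum.cong[OF refl])
    fix m assume m: "m \<in> {1..n}"
    have "{i\<in>J. dg i dvd m} = {i\<in>I. dg i \<le> m \<and> dg i dvd m}"
      using m by (auto simp: J_def dest: dvd_imp_le)
    thus "(\<Sum>i\<in>J. if dg i dvd m then dg i * q ^ (n - m) else 0) = lam m * q ^ (n - m)"
      unfolding lam_def by (subst sum.inter_filter[symmetric, OF J]) (simp add: sum_distrib_right)
  qed
  finally show ?thesis by simp
qed

text \<open>Subtracting \<open>q\<close> times the identity \<open>sum_lam\<close> for
  \<open>n - 1\<close> isolates the last summand.\<close>

lemma lam_eq: assumes "n \<ge> 1" shows "lam n = q ^ n"
proof -
  obtain n' where n: "n = Suc n'" using assms by (cases n) auto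
  have "(\<Sum>m\<in>{1..n}. lam m * q ^ (n - m)) = (\<Sum>m\<in>{1..n'}. lam m * q ^ (n - m)) + lam n"
    by (simp add: n)
  also have "(\<Sum>m\<in>{1..n'}. lam m * q ^ (n - m)) = q * (\<Sum>m\<in>{1..n'}. lam m * q ^ (n' - m))"
    unfolding sum_distrib_left by (intro sum.cong) (auto simp: n Suc_diff_le)
  finally show ?thesis unfolding sum_lam by (simp add: n algebra_simps)
qed

lemma num_le: assumes "n \<ge> 1" shows "n * num n \<le> q ^ n"
proof -
  have "n * num n = (\<Sum>i\<in>{i\<in>I. dg i = n}. dg i)" by (simp add: num_def)
  also have "\<dots> \<le> lam n"
    unfolding lam_def by (intro sum_mono2 finite_subset[OF _ finite_degree_le[of n]]) auto
  finally show ?thesis using lam_eq[OF assms] by simp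
qed

text \<open>In \<open>q ^ n = lam n\<close> the primes of degree other than \<open>n\<close> have
  degree at most \<open>n div 2\<close>. By \<open>num_le\<close> they contribute at most
  \<open>2 * q ^ (n div 2)\<close>, which is at most half of \<open>q ^ n\<close>.\<close>

lemma num_ge: assumes "n \<ge> 4" shows "q ^ n \<le> 2 * (n * num n)"
proof -
  define h where "h = n div 2"
  have "q ^ n = lam n" using assms lam_eq by simp
  also have "\<dots> \<le> (\<Sum>i\<in>{i\<in>I. dg i = n} \<union> (\<Union>m\<in>{1..h}. {i\<in>I. dg i = m}). dg i)"
    unfolding lam_def
  proof (rule sum_mono2)
    show "{i \<in> I. dg i \<le> n \<and> dg i dvd n} \<subseteq> {i \<in> I. dg i = n} \<union> (\<Union>m\<in>{1..h}. {i \<in> I. dg i = m})"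
    proof (rule subsetI, rule ccontr)
      fix i assume "i \<in> {i \<in> I. dg i \<le> n \<and> dg i dvd n}"
        and "i \<notin> {i \<in> I. dg i = n} \<union> (\<Union>m\<in>{1..h}. {i \<in> I. dg i = m})"
      hence i: "i \<in> I" "dg i dvd n" "\<not> (1 \<le> dg i \<and> dg i \<le> h)" "dg i \<noteq> n" by auto
      obtain e where e: "n = dg i * e" using i by (auto elim: dvdE)
      have "e \<noteq> 0" using e assms by (intro notI) simp
      have "\<not> e \<ge> 2"
      proof
        assume "e \<ge> 2"
        hence "dg i * 2 \<le> n" unfolding e by simp
        thus False using i dg_pos[of i] by (auto simp: h_def)
      qed
      with e \<open>e \<noteq> 0\<close> have "e = 1" by linarith
      thus False using e i by simp
    qed
  qed auto
  also have "\<dots> \<le> (\<Sum>i\<in>{i\<in>I. dg i = n}. dg i) + (\<Sum>i\<in>(\<Union>m\<in>{1..h}. {i\<in>I. dg i = m}). dg i)"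
    by (subst sum.union_inter[symmetric]) auto
  also have "(\<Sum>i\<in>(\<Union>m\<in>{1..h}. {i\<in>I. dg i = m}). dg i) = (\<Sum>m\<in>{1..h}. \<Sum>i\<in>{i\<in>I. dg i = m}. dg i)"
    by (rule sum.UNION_disjoint) auto
  also have "\<dots> = (\<Sum>m\<in>{1..h}. m * num m)" by (simp add: num_def mult.commute)
  also have "\<dots> \<le> (\<Sum>m\<in>{1..h}. q ^ m)" by (intro sum_mono num_le) auto
  also have "\<dots> \<le> 2 * q ^ h"
  proof (induction h)
    case (Suc h)
    have "2 * q ^ h \<le> q * q ^ h" using q_ge_2 by (intro mult_right_mono) auto
    moreover have "(\<Sum>m\<in>{1..Suc h}. q ^ m) = (\<Sum>m\<in>{1..h}. q ^ m) + q * q ^ h" by simp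
    ultimately show ?case using Suc unfolding power_Suc by linarith
  qed simp
  finally have 1: "q ^ n \<le> n * num n + 2 * q ^ h" by (simp add: num_def mult.commute)
  have "4 * q ^ h \<le> q ^ 2 * q ^ h"
    using power_mono[OF q_ge_2, of 2] by (intro mult_right_mono) (simp_all add: power2_eq_square)
  also have "\<dots> = q ^ (2 + h)" by (rule power_add[symmetric])
  also have "\<dots> \<le> q ^ n" using assms q_ge_2 by (intro power_increasing) (auto simp: h_def)
  finally show ?thesis using 1 by simp
qed

section \<open>Sums over squarefree moduli and Mertens products\<close>

definition nm :: "'i \<Rightarrow> real" where "nm i = real q ^ dg i"

lemma nm_ge_2: "i \<in> I \<Longrightarrow> nm i \<ge> 2"
proof -
  assume "i \<in> I"
  hence "real q ^ 1 \<le> real q ^ dg i"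
    using dg_pos q_ge_2 by (intro power_increasing) auto
  thus ?thesis using q_ge_2 unfolding nm_def power_one_right by linarith
qed

definition sqf :: "'i set \<Rightarrow> nat \<Rightarrow> 'i set set" where
  "sqf J Z = {s. finite s \<and> s \<subseteq> J \<and> (\<Sum>i\<in>s. dg i) \<le> Z}"

text \<open>The sum of \<open>1 / \<phi>(D)\<close> over the squarefree \<open>D\<close> of degree at most \<open>Z\<close> with all prime divisors in \<open>J\<close>.\<close>

definition tot :: "'i set \<Rightarrow> nat \<Rightarrow> real" where
  "tot J Z = (\<Sum>s\<in>sqf J Z. \<Prod>i\<in>s. 1 / (nm i - 1))"

lemma sqf_dg_le: "s \<in> sqf J Z \<Longrightarrow> i \<in> s \<Longrightarrow> dg i \<le> Z"
  using member_le_sum[of i s dg] by (auto simp: sqf_def)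

lemma finite_sqf: "J \<subseteq> I \<Longrightarrow> finite (sqf J Z)"
  by (rule finite_subset[of _ "Pow {i\<in>I. dg i \<le> Z}"])
     (use sqf_dg_le in \<open>auto simp: sqf_def\<close>)

text \<open>Each degree up to \<open>Z\<close> contributes exactly 1 to the sum of
  \<open>1 / q ^ deg M\<close> over multisets \<open>M\<close>. Grouping by support and summing
  geometric series produces the weights \<open>1 / (nm i - 1)\<close>; a support has at most the
  degree of its multiset.\<close>

lemma tot_I_ge: "real Z + 1 \<le> tot I Z"
proof -
  define U where "U = (\<Union>n\<in>{..Z}. ms n)"
  have U: "finite U" by (simp add: U_def)
  have pm: "(\<Prod>i\<in>#M. 1 / nm i) = 1 / real q ^ (\<Sum>i\<in>#M. dg i)" for M
    by (induction M) (auto simp: nm_def power_add)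
  have "real Z + 1 = (\<Sum>n\<in>{..Z}. \<Sum>M\<in>ms n. 1 / real q ^ n)"
    using q_ge_2 by (simp add: card_ms)
  also have "\<dots> = (\<Sum>n\<in>{..Z}. \<Sum>M\<in>ms n. \<Prod>i\<in>#M. 1 / nm i)"
    by (intro sum.cong refl) (auto simp: pm ms_def)
  also have "\<dots> = (\<Sum>M\<in>U. \<Prod>i\<in>#M. 1 / nm i)"
    unfolding U_def by (rule sum.UNION_disjoint[symmetric], simp_all, auto simp: ms_def)
  also have "\<dots> = (\<Sum>s\<in>sqf I Z. \<Sum>M\<in>{M\<in>U. set_mset M = s}. \<Prod>i\<in>#M. 1 / nm i)"
  proof (rule sum.group[symmetric, OF U finite_sqf])
    show "set_mset ` U \<subseteq> sqf I Z"
    proof clarify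
      fix M assume M: "M \<in> U"
      have "(\<Sum>i\<in>set_mset M. dg i) \<le> (\<Sum>i\<in>set_mset M. count M i * dg i)"
        by (intro sum_mono) (simp add: Suc_le_eq)
      also have "\<dots> = (\<Sum>i\<in>#M. dg i)" by (rule sum_mset_conv_sum_count[symmetric]) auto
      finally show "set_mset M \<in> sqf I Z" using M by (auto simp: sqf_def U_def ms_def)
    qed
  qed auto
  also have "\<dots> \<le> (\<Sum>s\<in>sqf I Z. \<Prod>i\<in>s. (1 / nm i) / (1 - 1 / nm i))"
  proof (intro sum_mono sum_mset_with_support_le)
    fix s i assume "s \<in> sqf I Z" "i \<in> s"
    hence "nm i \<ge> 2" using nm_ge_2 by (auto simp: sqf_def)
    thus "0 < 1 / nm i \<and> 1 / nm i < 1" by auto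
  qed (use U in \<open>auto simp: sqf_def\<close>)
  also have "\<dots> = tot I Z"
    unfolding tot_def
  proof (intro sum.cong prod.cong refl)
    fix s i assume "s \<in> sqf I Z" "i \<in> s"
    hence "nm i \<ge> 2" using nm_ge_2 by (auto simp: sqf_def)
    thus "(1 / nm i) / (1 - 1 / nm i) = 1 / (nm i - 1)" by (simp add: field_simps)
  qed
  finally show ?thesis .
qed

text \<open>Split \<open>s\<close> into \<open>s \<inter> J\<close> and \<open>s - J\<close> and
  forget the degree bound on the total: then \<open>tot I Z\<close> is at most
  \<open>tot J Z\<close> times the inverse Euler product over the excluded primes. Excluding primes
  thus costs no more than their Euler factors.\<close>

lemma tot_ge:
  assumes J: "J \<subseteq> I"
  shows "(real Z + 1) * (\<Prod>i\<in>{i\<in>I-J. dg i \<le> Z}. 1 - 1 / nm i) \<le> tot J Z"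
proof -
  define T where "T = {i\<in>I-J. dg i \<le> Z}"
  have T: "finite T" unfolding T_def by (rule finite_subset[OF _ finite_degree_le[of Z]]) auto
  define g where "g s = (\<Prod>i\<in>s. 1 / (nm i - 1))" for s
  have g: "g s \<ge> 0" if "s \<subseteq> I" for s
    unfolding g_def using that nm_ge_2 by (intro prod_nonneg) force
  have inj: "inj_on (\<lambda>s. (s \<inter> J, s - J)) S" for S
    by (rule inj_onI) auto
  have "real Z + 1 \<le> tot I Z" by (rule tot_I_ge)
  also have "\<dots> = (\<Sum>s\<in>sqf I Z. (\<lambda>(a, b). g a * g b) (s \<inter> J, s - J))"
    unfolding tot_def
  proof (intro sum.cong refl)
    fix s assume "s \<in> sqf I Z"
    hence "finite s" by (simp add: sqf_def)
    thus "(\<Prod>i\<in>s. 1 / (nm i - 1)) = (\<lambda>(a, b). g a * g b) (s \<inter> J, s - J)"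
      by (simp add: g_def prod.union_disjoint[symmetric] Int_Diff_Un Int_Diff_disjoint)
  qed
  also have "\<dots> = (\<Sum>(a, b)\<in>(\<lambda>s. (s \<inter> J, s - J)) ` sqf I Z. g a * g b)"
    by (subst sum.reindex[OF inj]) simp
  also have "\<dots> \<le> (\<Sum>(a, b)\<in>sqf J Z \<times> Pow T. g a * g b)"
  proof (rule sum_mono2)
    show "(\<lambda>s. (s \<inter> J, s - J)) ` sqf I Z \<subseteq> sqf J Z \<times> Pow T"
    proof clarify
      fix s assume s: "s \<in> sqf I Z"
      have "(\<Sum>i\<in>s \<inter> J. dg i) \<le> (\<Sum>i\<in>s. dg i)"
        using s by (intro sum_mono2) (auto simp: sqf_def)
      thus "s \<inter> J \<in> sqf J Z \<and> s - J \<in> Pow T"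
        using s sqf_dg_le[OF s] by (auto simp: sqf_def T_def)
    qed
  next
    fix y assume "y \<in> sqf J Z \<times> Pow T - (\<lambda>s. (s \<inter> J, s - J)) ` sqf I Z"
    then obtain a b where "y = (a, b)" "a \<in> sqf J Z" "b \<in> Pow T" by blast
    thus "0 \<le> (case y of (a, b) \<Rightarrow> g a * g b)"
      using J by (auto simp: sqf_def T_def intro!: mult_nonneg_nonneg g)
  qed (use T finite_sqf[OF J] in auto)
  also have "\<dots> = (\<Sum>a\<in>sqf J Z. g a) * (\<Sum>b\<in>Pow T. g b)"
    by (simp add: sum_product sum.cartesian_product)
  also have "(\<Sum>a\<in>sqf J Z. g a) = tot J Z" by (simp add: tot_def g_def)
  also have "(\<Sum>b\<in>Pow T. g b) = (\<Prod>i\<in>T. 1 / (nm i - 1) + 1)"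
    by (subst prod_add[OF T]) (simp add: g_def)
  also have "\<dots> = (\<Prod>i\<in>T. 1 / (1 - 1 / nm i))"
  proof (intro prod.cong refl)
    fix i assume "i \<in> T"
    hence "nm i \<ge> 2" using nm_ge_2 by (auto simp: T_def)
    thus "1 / (nm i - 1) + 1 = 1 / (1 - 1 / nm i)" by (simp add: field_simps)
  qed
  also have "\<dots> = 1 / (\<Prod>i\<in>T. 1 - 1 / nm i)" by (simp add: prod_dividef)
  finally have 1: "real Z + 1 \<le> tot J Z * (1 / (\<Prod>i\<in>T. 1 - 1 / nm i))" .
  have "0 < (\<Prod>i\<in>T. 1 - 1 / nm i)"
    using nm_ge_2 by (intro prod_pos) (force simp: T_def)
  with 1 show ?thesis unfolding T_def[symmetric] by (simp add: field_simps)
qed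

text \<open>The leading 1 pays for the term \<open>m = a + 1\<close>, so that \<open>a = 0\<close>
  is covered as well.\<close>

lemma sum_inverse_le_ln:
  assumes "a \<le> b"
  shows "(\<Sum>m\<in>{a<..b}. 1 / real m) \<le> 1 + ln ((real b + 1) / (real a + 1))"
proof (cases "a = b")
  case False
  hence "Suc a \<le> b" using assms by simp
  hence "(\<Sum>m\<in>{a<..b}. 1 / real m) \<le> 1 + ln (real b / (real a + 1))"
  proof (induction b rule: dec_induct)
    case base
    have "{a<..Suc a} = {Suc a}" by auto
    thus ?case by (simp add: add.commute)
  next
    case (step b)
    have "{a<..Suc b} = insert (Suc b) {a<..b}" using step by auto
    hence "(\<Sum>m\<in>{a<..Suc b}. 1 / real m) = 1 / real (Suc b) + (\<Sum>m\<in>{a<..b}. 1 / real m)" by simp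
    moreover have "1 / real (Suc b) \<le> ln (real (Suc b) / real b)"
    proof -
      have b: "real b > 0" using step by simp
      have "ln (real b / real (Suc b)) \<le> real b / real (Suc b) - 1"
        using b by (intro ln_le_minus_one) auto
      moreover have "ln (real b / real (Suc b)) = - ln (real (Suc b) / real b)"
        using b by (simp add: ln_div)
      moreover have "real b / real (Suc b) - 1 = - (1 / real (Suc b))" by (simp add: field_simps)
      ultimately show ?thesis by linarith
    qed
    moreover have "ln (real (Suc b) / real b) + ln (real b / (real a + 1)) = ln (real (Suc b) / (real a + 1))"
      using step by (simp add: ln_div)
    ultimately show ?case using step.IH by linarith
  qed
  also have "ln (real b / (real a + 1)) \<le> ln ((real b + 1) / (real a + 1))"
    using \<open>Suc a \<le> b\<close> by (intro ln_mono divide_right_mono) auto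
  finally show ?thesis by simp
qed simp

lemma prod_ge_exp:
  fixes x :: "'c \<Rightarrow> real"
  assumes "\<And>i. i \<in> J \<Longrightarrow> 0 \<le> x i \<and> x i \<le> 1/2"
  shows "exp (- (\<Sum>i\<in>J. x i + 2 * (x i)\<^sup>2)) \<le> (\<Prod>i\<in>J. 1 - x i)"
proof (cases "finite J")
  case True
  have "exp (- (\<Sum>i\<in>J. x i + 2 * (x i)\<^sup>2)) = (\<Prod>i\<in>J. exp (- (x i + 2 * (x i)\<^sup>2)))"
    using True by (simp add: exp_sum sum_negf[symmetric] del: exp_minus)
  also have "\<dots> \<le> (\<Prod>i\<in>J. 1 - x i)"
  proof (rule prod_mono, safe)
    fix i assume "i \<in> J"
    with assms have x: "0 \<le> x i" "x i \<le> 1/2" by auto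
    have "- (x i + 2 * (x i)\<^sup>2) \<le> ln (1 - x i)"
      using ln_one_minus_pos_lower_bound[OF x] by simp
    hence "exp (- (x i + 2 * (x i)\<^sup>2)) \<le> exp (ln (1 - x i))" by simp
    thus "exp (- (x i + 2 * (x i)\<^sup>2)) \<le> 1 - x i" using x by simp
  qed simp
  finally show ?thesis .
qed simp

lemma inv_nm: "i \<in> I \<Longrightarrow> 0 \<le> 1 / nm i \<and> 1 / nm i \<le> 1 / 2"
  using nm_ge_2[of i] by (auto simp: field_simps)

text \<open>By \<open>num_le\<close> the primes of degree \<open>m\<close> contribute at most
  \<open>1 / m\<close> to the sum of \<open>1 / nm i\<close>. The exponent 3 consists of the
  constant 1 of the harmonic sum and 2 for the quadratic terms, which add up to at most
  \<open>2 * (1/2) ^ m\<close> in degree \<open>m\<close>.\<close>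

lemma mertens_bound:
  assumes "a \<le> b" and J: "J \<subseteq> {i\<in>I. a < dg i \<and> dg i \<le> b}"
  shows "exp (-3) * ((real a + 1) / (real b + 1)) \<le> (\<Prod>i\<in>J. 1 - 1 / nm i)"
proof -
  have fin: "finite {i\<in>I. a < dg i \<and> dg i \<le> b}"
    by (rule finite_subset[OF _ finite_degree_le[of b]]) auto
  have "(\<Sum>i\<in>J. 1 / nm i + 2 * (1 / nm i)\<^sup>2) \<le> (\<Sum>i\<in>{i\<in>I. a < dg i \<and> dg i \<le> b}. 1 / nm i + 2 * (1 / nm i)\<^sup>2)"
    using J fin inv_nm by (intro sum_mono2) (auto intro!: add_nonneg_nonneg)
  also have "{i\<in>I. a < dg i \<and> dg i \<le> b} = (\<Union>m\<in>{a<..b}. {i\<in>I. dg i = m})" by auto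
  also have "(\<Sum>i\<in>\<dots>. 1 / nm i + 2 * (1 / nm i)\<^sup>2)
      = (\<Sum>m\<in>{a<..b}. \<Sum>i\<in>{i\<in>I. dg i = m}. 1 / nm i + 2 * (1 / nm i)\<^sup>2)"
    by (rule sum.UNION_disjoint) auto
  also have "\<dots> \<le> (\<Sum>m\<in>{a<..b}. 1 / real m + 2 * (1/2) ^ m)"
  proof (rule sum_mono)
    fix m assume m: "m \<in> {a<..b}"
    define x where "x = 1 / real q ^ m"
    have x: "x > 0" "x \<le> (1/2) ^ m"
      using q_ge_2 by (auto simp: x_def power_one_over intro!: divide_left_mono power_mono)
    have "real m * real (num m) \<le> real q ^ m"
      using num_le[of m] m by (metis greaterThanAtMost_iff less_one linorder_not_less not_less_zero of_nat_le_iff of_nat_mult of_nat_power less_nat_zero_code)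
    hence le: "real (num m) * x \<le> 1 / real m" using m by (simp add: x_def field_simps)
    have "(\<Sum>i\<in>{i\<in>I. dg i = m}. 1 / nm i + 2 * (1 / nm i)\<^sup>2) = (\<Sum>i\<in>{i\<in>I. dg i = m}. x + 2 * x\<^sup>2)"
      by (intro sum.cong refl) (auto simp: nm_def x_def)
    also have "\<dots> = real (num m) * x + 2 * x * (real (num m) * x)"
      by (simp add: num_def power2_eq_square algebra_simps)
    also have "\<dots> \<le> 1 / real m + 2 * x * (real (num m) * x)"
      using le by simp
    also have "2 * x * (real (num m) * x) \<le> 2 * (1/2) ^ m * 1"
    proof (rule mult_mono)
      have "1 / real m \<le> 1" using m by simp
      thus "real (num m) * x \<le> 1" using le by linarith
    qed (use x in auto)
    finally show "(\<Sum>i\<in>{i\<in>I. dg i = m}. 1 / nm i + 2 * (1 / nm i)\<^sup>2) \<le> 1 / real m + 2 * (1/2) ^ m" by simp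
  qed
  also have "\<dots> = (\<Sum>m\<in>{a<..b}. 1 / real m) + 2 * (\<Sum>m\<in>{a<..b}. (1/2) ^ m)"
    by (simp add: sum.distrib sum_distrib_left)
  also have "(\<Sum>m\<in>{a<..b}. (1/2::real) ^ m) \<le> (\<Sum>m\<in>{1..b}. (1/2) ^ m)"
    by (intro sum_mono2) auto
  also have "(\<Sum>m\<in>{1..b}. (1/2::real) ^ m) \<le> 1"
  proof -
    have "(\<Sum>m\<in>{1..b}. (1/2::real) ^ m) = 1 - (1/2) ^ b" by (induction b) auto
    thus ?thesis by simp
  qed
  finally have "(\<Sum>i\<in>J. 1 / nm i + 2 * (1 / nm i)\<^sup>2) \<le> 3 + ln ((real b + 1) / (real a + 1))"
    using sum_inverse_le_ln[OF assms(1)] by simp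
  hence "exp (- (3 + ln ((real b + 1) / (real a + 1)))) \<le> exp (- (\<Sum>i\<in>J. 1 / nm i + 2 * (1 / nm i)\<^sup>2))"
    by simp
  also have "\<dots> \<le> (\<Prod>i\<in>J. 1 - 1 / nm i)"
    using J inv_nm by (intro prod_ge_exp) blast
  also have "exp (- (3 + ln ((real b + 1) / (real a + 1)))) = exp (-3) * ((real a + 1) / (real b + 1))"
    by (simp add: exp_diff exp_minus)
  finally show ?thesis .
qed

text \<open>\<open>J\<close> has at most \<open>(\<Sum>i\<in>J. dg i) / (b + 1)\<close> elements,
  each with \<open>1 / nm i\<close> at most \<open>1 / q ^ (b + 1)\<close>. The factor 2 comes from
  \<open>x + 2 * x^2 \<le> 2 * x\<close> for \<open>x \<le> 1/2\<close>.\<close>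

lemma tail_bound:
  assumes J: "finite J" "J \<subseteq> {i\<in>I. b < dg i}"
  shows "exp (- 2 * (real (\<Sum>i\<in>J. dg i) / ((real b + 1) * real q ^ (b + 1)))) \<le> (\<Prod>i\<in>J. 1 - 1 / nm i)"
proof -
  have "(\<Sum>i\<in>J. 1 / nm i + 2 * (1 / nm i)\<^sup>2) \<le> (\<Sum>i\<in>J. 2 * (real (dg i) / ((real b + 1) * real q ^ (b + 1))))"
  proof (rule sum_mono)
    fix i assume "i \<in> J"
    hence i: "i \<in> I" "b < dg i" using J by auto
    have "1 / nm i * (1 / nm i) \<le> 1 / nm i * (1 / 2)"
      using inv_nm[OF i(1)] by (intro mult_left_mono) auto
    hence "1 / nm i + 2 * (1 / nm i)\<^sup>2 \<le> 2 * (1 / nm i)" by (simp add: power2_eq_square)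
    also have "1 / nm i \<le> 1 / real q ^ (b + 1)"
      unfolding nm_def using i q_ge_2 by (intro divide_left_mono power_increasing mult_pos_pos zero_less_power) auto
    also have "\<dots> = (real b + 1) / ((real b + 1) * real q ^ (b + 1))" by simp
    also have "\<dots> \<le> real (dg i) / ((real b + 1) * real q ^ (b + 1))"
      using i by (intro divide_right_mono) auto
    finally show "1 / nm i + 2 * (1 / nm i)\<^sup>2 \<le> 2 * (real (dg i) / ((real b + 1) * real q ^ (b + 1)))" by simp
  qed
  also have "\<dots> = 2 * (real (\<Sum>i\<in>J. dg i) / ((real b + 1) * real q ^ (b + 1)))"
    by (simp add: sum_distrib_left sum_divide_distrib)
  finally have "exp (- 2 * (real (\<Sum>i\<in>J. dg i) / ((real b + 1) * real q ^ (b + 1))))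
      \<le> exp (- (\<Sum>i\<in>J. 1 / nm i + 2 * (1 / nm i)\<^sup>2))" by simp
  also have "\<dots> \<le> (\<Prod>i\<in>J. 1 - 1 / nm i)"
    using J inv_nm by (intro prod_ge_exp) blast
  finally show ?thesis .
qed

text \<open>
  Few elements of \<open>J\<close> can have degree above \<open>max Y L\<close>; between \<open>Y\<close> and \<open>max Y L\<close> all elements are
  admitted at the price of the factor \<open>L + 1\<close>.
\<close>

lemma prod_divisors_ge:
  assumes J: "finite J" "J \<subseteq> I" and deg: "(\<Sum>i\<in>J. dg i) \<le> 6 * (Y + 1) + k" and L: "k + 1 \<le> q ^ L"
  shows "exp (-10) / (real L + 1) \<le> (\<Prod>i\<in>{i\<in>J. Y < dg i}. 1 - 1 / nm i)"
proof -
  define b where "b = max Y L"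
  have "{i\<in>J. Y < dg i} = {i\<in>J. Y < dg i \<and> dg i \<le> b} \<union> {i\<in>J. b < dg i}"
    by (auto simp: b_def)
  hence "(\<Prod>i\<in>{i\<in>J. Y < dg i}. 1 - 1 / nm i)
      = (\<Prod>i\<in>{i\<in>J. Y < dg i \<and> dg i \<le> b}. 1 - 1 / nm i) * (\<Prod>i\<in>{i\<in>J. b < dg i}. 1 - 1 / nm i)"
    using J by (simp, subst prod.union_disjoint) auto
  also have "\<dots> \<ge> (exp (-3) * ((real Y + 1) / (real b + 1))) * exp (-7)"
  proof (rule mult_mono)
    show "exp (-3) * ((real Y + 1) / (real b + 1)) \<le> (\<Prod>i\<in>{i\<in>J. Y < dg i \<and> dg i \<le> b}. 1 - 1 / nm i)"
      using J by (intro mertens_bound) (auto simp: b_def)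
    have "(\<Sum>i\<in>{i\<in>J. b < dg i}. dg i) \<le> (\<Sum>i\<in>J. dg i)"
      using J by (intro sum_mono2) auto
    also have "\<dots> \<le> 6 * (b + 1) + q ^ b"
    proof -
      have "q ^ L \<le> q ^ b" using q_ge_2 by (intro power_increasing) (auto simp: b_def)
      hence "k \<le> q ^ b" using L by (metis add_leD1 order_trans)
      moreover have "6 * (Y + 1) \<le> 6 * (b + 1)" by (simp add: b_def)
      ultimately show ?thesis using deg by (meson add_mono order_trans)
    qed
    also have "\<dots> \<le> 6 * ((b + 1) * q ^ b) + (b + 1) * q ^ b"
    proof -
      have "(b + 1) * 1 \<le> (b + 1) * q ^ b" by (intro mult_le_mono2) (simp add: Suc_le_eq)
      thus ?thesis by (intro add_mono) auto
    qed
    \<comment> \<open>The 2 is the one in the exponent of \<open>tail_bound\<close>; it is absorbed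
      by one more factor \<open>q\<close>.\<close>
    also have "2 * \<dots> \<le> 7 * ((b + 1) * q ^ (b + 1))"
    proof -
      have "2 * ((b + 1) * q ^ b) \<le> q * ((b + 1) * q ^ b)" using q_ge_2 by (intro mult_right_mono) auto
      thus ?thesis by (simp add: algebra_simps)
    qed
    finally have "2 * (\<Sum>i\<in>{i\<in>J. b < dg i}. dg i) \<le> 7 * ((b + 1) * q ^ (b + 1))" by simp
    hence "real (2 * (\<Sum>i\<in>{i\<in>J. b < dg i}. dg i)) \<le> real (7 * ((b + 1) * q ^ (b + 1)))"
      by (simp only: of_nat_le_iff)
    hence "2 * real (\<Sum>i\<in>{i\<in>J. b < dg i}. dg i) \<le> 7 * ((real b + 1) * real q ^ (b + 1))"
      by (simp add: algebra_simps)
    hence "exp (-7) \<le> exp (- 2 * (real (\<Sum>i\<in>{i\<in>J. b < dg i}. dg i) / ((real b + 1) * real q ^ (b + 1))))"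
      by (simp add: pos_divide_le_eq)
    also have "\<dots> \<le> (\<Prod>i\<in>{i\<in>J. b < dg i}. 1 - 1 / nm i)"
      using J by (intro tail_bound) auto
    finally show "exp (-7) \<le> (\<Prod>i\<in>{i\<in>J. b < dg i}. 1 - 1 / nm i)" .
    show "0 \<le> (\<Prod>i\<in>{i\<in>J. Y < dg i \<and> dg i \<le> b}. 1 - 1 / nm i)"
      using J inv_nm by (intro prod_nonneg) force
  qed auto
  also have "(exp (-3) * ((real Y + 1) / (real b + 1))) * exp (-7) = exp (-10) * ((real Y + 1) / (real b + 1))"
    by (simp add: exp_add[symmetric])
  finally have "exp (-10) * ((real Y + 1) / (real b + 1)) \<le> (\<Prod>i\<in>{i\<in>J. Y < dg i}. 1 - 1 / nm i)" .
  moreover have "1 / (real L + 1) \<le> (real Y + 1) / (real b + 1)"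
  proof (cases "Y \<le> L")
    case True
    hence "b = L" by (simp add: b_def)
    thus ?thesis by (auto simp: field_simps)
  next
    case False
    hence "b = Y" by (simp add: b_def)
    thus ?thesis by (auto simp: field_simps)
  qed
  hence "exp (-10) * (1 / (real L + 1)) \<le> exp (-10) * ((real Y + 1) / (real b + 1))"
    by (intro mult_left_mono) auto
  ultimately show ?thesis by simp
qed

text \<open>The moduli of the sieve. \<open>J\<close> will be the set of prime divisors of the
  denominator, for which equidistribution reaches less far; hence the separate degree bounds for the
  two parts of a modulus.\<close>

definition family :: "'i set \<Rightarrow> nat \<Rightarrow> nat \<Rightarrow> 'i set set" where
  "family J Y Z = (\<lambda>(s, t). s \<union> t) ` (sqf J Y \<times> sqf (I - J) Z)"

text \<open>By \<open>tot_ge\<close> the two parts yield \<open>Y + 1\<close> and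
  \<open>Z + 1\<close>, times Euler products over \<open>A\<close> and \<open>C\<close>. Joined with
  the small primes of \<open>J\<close>, the product over \<open>A\<close> costs
  \<open>1 / (Y + 1)\<close>, which cancels the first gain; the primes of \<open>J\<close> above
  \<open>Y\<close> cost \<open>1 / (L + 1)\<close>. The result is of order \<open>Z / L\<close>
  whatever \<open>Y\<close> is.\<close>

lemma family_sum_ge:
  assumes J: "finite J" "J \<subseteq> I" and deg: "(\<Sum>i\<in>J. dg i) \<le> 6 * (Y + 1) + k" and L: "k + 1 \<le> q ^ L"
  shows "exp (-13) * ((real Z + 1) / (real L + 1)) \<le> (\<Sum>s\<in>family J Y Z. \<Prod>i\<in>s. 1 / (nm i - 1))"
proof -
  define P where "P s = (\<Prod>i\<in>s. 1 - 1 / nm i)" for s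
  have P0: "P s > 0" if "s \<subseteq> I" for s
    unfolding P_def using that nm_ge_2 by (intro prod_pos) force
  have P1: "P s \<le> 1" if "s \<subseteq> I" for s
    unfolding P_def using that inv_nm by (intro prod_le_1) force
  have Pun: "P (s \<union> t) = P s * P t" if "finite s" "finite t" "s \<inter> t = {}" for s t
    unfolding P_def using that by (rule prod.union_disjoint)
  define A where "A = {i\<in>I-J. dg i \<le> Y}"
  define B where "B = {i\<in>J. dg i \<le> Y}"
  define C where "C = {i\<in>J. dg i \<le> Z}"
  define D where "D = {i\<in>J. Y < dg i}"
  have fin: "finite A" "finite B" "finite C" "finite D"
    using J by (auto simp: A_def B_def C_def D_def intro: finite_subset[OF _ finite_degree_le[of Y]])
  have sub: "A \<subseteq> I" "B \<subseteq> I" "C \<subseteq> I" "D \<subseteq> I"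
    using J by (auto simp: A_def B_def C_def D_def)
  \<comment> \<open>Enlarging \<open>C\<close> to all of \<open>J\<close> only lowers the product;
    splitting \<open>J\<close> again at \<open>Y\<close> releases \<open>B\<close>, which completes
    \<open>A\<close> to all primes of degree up to \<open>Y\<close>.\<close>
  have "P B * P D = P J"
    using J by (subst Pun[symmetric]) (auto simp: B_def D_def intro!: arg_cong[of _ _ P] finite_subset[OF _ J(1)])
  also have "P J = P C * P {i\<in>J. Z < dg i}"
    using J by (subst Pun[symmetric]) (auto simp: C_def intro!: arg_cong[of _ _ P])
  also have "\<dots> \<le> P C * 1"
    using J sub P0[of C] P1[of "{i\<in>J. Z < dg i}"] by (intro mult_left_mono) force+
  finally have PBD: "P B * P D \<le> P C" by simp
  have "exp (-3) * ((real 0 + 1) / (real Y + 1)) \<le> P {i\<in>I. dg i \<le> Y}"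
    unfolding P_def using dg_pos by (intro mertens_bound) force+
  also have "{i\<in>I. dg i \<le> Y} = A \<union> B" using J by (auto simp: A_def B_def)
  also have "P (A \<union> B) = P A * P B" using fin by (intro Pun) (auto simp: A_def B_def)
  finally have AB: "exp (-3) / (real Y + 1) \<le> P A * P B" by simp
  have D: "exp (-10) / (real L + 1) \<le> P D"
    unfolding P_def D_def by (rule prod_divisors_ge[OF J deg L])
  have "exp (-3) / (real Y + 1) * (exp (-10) / (real L + 1)) \<le> (P A * P B) * P D"
    using AB D P0 sub by (intro mult_mono) (auto intro!: mult_nonneg_nonneg less_imp_le[OF P0])
  also have "\<dots> \<le> P A * P C"
    using PBD P0[OF sub(1)] by (simp add: mult.assoc)
  finally have AC: "exp (-3) / (real Y + 1) * (exp (-10) / (real L + 1)) \<le> P A * P C" .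
  have "exp (-13) * ((real Z + 1) / (real L + 1))
      = (real Y + 1) * (real Z + 1) * (exp (-3) / (real Y + 1) * (exp (-10) / (real L + 1)))"
  proof -
    have "exp (-13) = exp (-3) * exp (-10 :: real)" by (simp add: exp_add[symmetric])
    thus ?thesis by (simp add: divide_simps)
  qed
  also have "\<dots> \<le> (real Y + 1) * (real Z + 1) * (P A * P C)"
    using AC by (intro mult_left_mono) auto
  also have "\<dots> = ((real Y + 1) * P A) * ((real Z + 1) * P C)" by simp
  also have "\<dots> \<le> tot J Y * tot (I - J) Z"
  proof (rule mult_mono)
    show "(real Y + 1) * P A \<le> tot J Y"
      unfolding P_def A_def by (rule tot_ge[OF J(2)])
    have "C = {i\<in>I-(I-J). dg i \<le> Z}" using J by (auto simp: C_def)
    thus "(real Z + 1) * P C \<le> tot (I - J) Z"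
      unfolding P_def using tot_ge[of "I - J" Z] by simp
    show "0 \<le> tot J Y"
      using \<open>(real Y + 1) * P A \<le> tot J Y\<close> P0[OF sub(1)] by (smt (verit) mult_pos_pos of_nat_0_le_iff)
    show "0 \<le> (real Z + 1) * P C" using P0[OF sub(3)] by simp
  qed
  also have "\<dots> = (\<Sum>(s, t)\<in>sqf J Y \<times> sqf (I - J) Z. (\<Prod>i\<in>s. 1 / (nm i - 1)) * (\<Prod>i\<in>t. 1 / (nm i - 1)))"
    by (simp add: tot_def sum_product sum.cartesian_product)
  also have "\<dots> = (\<Sum>x\<in>sqf J Y \<times> sqf (I - J) Z. \<Prod>i\<in>(\<lambda>(s, t). s \<union> t) x. 1 / (nm i - 1))"
  proof (rule sum.cong[OF refl], clarify)
    fix s t assume "s \<in> sqf J Y" "t \<in> sqf (I - J) Z"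
    thus "(\<Prod>i\<in>s. 1 / (nm i - 1)) * (\<Prod>i\<in>t. 1 / (nm i - 1)) = (\<Prod>i\<in>s \<union> t. 1 / (nm i - 1))"
      by (subst prod.union_disjoint) (auto simp: sqf_def)
  qed
  also have "\<dots> = (\<Sum>s\<in>family J Y Z. \<Prod>i\<in>s. 1 / (nm i - 1))"
    unfolding family_def
  proof (rule sum.reindex[symmetric, unfolded o_def])
    show "inj_on (\<lambda>(s, t). s \<union> t) (sqf J Y \<times> sqf (I - J) Z)"
      by (rule inj_onI) (auto simp: sqf_def)
  qed
  finally show ?thesis .
qed

end

subsection \<open>Polynomials over a finite field\<close>

text \<open>Suitable maps \<open>\<tau> a\<close> inject any fibre of \<open>\<phi>\<close> into any
  other, so all fibres have the same size. This serves both for varying polynomials under a fixed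
  functional and for varying functionals at a fixed polynomial.\<close>

lemma equidistribution_of_translates:
  fixes \<phi> :: "'s \<Rightarrow> 'k" and \<tau> :: "'k \<Rightarrow> 's \<Rightarrow> 's" and R (structure)
  assumes "abelian_group R" "finite (carrier R)" "finite S"
    and \<phi>: "\<And>s. s \<in> S \<Longrightarrow> \<phi> s \<in> carrier R"
    and \<tau>: "\<And>a s. a \<in> carrier R \<Longrightarrow> s \<in> S \<Longrightarrow> \<tau> a s \<in> S"
    and inj: "\<And>a. a \<in> carrier R \<Longrightarrow> inj_on (\<tau> a) S"
    and shift: "\<And>a s. a \<in> carrier R \<Longrightarrow> s \<in> S \<Longrightarrow> \<phi> (\<tau> a s) = \<phi> s \<oplus> a"
    and v: "v \<in> carrier R"
  shows "card (carrier R) * card {s\<in>S. \<phi> s = v} = card S"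
proof -
  interpret abelian_group R by fact
  have le: "card {s\<in>S. \<phi> s = v} \<le> card {s\<in>S. \<phi> s = w}" if "v \<in> carrier R" "w \<in> carrier R" for v w
  proof (rule card_inj_on_le)
    show "inj_on (\<tau> (\<ominus> v \<oplus> w)) {s\<in>S. \<phi> s = v}"
      using that by (intro inj_on_subset[OF inj]) auto
    show "\<tau> (\<ominus> v \<oplus> w) ` {s\<in>S. \<phi> s = v} \<subseteq> {s\<in>S. \<phi> s = w}"
      using that \<tau> shift by (auto simp: r_neg2)
  qed (use assms(3) in auto)
  have "card S = (\<Sum>w\<in>carrier R. card {s\<in>S. \<phi> s = w})"
    using assms(2,3) \<phi> sum.group[of S "carrier R" \<phi> "\<lambda>_. 1::nat"]
    by (simp add: image_subset_iff)
  also have "\<dots> = (\<Sum>w\<in>carrier R. card {s\<in>S. \<phi> s = v})"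
    using le v by (intro sum.cong refl antisym) auto
  finally show ?thesis by simp
qed

section \<open>Polynomials of bounded degree and monic polynomials\<close>

locale finite_field_poly = field R for R (structure) +
  fixes q :: nat
  assumes finite_carrier: "finite (carrier R)" and card_carrier: "card (carrier R) = q"
begin

abbreviation P where "P \<equiv> poly_ring R"
abbreviation pmult (infixl "\<cdot>" 70) where "x \<cdot> y \<equiv> x \<otimes>\<^bsub>poly_ring R\<^esub> y"
abbreviation padd (infixl "\<^bold>+" 65) where "x \<^bold>+ y \<equiv> x \<oplus>\<^bsub>poly_ring R\<^esub> y"
abbreviation pminus (infixl "\<^bold>-" 65) where "x \<^bold>- y \<equiv> x \<ominus>\<^bsub>poly_ring R\<^esub> y"

sublocale P: domain "poly_ring R"
  by (rule univ_poly_is_domain[OF carrier_is_subring])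

lemma P_zero [simp]: "\<zero>\<^bsub>poly_ring R\<^esub> = []"
  by (rule univ_poly_zero)

lemma P_one: "\<one>\<^bsub>poly_ring R\<^esub> = [\<one>]"
  by (rule univ_poly_one)

lemma nil_closed [simp]: "[] \<in> carrier P"
  by (rule univ_poly_zero_closed)

lemma P_null [simp]: "p \<in> carrier P \<Longrightarrow> p \<cdot> [] = []" "p \<in> carrier P \<Longrightarrow> [] \<cdot> p = []"
    "p \<in> carrier P \<Longrightarrow> p \<^bold>+ [] = p" "p \<in> carrier P \<Longrightarrow> [] \<^bold>+ p = p"
  using P.r_null[of p] P.l_null[of p] P.r_zero[of p] P.l_zero[of p] by simp_all

lemma q_ge_2: "q \<ge> 2"
proof -
  have "card {\<zero>, \<one>} \<le> card (carrier R)"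
    by (intro card_mono finite_carrier) auto
  thus ?thesis by (simp add: card_carrier)
qed

lemma poly_iff: "p \<in> carrier P \<longleftrightarrow> polynomial (carrier R) p"
  by (simp add: univ_poly_carrier)

lemma set_poly: "p \<in> carrier P \<Longrightarrow> set p \<subseteq> carrier R"
  by (simp add: poly_iff polynomial_incl)

lemma coeff_closed [simp, intro]: "p \<in> carrier P \<Longrightarrow> coeff p i \<in> carrier R"
  by (simp add: set_poly)

lemma coeff_add: "p \<in> carrier P \<Longrightarrow> p' \<in> carrier P \<Longrightarrow> coeff (p \<^bold>+ p') i = coeff p i \<oplus> coeff p' i"
  unfolding univ_poly_add by (subst poly_add_coeff) (simp_all add: set_poly del: poly_add.simps)

lemma coeff_inv: "p \<in> carrier P \<Longrightarrow> coeff (\<ominus>\<^bsub>poly_ring R\<^esub> p) i = \<ominus> coeff p i"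
proof -
  assume p: "p \<in> carrier P"
  have "coeff (\<ominus>\<^bsub>P\<^esub> p) i \<oplus> coeff p i = coeff (\<ominus>\<^bsub>P\<^esub> p \<^bold>+ p) i"
    using p by (simp add: coeff_add)
  also have "\<dots> = \<zero>" using p by (simp add: P.l_neg)
  finally show ?thesis using p by (metis P.add.inv_closed coeff_closed minus_equality)
qed

lemma coeff_minus: "p \<in> carrier P \<Longrightarrow> p' \<in> carrier P \<Longrightarrow> coeff (p \<^bold>- p') i = coeff p i \<ominus> coeff p' i"
  by (simp add: P.minus_eq minus_eq coeff_add coeff_inv)

lemma const_closed [simp, intro]: "a \<in> carrier R \<Longrightarrow> poly_of_const a \<in> carrier P"
  by (auto simp: poly_of_const_def poly_iff intro!: normalize_gives_polynomial)

lemma coeff_const_mult: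
  assumes "a \<in> carrier R" "p \<in> carrier P"
  shows "coeff (poly_of_const a \<cdot> p) i = a \<otimes> coeff p i"
proof (cases "a = \<zero>")
  case True
  thus ?thesis using assms by (simp add: poly_of_const_def)
next
  case False
  thus ?thesis
    using assms poly_mult_const(1)[OF carrier_is_subring, of p a]
    by (simp add: poly_of_const_def univ_poly_mult poly_iff scalar_coeff)
qed

lemma length_le_iff:
  assumes "p \<in> carrier P"
  shows "length p \<le> m \<longleftrightarrow> (\<forall>i\<ge>m. coeff p i = \<zero>)"
proof
  assume "length p \<le> m" thus "\<forall>i\<ge>m. coeff p i = \<zero>" by (auto intro: coeff_length)
next
  assume *: "\<forall>i\<ge>m. coeff p i = \<zero>"
  show "length p \<le> m"
  proof (rule ccontr)
    assume "\<not> length p \<le> m"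
    hence "p \<noteq> []" "m \<le> degree p" by auto
    hence "lead_coeff p = \<zero>" using * lead_coeff_simp by metis
    thus False using assms \<open>p \<noteq> []\<close> by (simp add: poly_iff polynomial_def)
  qed
qed

lemma poly_eqI:
  assumes "p \<in> carrier P" "p' \<in> carrier P" "\<And>i. coeff p i = coeff p' i"
  shows "p = p'"
  using assms coeff_iff_polynomial_cond[of "carrier R" p p'] by (auto simp: poly_iff)

lemma length_mult:
  assumes "p \<in> carrier P" "p' \<in> carrier P" "p \<noteq> []" "p' \<noteq> []"
  shows "p \<cdot> p' \<noteq> []" "Suc (length (p \<cdot> p')) = length p + length p'"
proof -
  show 1: "p \<cdot> p' \<noteq> []" using assms P.integral[of p p'] by auto
  have "degree (p \<cdot> p') = degree p + degree p'"
    using poly_mult_degree_eq[OF carrier_is_subring, of p p'] assms by (simp add: univ_poly_mult poly_iff)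
  moreover have "length p \<noteq> 0" "length p' \<noteq> 0" "length (p \<cdot> p') \<noteq> 0" using 1 assms by auto
  ultimately show "Suc (length (p \<cdot> p')) = length p + length p'" by linarith
qed

text \<open>The vector space of polynomials of degree below \<open>m\<close>. Bounding
  \<open>length\<close> instead of \<open>degree\<close> separates 0 from the nonzero constants, so
  that \<open>B 0\<close> is the zero space.\<close>

definition B :: "nat \<Rightarrow> 'a list set" where "B m = {p \<in> carrier P. length p \<le> m}"

abbreviation Mon :: "nat \<Rightarrow> 'a list set" where "Mon n \<equiv> monic_polys R n"

lemma B_iff: "p \<in> B m \<longleftrightarrow> p \<in> carrier P \<and> (\<forall>i\<ge>m. coeff p i = \<zero>)"
  by (auto simp: B_def length_le_iff)

lemma B_closed: "p \<in> B m \<Longrightarrow> p \<in> carrier P" by (simp add: B_def)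

lemma B_mono: "m \<le> m' \<Longrightarrow> B m \<subseteq> B m'" by (auto simp: B_def)

lemma B_nil [simp]: "[] \<in> B m" by (simp add: B_def)

lemma B_add [intro]: "p \<in> B m \<Longrightarrow> p' \<in> B m \<Longrightarrow> p \<^bold>+ p' \<in> B m"
  by (auto simp: B_iff coeff_add)

lemma B_minus [intro]: "p \<in> B m \<Longrightarrow> p' \<in> B m \<Longrightarrow> p \<^bold>- p' \<in> B m"
  by (auto simp: B_iff coeff_minus minus_eq)

lemma B_const_mult [intro]: "a \<in> carrier R \<Longrightarrow> p \<in> B m \<Longrightarrow> poly_of_const a \<cdot> p \<in> B m"
  by (auto simp: B_iff coeff_const_mult)

lemma B_mult:
  assumes "p \<in> carrier P" "p' \<in> carrier P" "length p + length p' \<le> m + 1"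
  shows "p \<cdot> p' \<in> B m"
proof (cases "p = [] \<or> p' = []")
  case False
  thus ?thesis using assms length_mult[of p p'] by (simp add: B_def)
qed (use assms in auto)

lemma Mon_closed: "p \<in> Mon n \<Longrightarrow> p \<in> carrier P"
  and Mon_length: "p \<in> Mon n \<Longrightarrow> length p = Suc n"
  and Mon_nonzero: "p \<in> Mon n \<Longrightarrow> p \<noteq> []"
  by (auto simp: monic_polys_def)

lemma Mon_iff: "p \<in> Mon n \<longleftrightarrow> p \<in> carrier P \<and> coeff p n = \<one> \<and> (\<forall>i>n. coeff p i = \<zero>)"
proof
  assume p: "p \<in> Mon n"
  hence "coeff p n = \<one>" using lead_coeff_simp[of p] by (auto simp: monic_polys_def)
  thus "p \<in> carrier P \<and> coeff p n = \<one> \<and> (\<forall>i>n. coeff p i = \<zero>)"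
    using p Mon_length[OF p] by (auto simp: Mon_closed intro: coeff_length)
next
  assume p: "p \<in> carrier P \<and> coeff p n = \<one> \<and> (\<forall>i>n. coeff p i = \<zero>)"
  hence "length p \<le> Suc n" by (simp add: length_le_iff Suc_le_eq)
  moreover have "\<not> length p \<le> n" using p length_le_iff[of p n] by auto
  ultimately have "length p = Suc n" by simp
  moreover from this have "p \<noteq> []" "degree p = n" by auto
  ultimately show "p \<in> Mon n" using p lead_coeff_simp[of p] by (simp add: monic_polys_def)
qed

lemma Mon_minus: assumes "p \<in> Mon n" "p' \<in> Mon n" shows "p \<^bold>- p' \<in> B n"
proof -
  have "coeff p i \<ominus> coeff p' i = \<zero>" if "i \<ge> n" for i
    using assms that by (cases "i = n") (auto simp: Mon_iff minus_eq r_neg)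
  thus ?thesis using assms by (auto simp: B_iff Mon_closed coeff_minus)
qed

lemma Mon_add: "p \<in> Mon n \<Longrightarrow> p' \<in> B n \<Longrightarrow> p \<^bold>+ p' \<in> Mon n"
  by (auto simp: B_iff Mon_iff coeff_add)

lemma Mon_mult: "p \<in> Mon n \<Longrightarrow> p' \<in> Mon n' \<Longrightarrow> p \<cdot> p' \<in> Mon (n + n')"
proof -
  assume p: "p \<in> Mon n" "p' \<in> Mon n'"
  have "hd (p \<cdot> p') = hd p \<otimes> hd p'"
    using poly_mult_lead_coeff[OF carrier_is_subring, of p p'] p
    by (simp add: univ_poly_mult poly_iff[symmetric] Mon_closed Mon_nonzero)
  moreover have "p \<cdot> p' \<noteq> []" "Suc (length (p \<cdot> p')) = length p + length p'"
    using p length_mult[of p p'] by (auto simp: Mon_closed Mon_nonzero)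
  ultimately show ?thesis
    using p Mon_length[OF p(1)] Mon_length[OF p(2)] by (simp add: monic_polys_def)
qed

lemma Mon_one: "\<one>\<^bsub>poly_ring R\<^esub> \<in> Mon 0"
  using P.one_closed by (auto simp: monic_polys_def P_one)

lemma Mon_0: "Mon 0 = {\<one>\<^bsub>poly_ring R\<^esub>}"
proof -
  have "p = [\<one>]" if "p \<in> Mon 0" for p
    using that by (cases p) (auto simp: monic_polys_def)
  thus ?thesis using Mon_one unfolding P_one by blast
qed

lemma Mon_eq_lists: "Mon n = (#) \<one> ` {xs. set xs \<subseteq> carrier R \<and> length xs = n}"
proof (intro equalityI subsetI)
  fix p assume p: "p \<in> Mon n"
  hence "p = \<one> # tl p" by (cases p) (auto simp: monic_polys_def)
  moreover have "set (tl p) \<subseteq> carrier R"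
    using p set_poly[of p] by (cases p) (auto simp: monic_polys_def)
  ultimately show "p \<in> (#) \<one> ` {xs. set xs \<subseteq> carrier R \<and> length xs = n}"
    using Mon_length[OF p] by (metis (mono_tags, lifting) diff_Suc_1 image_eqI length_tl mem_Collect_eq)
qed (auto simp: monic_polys_def poly_iff polynomial_def)

lemma finite_Mon [simp]: "finite (Mon n)"
  unfolding Mon_eq_lists by (intro finite_imageI finite_lists_length_eq finite_carrier)

lemma card_Mon: "card (Mon n) = q ^ n"
  unfolding Mon_eq_lists
  by (subst card_image) (auto simp: card_lists_length_eq[OF finite_carrier] card_carrier)

lemma Mon_nonempty: "\<exists>p. p \<in> Mon n"
  using card_Mon[of n] q_ge_2 by (metis card.empty equals0I power_eq_0_iff not_numeral_le_zero)

lemma bij_B_Mon: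
  assumes "F \<in> Mon n"
  shows "bij_betw (\<lambda>p. F \<^bold>+ p) (B n) (Mon n)"
proof (rule bij_betw_byWitness[where f' = "\<lambda>p. p \<^bold>- F"])
  have F: "F \<in> carrier P" using assms by (rule Mon_closed)
  show "\<forall>p\<in>B n. F \<^bold>+ p \<^bold>- F = p"
  proof
    fix p assume "p \<in> B n"
    hence p: "p \<in> carrier P" by (rule B_closed)
    show "F \<^bold>+ p \<^bold>- F = p" using F p by algebra
  qed
  show "\<forall>p\<in>Mon n. F \<^bold>+ (p \<^bold>- F) = p"
  proof
    fix p assume "p \<in> Mon n"
    hence p: "p \<in> carrier P" by (rule Mon_closed)
    show "F \<^bold>+ (p \<^bold>- F) = p" using F p by algebra
  qed
qed (use assms Mon_add Mon_minus in auto)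

lemma finite_B [simp]: "finite (B n)" and card_B: "card (B n) = q ^ n"
proof -
  obtain F where F: "F \<in> Mon n" using Mon_nonempty by auto
  show "finite (B n)" using bij_betw_finite[OF bij_B_Mon[OF F]] by simp
  show "card (B n) = q ^ n" using bij_betw_same_card[OF bij_B_Mon[OF F]] by (simp add: card_Mon)
qed

lemma long_division:
  assumes "p \<in> carrier P" "b \<in> carrier P" "b \<noteq> []"
  obtains u r where "u \<in> carrier P" "r \<in> carrier P" "p = b \<cdot> u \<^bold>+ r" "length r < length b"
    "u \<noteq> [] \<Longrightarrow> Suc (length p) = length b + length u"
proof -
  obtain u r where ur: "u \<in> carrier P" "r \<in> carrier P" "p = b \<cdot> u \<^bold>+ r" "r = [] \<or> degree r < degree b"
    using field_long_division_theorem_shell[OF carrier_is_subfield assms(1,2)] assms(3) by auto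
  have rb: "length r < length b"
    using ur(4) assms(3) by (cases "r = []") (simp, linarith)
  have "Suc (length p) = length b + length u" if u: "u \<noteq> []"
  proof -
    have len: "Suc (length (b \<cdot> u)) = length b + length u" "b \<cdot> u \<noteq> []"
      using length_mult[of b u] assms ur u by auto
    moreover have "length u > 0" using u by simp
    ultimately have "length r < length (b \<cdot> u)" using rb by linarith
    hence "length p = length (b \<cdot> u)"
      unfolding ur(3) univ_poly_add using assms(2) ur
      by (subst poly_add_length_eq[OF carrier_is_subring]) (auto simp: poly_iff[symmetric] simp flip: univ_poly_mult)
    thus ?thesis using len by simp
  qed
  with ur rb that show ?thesis by blast
qed

lemma pdividesI: "u \<in> carrier P \<Longrightarrow> x = p \<cdot> u \<Longrightarrow> p pdivides x"
  by (auto simp: pdivides_def factor_def)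

lemma pdividesE:
  assumes "p pdivides x" obtains u where "u \<in> carrier P" "x = p \<cdot> u"
  using assms by (auto simp: pdivides_def factor_def)

lemma pdivides_trans': "x pdivides y \<Longrightarrow> y pdivides z \<Longrightarrow> x \<in> carrier P \<Longrightarrow> x pdivides z"
  unfolding pdivides_def by (rule P.divides_trans)

lemma pdivides_length_le: "x pdivides y \<Longrightarrow> x \<in> carrier P \<Longrightarrow> y \<noteq> [] \<Longrightarrow> length x \<le> length y"
proof (elim pdividesE)
  fix u assume *: "x \<in> carrier P" "y \<noteq> []" "u \<in> carrier P" "y = x \<cdot> u"
  hence "x \<noteq> []" "u \<noteq> []" by auto
  with * length_mult[of x u] show ?thesis by (cases u) auto
qed

lemma Mon_cofactor:
  assumes D: "D \<in> Mon e" and F: "D \<cdot> u \<in> Mon n" and u: "u \<in> carrier P"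
  shows "e \<le> n" "u \<in> Mon (n - e)"
proof -
  have Dc: "D \<in> carrier P" "D \<noteq> []" using D by (auto simp: Mon_closed Mon_nonzero)
  have u0: "u \<noteq> []" using F Dc Mon_nonzero by fastforce
  have "Suc (Suc n) = Suc e + length u"
    using length_mult[OF Dc(1) u Dc(2) u0] Mon_length[OF F] Mon_length[OF D] by simp
  moreover have "length u \<noteq> 0" using u0 by simp
  ultimately have len: "e \<le> n" "length u = Suc (n - e)" by linarith+
  have "hd (D \<cdot> u) = hd D \<otimes> hd u"
    using poly_mult_lead_coeff[OF carrier_is_subring, of D u] Dc u u0
    by (simp add: univ_poly_mult poly_iff[symmetric])
  moreover have "hd u \<in> carrier R" using set_poly[OF u] u0 by auto
  ultimately have "hd u = \<one>" using D F by (simp add: monic_polys_def)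
  thus "e \<le> n" "u \<in> Mon (n - e)" using len u u0 by (auto simp: monic_polys_def)
qed

lemma Mon_dvd_cofactor:
  assumes "D \<in> Mon e" "F \<in> Mon n" "D pdivides F"
  obtains u where "F = D \<cdot> u" "e \<le> n" "u \<in> Mon (n - e)"
proof -
  obtain u where "u \<in> carrier P" "F = D \<cdot> u" using assms(3) by (rule pdividesE)
  thus ?thesis using that Mon_cofactor[of D e u n] assms by auto
qed

lemma make_monic:
  assumes "p \<in> carrier P" "p \<noteq> []"
  obtains c p' where "c \<in> carrier R" "c \<noteq> \<zero>" "p' \<in> Mon (degree p)" "p = poly_of_const c \<cdot> p'"
proof -
  define c where "c = hd p"
  have c: "c \<in> carrier R" "c \<noteq> \<zero>"
    using assms set_poly[of p] by (auto simp: c_def poly_iff polynomial_def)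
  hence inv: "inv c \<in> carrier R" "inv c \<otimes> c = \<one>" "c \<otimes> inv c = \<one>"
    by (auto simp: field_Units)
  define p' where "p' = poly_of_const (inv c) \<cdot> p"
  have p': "p' \<in> carrier P" using inv assms by (simp add: p'_def)
  have "coeff p (degree p) = c" using assms(2) lead_coeff_simp[of p] by (simp add: c_def)
  moreover have "coeff p i = \<zero>" if "i > degree p" for i using that by (rule coeff_degree)
  ultimately have "p' \<in> Mon (degree p)"
    using inv assms p' by (simp add: Mon_iff p'_def coeff_const_mult)
  moreover have "p = poly_of_const c \<cdot> p'"
  proof (rule poly_eqI)
    fix i
    have "c \<otimes> (inv c \<otimes> coeff p i) = coeff p i"
      using c inv assms by (simp add: m_assoc[symmetric])
    thus "coeff p i = coeff (poly_of_const c \<cdot> p') i"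
      using c inv assms p' by (simp add: p'_def coeff_const_mult)
  qed (use assms p' c in auto)
  ultimately show ?thesis using that c by blast
qed

lemma unit_iff: "p \<in> Units P \<longleftrightarrow> p \<in> carrier P \<and> length p = 1"
  using univ_poly_units'[OF carrier_is_subfield, of p] by (cases p) auto

section \<open>Monic irreducibles and unique factorization\<close>

definition irr :: "'a list set" where
  "irr = {p \<in> carrier P. p \<noteq> [] \<and> hd p = \<one> \<and> pirreducible (carrier R) p}"

lemma irr_closed: "p \<in> irr \<Longrightarrow> p \<in> carrier P" by (simp add: irr_def)

lemma irr_Mon: "p \<in> irr \<Longrightarrow> p \<in> Mon (degree p)" by (simp add: irr_def monic_polys_def)

lemma irr_degree: "p \<in> irr \<Longrightarrow> degree p \<ge> 1"
  using pirreducible_degree[OF carrier_is_subfield, of p] by (simp add: irr_def)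

lemma irr_prime:
  assumes "p \<in> irr" "x \<in> carrier P" "y \<in> carrier P" "p pdivides x \<cdot> y"
  shows "p pdivides x \<or> p pdivides y"
proof -
  have "pprime (carrier R) p"
    using assms(1) pprime_iff_pirreducible[OF carrier_is_subfield, of p] by (simp add: irr_def)
  thus ?thesis using pprimeE(3)[OF carrier_is_subfield irr_closed[OF assms(1)]] assms by blast
qed

lemma irr_dvd_irr:
  assumes "p \<in> irr" "p' \<in> irr" "p pdivides p'"
  shows "p = p'"
proof -
  obtain u where u: "p' = p \<cdot> u" "degree p \<le> degree p'" "u \<in> Mon (degree p' - degree p)"
    using Mon_dvd_cofactor[OF irr_Mon irr_Mon assms(3)] assms by blast
  have "p \<in> Units P \<or> u \<in> Units P"
    using pirreducibleE(3)[OF carrier_is_subring irr_closed[OF assms(2)], of p u] assms u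
    by (auto simp: irr_def Mon_closed)
  moreover have "p \<notin> Units P" using assms(1) irr_degree[of p] by (auto simp: unit_iff)
  ultimately have "length u = 1" by (auto simp: unit_iff)
  hence "u \<in> Mon 0" using u(3) by (simp add: monic_polys_def)
  thus ?thesis using u(1) irr_closed[OF assms(1)] by (simp add: Mon_0)
qed

text \<open>A monic divisor of least positive degree is irreducible, since a proper factor of it,
  made monic, would be a smaller one.\<close>

lemma exists_irr_dvd:
  assumes F: "F \<in> Mon n" "n \<ge> 1"
  obtains p where "p \<in> irr" "p pdivides F"
proof -
  define ok where "ok e \<longleftrightarrow> e \<ge> 1 \<and> (\<exists>D\<in>Mon e. D pdivides F)" for e
  have "F pdivides F" using Mon_closed[OF F(1)] by (intro pdividesI[of "\<one>\<^bsub>P\<^esub>"]) auto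
  hence "ok n" using F by (auto simp: ok_def)
  define e where "e = (LEAST e. ok e)"
  have e: "ok e" unfolding e_def by (rule LeastI) fact
  have least: "\<not> ok e'" if "e' < e" for e' using that not_less_Least unfolding e_def by blast
  obtain D where D: "D \<in> Mon e" "D pdivides F" using e by (auto simp: ok_def)
  have Dc: "D \<in> carrier P" "D \<noteq> []" using D Mon_closed Mon_nonzero by blast+
  have "pirreducible (carrier R) D"
  proof (rule pirreducibleI[OF carrier_is_subring Dc])
    show "D \<notin> Units P" using Mon_length[OF D(1)] e by (auto simp: unit_iff ok_def)
    fix x y assume xy: "x \<in> carrier P" "y \<in> carrier P" "D = x \<cdot> y"
    show "x \<in> Units P \<or> y \<in> Units P"
    proof (rule ccontr)
      assume nu: "\<not> (x \<in> Units P \<or> y \<in> Units P)"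
      have x0: "x \<noteq> []" "y \<noteq> []" using xy Dc by auto
      have "length x \<noteq> 1" "length y \<noteq> 1" "length x \<noteq> 0" "length y \<noteq> 0"
        using nu xy x0 by (auto simp: unit_iff)
      moreover have "Suc (length D) = length x + length y" using length_mult[of x y] xy x0 by simp
      ultimately have deg: "1 \<le> degree x" "degree x < e" using Mon_length[OF D(1)] by linarith+
      obtain c x' where c: "c \<in> carrier R" "x' \<in> Mon (degree x)" "x = poly_of_const c \<cdot> x'"
        using make_monic[OF xy(1) x0(1)] by blast
      have x'c: "x' \<in> carrier P" using c Mon_closed by blast
      have "D = x' \<cdot> (poly_of_const c \<cdot> y)"
        using xy c x'c by (simp add: P.m_ac)
      hence "x' pdivides D" using xy c by (intro pdividesI) auto
      hence "x' pdivides F" using D(2) x'c pdivides_trans' by blast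
      thus False using least[OF deg(2)] deg c by (auto simp: ok_def)
    qed
  qed
  hence "D \<in> irr" using D Dc by (auto simp: irr_def monic_polys_def)
  thus ?thesis using D that by blast
qed

text \<open>The product over a multiset by way of an arbitrary enumeration; commutativity makes the
  choice immaterial, which is the content of \<open>pr_add_mset\<close>. Multisets are what
  \<open>prime_system\<close> counts.\<close>

definition pr :: "'a list multiset \<Rightarrow> 'a list" where
  "pr M = foldr (\<otimes>\<^bsub>P\<^esub>) (SOME xs. mset xs = M) \<one>\<^bsub>P\<^esub>"

lemma pr_empty [simp]: "pr {#} = \<one>\<^bsub>P\<^esub>"
  by (simp add: pr_def)

lemma pr_add_mset:
  assumes "set_mset M \<subseteq> carrier P" "p \<in> carrier P"
  shows "pr (add_mset p M) = p \<cdot> pr M"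
proof -
  have ex: "mset (SOME xs. mset xs = N) = N" for N :: "'a list multiset"
    by (rule someI_ex) (rule ex_mset)
  define xs where "xs = (SOME xs. mset xs = M)"
  have "mset xs = M" unfolding xs_def by (rule ex)
  hence "set xs \<subseteq> carrier P" using assms(1) by (metis set_mset_mset)
  have "pr (add_mset p M) = foldr (\<otimes>\<^bsub>P\<^esub>) (p # xs) \<one>\<^bsub>P\<^esub>"
    unfolding pr_def
  proof (rule P.multlist_perm_cong[OF _ _])
    show "mset (SOME xs. mset xs = add_mset p M) = mset (p # xs)"
      using \<open>mset xs = M\<close> by (simp add: ex)
    show "set (SOME xs. mset xs = add_mset p M) \<subseteq> carrier P"
      using assms ex[of "add_mset p M"] by (metis insert_subset set_mset_add_mset_insert set_mset_mset)
  qed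
  thus ?thesis by (simp add: pr_def xs_def)
qed

lemma irr_subset_carrier: "irr \<subseteq> carrier P" by (auto simp: irr_closed)

lemma pr_Mon: "set_mset M \<subseteq> irr \<Longrightarrow> pr M \<in> Mon (\<Sum>p\<in>#M. degree p)"
proof (induction M)
  case (add p M)
  thus ?case using irr_subset_carrier Mon_mult[OF irr_Mon, of p "pr M"] by (simp add: pr_add_mset subset_iff)
qed (simp add: Mon_one)

lemma irr_dvd_pr:
  assumes "p \<in> irr" "set_mset M \<subseteq> irr" "p pdivides pr M"
  shows "p \<in># M"
  using assms(2,3)
proof (induction M)
  case empty
  have "length p \<le> length (\<one>\<^bsub>P\<^esub>)"
    using empty assms(1) by (intro pdivides_length_le) (auto simp: irr_closed P_one)
  thus ?case using irr_degree[OF assms(1)] by (simp add: P_one)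
next
  case (add x M)
  have x: "x \<in> irr" "set_mset M \<subseteq> irr" using add.prems by auto
  hence "p pdivides x \<cdot> pr M"
    using add.prems irr_subset_carrier by (simp add: pr_add_mset subset_iff)
  hence "p pdivides x \<or> p pdivides pr M"
    using irr_prime[OF assms(1)] x irr_closed pr_Mon Mon_closed by blast
  thus ?case using add.IH x irr_dvd_irr[OF assms(1)] by auto
qed

lemma pr_inj: "set_mset M \<subseteq> irr \<Longrightarrow> set_mset M' \<subseteq> irr \<Longrightarrow> pr M = pr M' \<Longrightarrow> M = M'"
proof (induction M arbitrary: M')
  case empty
  show ?case
  proof (rule ccontr)
    assume "{#} \<noteq> M'"
    then obtain p where p: "p \<in># M'" by auto
    hence "p \<in> irr" using empty by auto
    have M: "pr M' \<in> Mon (\<Sum>p\<in>#M'. degree p)" "pr M' \<in> Mon 0"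
      using empty pr_Mon[of M'] Mon_one by auto
    have "Suc (\<Sum>p\<in>#M'. degree p) = Suc 0" using Mon_length[OF M(1)] Mon_length[OF M(2)] by metis
    hence "(\<Sum>p\<in>#M'. degree p) = 0" by simp
    thus False using p irr_degree[OF \<open>p \<in> irr\<close>] by (auto simp: sum_mset_0_iff)
  qed
next
  case (add p M)
  have p: "p \<in> irr" "set_mset M \<subseteq> irr" using add.prems by auto
  have eq: "pr (add_mset p M) = p \<cdot> pr M"
    using p irr_subset_carrier by (intro pr_add_mset) auto
  have "p pdivides pr M'"
    using add.prems(3) eq pr_Mon[OF p(2)] Mon_closed by (intro pdividesI[of "pr M"]) auto
  hence "p \<in># M'" using irr_dvd_pr p add.prems by blast
  then obtain N where N: "M' = add_mset p N" by (meson mset_add)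
  have Nirr: "set_mset N \<subseteq> irr" using N add.prems by auto
  have "pr M' = p \<cdot> pr N" unfolding N using p Nirr irr_subset_carrier by (intro pr_add_mset) auto
  hence "p \<cdot> pr M = p \<cdot> pr N" using eq add.prems by simp
  moreover have "p \<noteq> []" using p by (simp add: irr_def)
  ultimately have "pr M = pr N"
    using P.m_lcancel[of p "pr M" "pr N"] p pr_Mon[OF p(2)] pr_Mon[OF Nirr] Mon_closed irr_closed by auto
  thus ?case using add.IH p Nirr N by blast
qed

lemma pr_surj: "F \<in> Mon n \<Longrightarrow> \<exists>M. set_mset M \<subseteq> irr \<and> pr M = F"
proof (induction n arbitrary: F rule: less_induct)
  case (less n)
  show ?case
  proof (cases "n = 0")
    case True
    hence "pr {#} = F" using less.prems Mon_0 by auto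
    thus ?thesis by (intro exI[of _ "{#}"]) simp
  next
    case False
    then obtain p where p: "p \<in> irr" "p pdivides F" using exists_irr_dvd[OF less.prems] by auto
    obtain u where u: "F = p \<cdot> u" "degree p \<le> n" "u \<in> Mon (n - degree p)"
      using Mon_dvd_cofactor[OF irr_Mon[OF p(1)] less.prems p(2)] by blast
    have "n - degree p < n" using irr_degree[OF p(1)] False by linarith
    then obtain M where M: "set_mset M \<subseteq> irr" "pr M = u" using less.IH u by blast
    hence "pr (add_mset p M) = F"
      using u p irr_subset_carrier by (subst pr_add_mset) auto
    thus ?thesis using M p by (intro exI[of _ "add_mset p M"]) auto
  qed
qed

text \<open>Unique factorization says that \<open>pr\<close> maps the multisets of irreducibles of
  total degree \<open>n\<close> bijectively to \<open>Mon n\<close>, whose cardinality is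
  known.\<close>

sublocale PS: prime_system irr "\<lambda>p. length p - 1" q
proof
  show "q \<ge> 2" by (rule q_ge_2)
  show "1 \<le> degree p" if "p \<in> irr" for p using that by (rule irr_degree)
  fix n
  have "bij_betw pr {M. set_mset M \<subseteq> irr \<and> (\<Sum>p\<in>#M. degree p) = n} (Mon n)"
    unfolding bij_betw_def
  proof (intro conjI equalityI subsetI)
    show "inj_on pr {M. set_mset M \<subseteq> irr \<and> (\<Sum>p\<in>#M. degree p) = n}"
      by (rule inj_onI) (use pr_inj in blast)
  next
    fix F assume "F \<in> pr ` {M. set_mset M \<subseteq> irr \<and> (\<Sum>p\<in>#M. degree p) = n}"
    thus "F \<in> Mon n" using pr_Mon by auto
  next
    fix F assume F: "F \<in> Mon n"
    then obtain M where M: "set_mset M \<subseteq> irr" "pr M = F" using pr_surj by blast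
    hence "F \<in> Mon (\<Sum>p\<in>#M. degree p)" using pr_Mon by blast
    hence "Suc (\<Sum>p\<in>#M. degree p) = Suc n" using Mon_length[OF F] Mon_length[of F] by metis
    hence "(\<Sum>p\<in>#M. degree p) = n" by simp
    thus "F \<in> pr ` {M. set_mset M \<subseteq> irr \<and> (\<Sum>p\<in>#M. degree p) = n}" using M by blast
  qed
  from bij_betw_same_card[OF this]
  show "card {M. set_mset M \<subseteq> irr \<and> (\<Sum>p\<in>#M. degree p) = n} = q ^ n"
    by (simp add: card_Mon)
qed

section \<open>Squarefree products and prime divisors\<close>

definition prs :: "'a list set \<Rightarrow> 'a list" where "prs w = pr (mset_set w)"

lemma prs_empty [simp]: "prs {} = \<one>\<^bsub>P\<^esub>" by (simp add: prs_def)

lemma prs_insert: "finite w \<Longrightarrow> w \<subseteq> irr \<Longrightarrow> p \<in> irr \<Longrightarrow> p \<notin> w \<Longrightarrow> prs (insert p w) = p \<cdot> prs w"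
  using irr_subset_carrier by (auto simp: prs_def intro!: pr_add_mset)

lemma prs_Mon: "finite w \<Longrightarrow> w \<subseteq> irr \<Longrightarrow> prs w \<in> Mon (\<Sum>p\<in>w. degree p)"
  using pr_Mon[of "mset_set w"] by (simp add: prs_def sum_unfold_sum_mset)

lemma prs_closed: "finite w \<Longrightarrow> w \<subseteq> irr \<Longrightarrow> prs w \<in> carrier P"
  using prs_Mon Mon_closed by blast

lemma prs_dvd_iff:
  assumes "finite w" "w \<subseteq> irr" "F \<in> carrier P"
  shows "prs w pdivides F \<longleftrightarrow> (\<forall>p\<in>w. p pdivides F)"
  using assms(1,2)
proof (induction w rule: finite_induct)
  case empty
  thus ?case using assms(3) by (auto intro: pdividesI[of F])
next
  case (insert p w)
  have p: "p \<in> irr" "w \<subseteq> irr" using insert by auto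
  have c: "p \<in> carrier P" "prs w \<in> carrier P"
    using p irr_closed[of p] prs_closed[OF insert.hyps(1)] by simp_all
  have eq: "prs (insert p w) = p \<cdot> prs w" using insert.hyps p by (intro prs_insert)
  show ?case
  proof
    assume L: "prs (insert p w) pdivides F"
    have "p pdivides p \<cdot> prs w" using c by (intro pdividesI) auto
    moreover have "prs w pdivides p \<cdot> prs w" using c by (intro pdividesI[of p]) (auto simp: P.m_comm)
    ultimately show "\<forall>x\<in>insert p w. x pdivides F"
      using L eq insert.IH p c pdivides_trans' by auto
  next
    assume R: "\<forall>x\<in>insert p w. x pdivides F"
    then obtain u where u: "u \<in> carrier P" "F = prs w \<cdot> u" using insert p by (auto elim: pdividesE)
    have "p pdivides prs w \<or> p pdivides u" using R u c irr_prime[OF p(1)] by auto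
    moreover have "\<not> p pdivides prs w"
      using irr_dvd_pr[OF p(1), of "mset_set w"] p insert by (auto simp: prs_def)
    ultimately obtain u' where u': "u' \<in> carrier P" "u = p \<cdot> u'" by (auto elim: pdividesE)
    show "prs (insert p w) pdivides F"
      unfolding eq using u u' c by (intro pdividesI[of u']) (auto simp: P.m_ac)
  qed
qed

text \<open>An irreducible in \<open>w\<close> divides the right-hand side of
  \<open>prs w * E = Q * u\<close> but not \<open>Q\<close>, hence divides \<open>u\<close> and can
  be cancelled. So the part of a modulus that is prime to the denominator is invisible to
  divisibility by it.\<close>

lemma coprime_prs_cancel:
  assumes "finite w" "w \<subseteq> irr" "Q \<in> carrier P" "\<And>p. p \<in> w \<Longrightarrow> \<not> p pdivides Q"
    and "E \<in> carrier P" "Q pdivides prs w \<cdot> E"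
  shows "Q pdivides E"
  using assms(1,2,4,6)
proof (induction w rule: finite_induct)
  case empty
  thus ?case using assms by simp
next
  case (insert p w)
  have p: "p \<in> irr" "w \<subseteq> irr" using insert by auto
  have c: "p \<in> carrier P" "prs w \<in> carrier P" "p \<noteq> []"
    using p irr_closed[of p] prs_closed[OF insert.hyps(1)] by (simp_all add: irr_def)
  have eq: "prs (insert p w) = p \<cdot> prs w" using insert.hyps p by (intro prs_insert)
  obtain u where u: "u \<in> carrier P" "p \<cdot> (prs w \<cdot> E) = Q \<cdot> u"
    using insert.prems(3) eq c assms(5) by (auto elim!: pdividesE simp: P.m_assoc)
  have "p pdivides Q \<cdot> u" using u c assms by (intro pdividesI[of "prs w \<cdot> E"]) auto
  hence "p pdivides u" using irr_prime[OF p(1) assms(3) u(1)] insert.prems by auto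
  then obtain u' where u': "u' \<in> carrier P" "u = p \<cdot> u'" by (rule pdividesE)
  have "p \<cdot> (prs w \<cdot> E) = p \<cdot> (Q \<cdot> u')" using u u' c assms by (simp add: P.m_lcomm)
  hence "prs w \<cdot> E = Q \<cdot> u'" using P.m_lcancel[of p "prs w \<cdot> E" "Q \<cdot> u'"] c assms u' by auto
  hence "Q pdivides prs w \<cdot> E" using u' by (intro pdividesI) auto
  thus ?case using insert p by auto
qed

lemma prs_Un:
  assumes "finite s" "finite t" "s \<subseteq> irr" "t \<subseteq> irr" "s \<inter> t = {}"
  shows "prs (s \<union> t) = prs s \<cdot> prs t"
  using assms(1,3,5)
proof (induction s rule: finite_induct)
  case empty
  thus ?case using prs_closed[OF assms(2,4)] by simp
next
  case (insert p s)
  hence "prs (insert p (s \<union> t)) = p \<cdot> prs (s \<union> t)" using assms by (intro prs_insert) auto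
  thus ?case using insert prs_closed[OF assms(2,4)] prs_closed[of s] irr_closed[of p]
    by (simp add: prs_insert P.m_assoc)
qed

definition irr_divisors :: "'a list \<Rightarrow> 'a list set" where
  "irr_divisors Q = {p\<in>irr. p pdivides Q}"

text \<open>The product of the distinct irreducible divisors divides \<open>Q\<close>, which bounds
  its degree.\<close>

lemma irr_divisors:
  assumes "Q \<in> carrier P" "Q \<noteq> []"
  shows "finite (irr_divisors Q)" "(\<Sum>p\<in>irr_divisors Q. degree p) \<le> degree Q"
proof -
  have "irr_divisors Q \<subseteq> {p\<in>irr. degree p \<le> degree Q}"
    using pdivides_length_le[of _ Q] assms irr_closed by (fastforce simp: irr_divisors_def)
  thus fin: "finite (irr_divisors Q)" by (rule finite_subset) (rule PS.finite_degree_le)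
  have sub: "irr_divisors Q \<subseteq> irr" by (auto simp: irr_divisors_def)
  have "prs (irr_divisors Q) pdivides Q"
    using fin sub assms by (subst prs_dvd_iff) (auto simp: irr_divisors_def)
  hence "length (prs (irr_divisors Q)) \<le> length Q"
    using fin sub assms prs_closed by (intro pdivides_length_le) auto
  thus "(\<Sum>p\<in>irr_divisors Q. degree p) \<le> degree Q"
    using Mon_length[OF prs_Mon[OF fin sub]] by linarith
qed

end

subsection \<open>Best denominators of a linear functional\<close>

locale poly_functional = finite_field_poly +
  fixes L :: "'a list \<Rightarrow> 'a"
  assumes L_closed [simp]: "p \<in> carrier P \<Longrightarrow> L p \<in> carrier R"
    and L_add: "p \<in> carrier P \<Longrightarrow> p' \<in> carrier P \<Longrightarrow> L (p \<^bold>+ p') = L p \<oplus> L p'"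
    and L_const: "a \<in> carrier R \<Longrightarrow> p \<in> carrier P \<Longrightarrow> L (poly_of_const a \<cdot> p) = a \<otimes> L p"
begin

lemma L_nil [simp]: "L [] = \<zero>"
proof -
  have "L (poly_of_const \<zero> \<cdot> []) = \<zero> \<otimes> L []" by (rule L_const) auto
  thus ?thesis by simp
qed

lemma L_minus:
  assumes "p \<in> carrier P" "p' \<in> carrier P"
  shows "L (p \<^bold>- p') = L p \<ominus> L p'"
proof -
  have "p = (p \<^bold>- p') \<^bold>+ p'" using assms by algebra
  hence "L p = L (p \<^bold>- p') \<oplus> L p'" using assms L_add[of "p \<^bold>- p'" p'] by simp
  moreover have "L p \<in> carrier R" "L p' \<in> carrier R" "L (p \<^bold>- p') \<in> carrier R" using assms by auto
  ultimately show ?thesis by (simp add: minus_eq a_assoc r_neg)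
qed

text \<open>
  If \<open>L\<close> is read as the Laurent series \<open>\<theta> = (\<Sum>i. L (T^i) / T^(i + 1))\<close>, then \<open>kills E m\<close> says that
  \<open>E * \<theta>\<close> is closer than \<open>q ^ (- m)\<close> to a polynomial.
\<close>

definition kills :: "'a list \<Rightarrow> nat \<Rightarrow> bool" where
  "kills E m \<longleftrightarrow> (\<forall>F\<in>B m. L (E \<cdot> F) = \<zero>)"

lemma killsD: "kills E m \<Longrightarrow> F \<in> B m \<Longrightarrow> L (E \<cdot> F) = \<zero>"
  by (simp add: kills_def)

lemma kills_mono: "kills E m \<Longrightarrow> m' \<le> m \<Longrightarrow> kills E m'"
  using B_mono[of m' m] by (auto simp: kills_def)

lemma kills_Suc:
  assumes "E \<in> carrier P" "kills E m" "T \<in> Mon m" "L (E \<cdot> T) = \<zero>"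
  shows "kills E (Suc m)"
  unfolding kills_def
proof
  fix F assume F: "F \<in> B (Suc m)"
  define a where "a = coeff F m"
  define F' where "F' = F \<^bold>- poly_of_const a \<cdot> T"
  have c: "F \<in> carrier P" "T \<in> carrier P" "a \<in> carrier R" "poly_of_const a \<cdot> T \<in> carrier P"
    using F assms by (auto simp: B_closed Mon_closed a_def)
  have "coeff F i \<ominus> a \<otimes> coeff T i = \<zero>" if "i \<ge> m" for i
    using assms(3) F that c by (cases "i = m") (auto simp: a_def Mon_iff B_iff minus_eq r_neg)
  hence F': "F' \<in> B m" using c by (auto simp: F'_def B_iff coeff_minus coeff_const_mult)
  have "F = poly_of_const a \<cdot> T \<^bold>+ F'" unfolding F'_def using c by algebra
  hence "E \<cdot> F = poly_of_const a \<cdot> (E \<cdot> T) \<^bold>+ E \<cdot> F'"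
    using c assms(1) B_closed[OF F'] by (simp add: P.r_distr P.m_lcomm)
  hence "L (E \<cdot> F) = a \<otimes> L (E \<cdot> T) \<oplus> L (E \<cdot> F')"
    using c assms(1) B_closed[OF F'] by (simp add: L_add L_const)
  thus "L (E \<cdot> F) = \<zero>" using assms killsD[OF assms(2) F'] c by simp
qed

text \<open>Dirichlet approximation by the pigeonhole principle: \<open>q ^ (m + 1)\<close>
  candidates have at most \<open>q ^ m\<close> value vectors, so two of them agree and their
  difference is killed. Arbitrary monic \<open>T i\<close> of degree \<open>i\<close> serve as a
  triangular basis in place of the powers of the variable.\<close>

lemma exists_denominator: "\<exists>E\<in>B (Suc m). E \<noteq> [] \<and> kills E m"
proof -
  define T where "T i = (SOME p. p \<in> Mon i)" for i
  have T: "T i \<in> Mon i" for i unfolding T_def by (rule someI_ex) (rule Mon_nonempty)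
  hence Xc: "T i \<in> carrier P" for i using Mon_closed by blast
  define g where "g E = (\<lambda>i\<in>{..<m}. L (E \<cdot> T i))" for E
  have "\<not> inj_on g (B (Suc m))"
  proof
    assume "inj_on g (B (Suc m))"
    hence "card (B (Suc m)) \<le> card ({..<m} \<rightarrow>\<^sub>E carrier R)"
    proof (rule card_inj_on_le)
      show "g ` B (Suc m) \<subseteq> {..<m} \<rightarrow>\<^sub>E carrier R"
        by (intro image_subsetI) (simp add: g_def restrict_PiE_iff B_closed Xc)
    qed (auto simp: finite_carrier intro!: finite_PiE)
    hence "q ^ Suc m \<le> q ^ m" by (simp add: card_B card_PiE card_carrier)
    thus False using q_ge_2 by (simp add: power_le_imp_le_exp)
  qed
  then obtain E1 E2 where E12: "E1 \<in> B (Suc m)" "E2 \<in> B (Suc m)" "g E1 = g E2" "E1 \<noteq> E2"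
    by (auto simp: inj_on_def)
  hence c: "E1 \<in> carrier P" "E2 \<in> carrier P" by (auto simp: B_closed)
  define E where "E = E1 \<^bold>- E2"
  have E: "E \<in> B (Suc m)" "E \<in> carrier P" using E12 c by (auto simp: E_def)
  have "E \<noteq> []" using E12(4) c P.r_right_minus_eq[of E1 E2] by (simp add: E_def)
  moreover have "L (E \<cdot> T i) = \<zero>" if "i < m" for i
  proof -
    have "L (E1 \<cdot> T i) = L (E2 \<cdot> T i)" using fun_cong[OF E12(3), of i] that by (simp add: g_def)
    moreover have "E \<cdot> T i = E1 \<cdot> T i \<^bold>- E2 \<cdot> T i"
      unfolding E_def using c Xc[of i] by algebra
    ultimately show ?thesis using c Xc by (simp add: L_minus minus_eq r_neg)
  qed
  hence "kills E i" if "i \<le> m" for i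
    using that
  proof (induction i)
    case 0
    have "B 0 = {[]}" by (auto simp: B_def)
    thus ?case using E by (simp add: kills_def)
  next
    case (Suc i)
    thus ?case using E(2) T by (intro kills_Suc[of E i "T i"]) auto
  qed
  ultimately show ?thesis using E by blast
qed

definition min_denominator :: "'a list \<Rightarrow> nat \<Rightarrow> bool" where
  "min_denominator Q m \<longleftrightarrow> Q \<in> carrier P \<and> Q \<noteq> [] \<and> kills Q m \<and>
     (\<forall>E\<in>carrier P. E \<noteq> [] \<longrightarrow> kills E m \<longrightarrow> length Q \<le> length E)"

lemma exists_min_denominator:
  assumes "E \<in> carrier P" "E \<noteq> []" "kills E m"
  obtains Q where "min_denominator Q m" "length Q \<le> length E"
proof -
  define ok where "ok E \<longleftrightarrow> E \<in> carrier P \<and> E \<noteq> [] \<and> kills E m" for E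
  have "ok E" using assms by (simp add: ok_def)
  from ex_has_least_nat[of ok, OF this] obtain Q where "ok Q" "\<forall>E. ok E \<longrightarrow> length Q \<le> length E"
    by blast
  thus ?thesis using that[of Q] assms by (auto simp: ok_def min_denominator_def)
qed

text \<open>Let \<open>S\<close> be the remainder of \<open>E\<close> modulo \<open>Q\<close>. The
  quotient is short enough for \<open>S\<close> to inherit the weak condition at level
  \<open>degree Q\<close>. Dividing the test polynomials by \<open>Q\<close> then lifts the
  condition on \<open>S\<close> to the full level \<open>m\<close>, and minimality of
  \<open>Q\<close> leaves only \<open>S = []\<close>.\<close>

lemma min_denominator_dvd:
  assumes Q: "min_denominator Q m" "degree Q \<le> m"
    and E: "E \<in> carrier P" "length E \<le> Suc m" "kills E (degree Q)"
  shows "Q pdivides E"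
proof -
  define r where "r = degree Q"
  have Qc: "Q \<in> carrier P" "Q \<noteq> []" "kills Q m" using Q by (auto simp: min_denominator_def)
  have lQ: "length Q = Suc r" using Qc(2) by (cases Q) (simp_all add: r_def)
  obtain U S where US: "U \<in> carrier P" "S \<in> carrier P" "E = Q \<cdot> U \<^bold>+ S" "length S < length Q"
      "U \<noteq> [] \<Longrightarrow> Suc (length E) = length Q + length U"
    using long_division[OF E(1) Qc(1,2)] by blast
  have kr: "L (S \<cdot> F) = \<zero>" if F: "F \<in> B r" for F
  proof -
    have Fc: "F \<in> carrier P" "length F \<le> r" using F by (auto simp: B_def)
    have UF: "U \<cdot> F \<in> B m"
    proof (cases "U = []")
      case False
      have "length U + length F \<le> m + 1" using US(5)[OF False] E(2) Fc(2) lQ Q(2) by linarith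
      thus ?thesis using US(1) Fc(1) by (intro B_mult)
    qed (simp add: Fc)
    have "S \<cdot> F = E \<cdot> F \<^bold>- Q \<cdot> (U \<cdot> F)"
      unfolding US(3) using US(1,2) Qc(1) Fc(1) by algebra
    hence "L (S \<cdot> F) = L (E \<cdot> F) \<ominus> L (Q \<cdot> (U \<cdot> F))"
      using E US Qc Fc by (simp add: L_minus)
    thus ?thesis using killsD[OF E(3), of F] killsD[OF Qc(3) UF] F by (simp add: r_def minus_eq)
  qed
  have "kills S m"
    unfolding kills_def
  proof
    fix F assume "F \<in> B m"
    hence F: "F \<in> carrier P" "length F \<le> m" by (auto simp: B_def)
    obtain W F1 where W: "W \<in> carrier P" "F1 \<in> carrier P" "F = Q \<cdot> W \<^bold>+ F1" "length F1 < length Q"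
        "W \<noteq> [] \<Longrightarrow> Suc (length F) = length Q + length W"
      using long_division[OF F(1) Qc(1,2)] by blast
    have WS: "W \<cdot> S \<in> B m"
    proof (cases "W = []")
      case False
      have "length W + length S \<le> m + 1" using W(5)[OF False] US(4) F(2) lQ by linarith
      thus ?thesis using W(1) US(2) by (intro B_mult)
    qed (simp add: US)
    have "S \<cdot> F = Q \<cdot> (W \<cdot> S) \<^bold>+ S \<cdot> F1"
      unfolding W(3) using US(2) W(1,2) Qc(1) by algebra
    hence "L (S \<cdot> F) = L (Q \<cdot> (W \<cdot> S)) \<oplus> L (S \<cdot> F1)"
      using US W Qc by (simp add: L_add)
    thus "L (S \<cdot> F) = \<zero>" using killsD[OF Qc(3) WS] kr[of F1] W lQ by (simp add: B_def)
  qed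
  hence "S = []" using Q(1) US by (auto simp: min_denominator_def)
  hence "E = Q \<cdot> U" using US Qc by simp
  thus ?thesis using US by (intro pdividesI)
qed

text \<open>Some \<open>G\<close> in \<open>B m\<close> has \<open>L (E G) \<noteq> 0\<close>;
  adding scalar multiples of it to \<open>F\<close> shifts the value by any prescribed
  amount.\<close>

lemma equidistribution:
  assumes S: "finite S" "S \<subseteq> carrier P" "\<And>F G. F \<in> S \<Longrightarrow> G \<in> B m \<Longrightarrow> F \<^bold>+ G \<in> S"
    and E: "E \<in> carrier P" "\<not> kills E m" and v: "v \<in> carrier R"
  shows "q * card {F\<in>S. L (E \<cdot> F) = v} = card S"
proof -
  obtain G where G: "G \<in> B m" "L (E \<cdot> G) \<noteq> \<zero>" using E(2) by (auto simp: kills_def)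
  define g where "g = L (E \<cdot> G)"
  have Gc: "G \<in> carrier P" using G by (rule_tac B_closed)
  have g: "g \<in> carrier R" "inv g \<in> carrier R" "inv g \<otimes> g = \<one>"
    using G(2) E(1) Gc by (auto simp: g_def field_Units)
  define \<tau> where "\<tau> a F = F \<^bold>+ poly_of_const (a \<otimes> inv g) \<cdot> G" for a F
  have "card (carrier R) * card {F\<in>S. L (E \<cdot> F) = v} = card S"
  proof (rule equidistribution_of_translates[where \<phi> = "\<lambda>F. L (E \<cdot> F)" and \<tau> = \<tau>])
    show "abelian_group R" ..
    fix a assume a: "a \<in> carrier R"
    have c: "poly_of_const (a \<otimes> inv g) \<cdot> G \<in> B m" "poly_of_const (a \<otimes> inv g) \<cdot> G \<in> carrier P"
      using a g G Gc by auto
    show "\<tau> a F \<in> S" if "F \<in> S" for F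
      unfolding \<tau>_def using that c by (intro S(3))
    show "inj_on (\<tau> a) S"
      using S(2) c by (intro inj_onI) (simp add: \<tau>_def subset_iff)
    fix F assume F: "F \<in> S"
    hence Fc: "F \<in> carrier P" using S by auto
    have "E \<cdot> \<tau> a F = E \<cdot> F \<^bold>+ poly_of_const (a \<otimes> inv g) \<cdot> (E \<cdot> G)"
      unfolding \<tau>_def using Fc c Gc E a g by (simp add: P.r_distr P.m_lcomm)
    hence "L (E \<cdot> \<tau> a F) = L (E \<cdot> F) \<oplus> (a \<otimes> inv g) \<otimes> g"
      using Fc Gc E a g by (simp add: L_add L_const g_def)
    thus "L (E \<cdot> \<tau> a F) = L (E \<cdot> F) \<oplus> a" using a g by (simp add: m_assoc)
  qed (use S E v in \<open>auto simp: finite_carrier\<close>)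
  thus ?thesis by (simp add: card_carrier)
qed

lemma equidistribution_B:
  assumes "E \<in> carrier P" "\<not> kills E m" "v \<in> carrier R"
  shows "q * card {F\<in>B m. L (E \<cdot> F) = v} = q ^ m"
  using equidistribution[of "B m" m E v] assms B_add by (simp add: card_B B_closed subset_iff)

lemma equidistribution_Mon:
  assumes "E \<in> carrier P" "\<not> kills E m" "v \<in> carrier R"
  shows "q * card {F\<in>Mon m. L (E \<cdot> F) = v} = q ^ m"
  using equidistribution[of "Mon m" m E v] assms Mon_add by (simp add: card_Mon Mon_closed subset_iff)

text \<open>Being killed up to \<open>k\<close> amounts to \<open>k\<close> linear conditions on the
  cofactor of \<open>D\<close>, and \<open>nondeg\<close> is their linear independence. Instead of a
  rank computation, the pairs \<open>(F, C)\<close> with \<open>L (D F C) = 0\<close> are counted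
  twice: for fixed \<open>F\<close> the number depends only on whether \<open>D F\<close> is killed,
  for fixed \<open>C\<close> only on whether \<open>C\<close> is zero.\<close>

lemma card_killed_multiples:
  assumes D: "D \<in> Mon e" and le: "e + k \<le> d"
    and nondeg: "\<And>C. C \<in> B k \<Longrightarrow> C \<noteq> [] \<Longrightarrow> \<not> kills (D \<cdot> C) (d - e)"
  shows "card {F\<in>Mon d. kills F k \<and> D pdivides F} * q ^ (k + e) = q ^ d"
proof -
  have Dc: "D \<in> carrier P" "D \<noteq> []" using D Mon_closed Mon_nonzero by auto
  define T where "T = Mon (d - e)"
  define S where "S = {F\<in>T. kills (D \<cdot> F) k}"
  have T: "finite T" "card T = q ^ (d - e)" "T \<subseteq> carrier P"
    by (auto simp: T_def card_Mon Mon_closed)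
  have bij: "{F\<in>Mon d. kills F k \<and> D pdivides F} = (\<lambda>F. D \<cdot> F) ` S"
  proof (intro equalityI subsetI)
    fix F assume F: "F \<in> {F\<in>Mon d. kills F k \<and> D pdivides F}"
    then obtain u where "F = D \<cdot> u" "u \<in> Mon (d - e)" using Mon_dvd_cofactor[OF D] by blast
    thus "F \<in> (\<lambda>F. D \<cdot> F) ` S" using F by (auto simp: S_def T_def)
  next
    fix F assume "F \<in> (\<lambda>F. D \<cdot> F) ` S"
    then obtain u where u: "F = D \<cdot> u" "u \<in> Mon (d - e)" "kills F k" by (auto simp: S_def T_def)
    hence "F \<in> Mon (e + (d - e))" using Mon_mult[OF D] by auto
    thus "F \<in> {F\<in>Mon d. kills F k \<and> D pdivides F}"
      using u le Mon_closed by (auto intro: pdividesI)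
  qed
  have inj: "inj_on (\<lambda>F. D \<cdot> F) S"
    using Dc T P.m_lcancel by (intro inj_onI) (auto simp: S_def subset_iff)
  have cS: "card {F\<in>Mon d. kills F k \<and> D pdivides F} = card S"
    unfolding bij by (rule card_image[OF inj])
  have SS: "(\<Sum>F\<in>T. card {C\<in>B k. L ((D \<cdot> F) \<cdot> C) = \<zero>}) = (\<Sum>C\<in>B k. card {F\<in>T. L ((D \<cdot> C) \<cdot> F) = \<zero>})"
  proof -
    have "(\<Sum>F\<in>T. card {C\<in>B k. L ((D \<cdot> F) \<cdot> C) = \<zero>}) = (\<Sum>F\<in>T. \<Sum>C\<in>B k. if L ((D \<cdot> F) \<cdot> C) = \<zero> then 1 else 0)"
      by (simp flip: sum.inter_filter)
    also have "\<dots> = (\<Sum>C\<in>B k. \<Sum>F\<in>T. if L ((D \<cdot> F) \<cdot> C) = \<zero> then 1 else 0)" by (rule sum.swap)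
    also have "\<dots> = (\<Sum>C\<in>B k. \<Sum>F\<in>T. if L ((D \<cdot> C) \<cdot> F) = \<zero> then 1 else 0)"
      using Dc T B_closed by (intro sum.cong refl) (auto simp: P.m_ac subset_iff)
    also have "\<dots> = (\<Sum>C\<in>B k. card {F\<in>T. L ((D \<cdot> C) \<cdot> F) = \<zero>})"
      using T by (simp flip: sum.inter_filter)
    finally show ?thesis .
  qed
  have "q * (\<Sum>F\<in>T. card {C\<in>B k. L ((D \<cdot> F) \<cdot> C) = \<zero>}) = (\<Sum>F\<in>T. if F \<in> S then q * q ^ k else q ^ k)"
    unfolding sum_distrib_left
  proof (rule sum.cong[OF refl])
    fix F assume F: "F \<in> T"
    show "q * card {C\<in>B k. L ((D \<cdot> F) \<cdot> C) = \<zero>} = (if F \<in> S then q * q ^ k else q ^ k)"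
    proof (cases "F \<in> S")
      case True
      hence "{C\<in>B k. L ((D \<cdot> F) \<cdot> C) = \<zero>} = B k" by (auto simp: S_def kills_def)
      thus ?thesis using True by (simp add: card_B)
    next
      case False
      thus ?thesis using F T Dc equidistribution_B[of "D \<cdot> F" k \<zero>] by (auto simp: S_def)
    qed
  qed
  also have "\<dots> = card S * (q * q ^ k) + (card T - card S) * q ^ k"
  proof -
    have "T \<inter> S = S" "T \<inter> - S = T - S" "S \<subseteq> T" by (auto simp: S_def)
    thus ?thesis using T
      by (simp add: sum.If_cases card_Diff_subset finite_subset[of S T])
  qed
  finally have 1: "q * (\<Sum>F\<in>T. card {C\<in>B k. L ((D \<cdot> F) \<cdot> C) = \<zero>}) = card S * (q * q ^ k) + (card T - card S) * q ^ k" .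
  have "q * (\<Sum>C\<in>B k. card {F\<in>T. L ((D \<cdot> C) \<cdot> F) = \<zero>}) = (\<Sum>C\<in>B k. if C = [] then q * card T else card T)"
    unfolding sum_distrib_left
  proof (rule sum.cong[OF refl])
    fix C assume C: "C \<in> B k"
    show "q * card {F\<in>T. L ((D \<cdot> C) \<cdot> F) = \<zero>} = (if C = [] then q * card T else card T)"
    proof (cases "C = []")
      case True
      hence "{F\<in>T. L ((D \<cdot> C) \<cdot> F) = \<zero>} = T" using Dc T by auto
      thus ?thesis using True by simp
    next
      case False
      have "D \<cdot> C \<in> carrier P" using Dc C by (simp add: B_closed)
      thus ?thesis
        using equidistribution_Mon[OF _ nondeg[OF C False], of \<zero>] False by (simp add: T_def card_Mon)
    qed
  qed
  also have "\<dots> = q * card T + (q ^ k - 1) * card T"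
  proof -
    have "B k \<inter> {C. C = []} = {[]}" "B k \<inter> - {C. C = []} = B k - {[]}" by auto
    thus ?thesis by (simp add: sum.If_cases card_Diff_singleton card_B)
  qed
  finally have "card S * (q * q ^ k) + (card T - card S) * q ^ k = q * card T + (q ^ k - 1) * card T"
    using 1 SS by simp
  moreover have "card S \<le> card T" using T by (intro card_mono) (auto simp: S_def)
  moreover have "q ^ k \<ge> 1" using q_ge_2 by simp
  ultimately have "int (card S) * (int q * int q ^ k) + (int (card T) - int (card S)) * int q ^ k
      = int q * int (card T) + (int q ^ k - 1) * int (card T)"
    by (metis (mono_tags, opaque_lifting) of_nat_1 of_nat_add of_nat_diff of_nat_mult of_nat_power)
  hence "(int q - 1) * (int (card S) * int q ^ k) = (int q - 1) * int (card T)"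
    by (simp add: algebra_simps)
  hence "int (card S) * int q ^ k = int (card T)" using q_ge_2 by simp
  hence "int (card S * q ^ k) = int (q ^ (d - e))" by (simp add: T(2))
  hence "card S * q ^ k = q ^ (d - e)" by (simp only: of_nat_eq_iff)
  moreover have "q ^ (d - e) * q ^ e = q ^ d" using le by (simp flip: power_add)
  ultimately show ?thesis unfolding cS by (simp add: power_add mult.assoc[symmetric])
qed

text \<open>A denominator \<open>Q\<close> of degree below \<open>k\<close> that is good to level
  \<open>d\<close> divides every monic \<open>F\<close> of degree \<open>d\<close> that is killed up
  to \<open>k\<close>. If \<open>F\<close> is irreducible, \<open>Q\<close> must be constant, so
  \<open>L\<close> vanishes below degree \<open>d\<close>; division by \<open>F\<close> extends this
  to all degrees below \<open>d + k\<close>.\<close>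

lemma no_irr_killed_if_degenerate:
  assumes E: "E \<in> B k" "E \<noteq> []" "kills E d" and "k \<le> d"
    and F: "F \<in> Mon d" "F \<in> irr" "kills F k"
    and G: "G \<in> B (d + k)"
  shows "L G = \<zero>"
proof -
  have "E \<in> carrier P" using E by (simp add: B_closed)
  then obtain Q where Q: "min_denominator Q d" "length Q \<le> length E"
    using exists_min_denominator[OF _ E(2,3)] by blast
  have Qc: "Q \<in> carrier P" "Q \<noteq> []" "kills Q d" using Q by (auto simp: min_denominator_def)
  have lQ: "length Q \<le> k" using Q E by (auto simp: B_def)
  have Fc: "F \<in> carrier P" "F \<noteq> []" using F Mon_closed Mon_nonzero by auto
  have "Q pdivides F"
    using lQ F(1) Fc \<open>k \<le> d\<close> Mon_length[OF F(1)] kills_mono[OF F(3)]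
    by (intro min_denominator_dvd[OF Q(1)]) auto
  then obtain u where u: "u \<in> carrier P" "F = Q \<cdot> u" by (rule pdividesE)
  have u0: "u \<noteq> []" using u Fc Qc by auto
  have "Q \<in> Units P \<or> u \<in> Units P"
    using pirreducibleE(3)[OF carrier_is_subring Fc(1), of Q u] F u Qc by (auto simp: irr_def)
  moreover have "length u \<noteq> 1"
    using length_mult(2)[OF Qc(1) u(1) Qc(2) u0] u(2) Mon_length[OF F(1)] lQ \<open>k \<le> d\<close> by auto
  ultimately have QU: "Q \<in> Units P" by (auto simp: unit_iff)
  have low: "L H = \<zero>" if H: "H \<in> B d" for H
  proof -
    define Qi where "Qi = inv\<^bsub>P\<^esub> Q"
    have Qi: "Qi \<in> Units P" "Q \<cdot> Qi = \<one>\<^bsub>P\<^esub>" using QU by (auto simp: Qi_def)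
    hence Qi': "Qi \<in> carrier P" "length Qi = 1" by (auto simp: unit_iff)
    have Hc: "H \<in> carrier P" "length H \<le> d" using H by (auto simp: B_def)
    have "Qi \<cdot> H \<in> B d" using Qi' Hc by (intro B_mult) auto
    hence "L (Q \<cdot> (Qi \<cdot> H)) = \<zero>" by (rule killsD[OF Qc(3)])
    moreover have "Q \<cdot> (Qi \<cdot> H) = H" using Qc Qi Qi' Hc by (simp add: P.m_assoc[symmetric])
    ultimately show ?thesis by simp
  qed
  have Gc: "G \<in> carrier P" "length G \<le> d + k" using G by (auto simp: B_def)
  obtain W G1 where W: "W \<in> carrier P" "G1 \<in> carrier P" "G = F \<cdot> W \<^bold>+ G1" "length G1 < length F"
      "W \<noteq> [] \<Longrightarrow> Suc (length G) = length F + length W"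
    using long_division[OF Gc(1) Fc] by blast
  have "W \<in> B k" using W(1,5) Gc Mon_length[OF F(1)] by (cases "W = []") (auto simp: B_def)
  hence "L (F \<cdot> W) = \<zero>" by (rule killsD[OF F(3)])
  moreover have "L G1 = \<zero>" using W Mon_length[OF F(1)] by (intro low) (auto simp: B_def)
  ultimately show ?thesis using W Fc by (simp add: L_add)
qed

text \<open>If \<open>D1 D2 C\<close> were killed, \<open>Q\<close> would divide it and hence also
  \<open>D1 C\<close>. For \<open>degree Q \<ge> k\<close> the bound on \<open>e1\<close> makes
  \<open>D1 C\<close> too short for that. For \<open>degree Q < k\<close> the truncated difference
  forces \<open>e1 = 0\<close>, and the contradiction comes from \<open>nd\<close> applied to
  \<open>Q\<close> itself.\<close>

lemma nondegenerate_multiples: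
  assumes nd: "\<And>E. E \<in> B k \<Longrightarrow> E \<noteq> [] \<Longrightarrow> \<not> kills E d"
    and Q: "min_denominator Q m" "degree Q \<le> m"
    and D1: "D1 \<in> Mon e1" "e1 \<le> degree Q - k"
    and D2: "D2 \<in> Mon e2" "\<And>E. E \<in> carrier P \<Longrightarrow> Q pdivides D2 \<cdot> E \<Longrightarrow> Q pdivides E"
    and bounds: "e1 + e2 + k \<le> m" "degree Q + e1 + e2 \<le> d"
    and C: "C \<in> B k" "C \<noteq> []"
  shows "\<not> kills ((D1 \<cdot> D2) \<cdot> C) (d - (e1 + e2))"
proof
  assume K: "kills ((D1 \<cdot> D2) \<cdot> C) (d - (e1 + e2))"
  define r where "r = degree Q"
  have Qc: "Q \<in> carrier P" "Q \<noteq> []" "kills Q m" using Q by (auto simp: min_denominator_def)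
  have lQ: "length Q = Suc r" using Qc(2) by (cases Q) (simp_all add: r_def)
  have c: "D1 \<in> carrier P" "D2 \<in> carrier P" "C \<in> carrier P" "D1 \<noteq> []" "D2 \<noteq> []" "length C \<le> k"
    using D1 D2 C Mon_closed Mon_nonzero by (auto simp: B_def)
  define E1 where "E1 = D1 \<cdot> C"
  have E1: "E1 \<in> carrier P" "E1 \<noteq> []" "Suc (length E1) = Suc e1 + length C"
    using length_mult[of D1 C] c C Mon_length[OF D1(1)] by (auto simp: E1_def)
  have E: "(D1 \<cdot> D2) \<cdot> C = D2 \<cdot> E1" using c by (simp add: E1_def P.m_ac)
  have lE: "D2 \<cdot> E1 \<noteq> []" "Suc (length (D2 \<cdot> E1)) = Suc e2 + length E1"
    using length_mult[of D2 E1] c E1 Mon_length[OF D2(1)] by auto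
  have "Q pdivides D2 \<cdot> E1"
  proof (rule min_denominator_dvd[OF Q])
    show "length (D2 \<cdot> E1) \<le> Suc m" using lE E1 c bounds by linarith
    show "kills (D2 \<cdot> E1) (degree Q)"
      using K bounds(2) unfolding E by (intro kills_mono[OF K[unfolded E]]) linarith
  qed (use c E1 in auto)
  hence "Q pdivides E1" using D2(2) E1 by blast
  then obtain U' where U': "U' \<in> carrier P" "E1 = Q \<cdot> U'" by (rule pdividesE)
  have U'0: "U' \<noteq> []" using U' E1 Qc by auto
  have lU': "Suc (length E1) = Suc r + length U'"
    using length_mult(2)[OF Qc(1) U'(1) Qc(2) U'0] U' lQ by simp
  have U'1: "length U' \<ge> 1" using U'0 by (cases U') auto
  show False
  proof (cases "k \<le> r")
    case True
    thus False using lU' U'1 E1 c D1 by (auto simp: r_def)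
  next
    case False
    hence e1: "e1 = 0" using D1 by (simp add: r_def)
    define U where "U = D2 \<cdot> U'"
    have U: "U \<in> carrier P" "U \<noteq> []" "Suc (length U) = Suc e2 + length U'"
      using length_mult[of D2 U'] c U' U'0 Mon_length[OF D2(1)] by (auto simp: U_def)
    have EQ: "D2 \<cdot> E1 = Q \<cdot> U" using U' c Qc by (simp add: U_def P.m_lcomm)
    have lUm: "length U \<le> Suc m" using U lU' E1 c bounds U'1 by linarith
    have "\<not> kills Q d" using nd[of Q] Qc lQ False by (auto simp: B_def)
    \<comment> \<open>The first level at which \<open>Q\<close> fails to kill. Division of the
      witness \<open>F\<close> by \<open>U\<close> gives a quotient short enough for
      \<open>K\<close> and a remainder shorter than this level, so \<open>L (Q F)\<close> would
      vanish after all.\<close>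
    define m' where "m' = (LEAST j. \<not> kills Q j)"
    have nk: "\<not> kills Q m'" unfolding m'_def by (rule LeastI) fact
    have m'd: "m' \<le> d" unfolding m'_def by (rule Least_le) fact
    have "m < m'" using nk kills_mono[OF Qc(3)] by (meson not_le)
    then obtain m1 where m1: "m' = Suc m1" by (cases m') auto
    have k1: "kills Q m1" using not_less_Least[of m1 "\<lambda>j. \<not> kills Q j"] m1 by (auto simp: m'_def)
    obtain F where F: "F \<in> B m'" "L (Q \<cdot> F) \<noteq> \<zero>" using nk by (auto simp: kills_def)
    hence Fc: "F \<in> carrier P" "length F \<le> m'" by (auto simp: B_def)
    obtain W F1 where W: "W \<in> carrier P" "F1 \<in> carrier P" "F = U \<cdot> W \<^bold>+ F1" "length F1 < length U"
        "W \<noteq> [] \<Longrightarrow> Suc (length F) = length U + length W"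
      using long_division[OF Fc(1) U(1,2)] by blast
    have "F1 \<in> B m1" using W lUm m1 \<open>m < m'\<close> by (auto simp: B_def)
    hence z1: "L (Q \<cdot> F1) = \<zero>" by (rule killsD[OF k1])
    have "W \<in> B (d - (e1 + e2))"
    proof (cases "W = []")
      case False
      have "length W \<le> d - (e1 + e2)" using W(5)[OF False] U U'1 Fc m'd e1 by linarith
      thus ?thesis using W by (simp add: B_def)
    qed simp
    hence z2: "L ((Q \<cdot> U) \<cdot> W) = \<zero>" using killsD[OF K] E EQ by simp
    have "Q \<cdot> F = (Q \<cdot> U) \<cdot> W \<^bold>+ Q \<cdot> F1" unfolding W(3) using Qc(1) U(1) W(1,2) by algebra
    hence "L (Q \<cdot> F) = \<zero>" using z1 z2 Qc U W by (simp add: L_add)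
    thus False using F by simp
  qed
qed

text \<open>
  The simplifier would otherwise destroy the parameter \<open>\<lambda>p. length p - 1\<close> of the interpretation \<open>PS\<close>.
\<close>

declare One_nat_def [simp del]

text \<open>\<open>V\<close>, the monic polynomials of degree \<open>d\<close> killed up to
  \<open>k\<close>, is sifted by irreducibles of degree at most \<open>Z < d\<close>, so
  irreducibles of degree \<open>d\<close> survive. \<open>4 * Z + k \<le> m\<close> and
  \<open>2 * m \<le> d + k\<close> leave room for the moduli beside \<open>Q\<close>;
  \<open>m \<le> 6 * (Z + 1)\<close> limits the total degree of the prime divisors of
  \<open>Q\<close> in terms of the sieve level.\<close>

lemma card_irr_killed_le:
  assumes nontriv: "G \<in> B (d + k)" "L G \<noteq> \<zero>"
    and m: "2 * m \<le> d + k" "4 * Z + k \<le> m" "m \<le> 6 * (Z + 1)"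
    and d: "k \<le> d" "Z < d" and l: "k + 1 \<le> q ^ l"
  shows "real (card {p\<in>irr. degree p = d \<and> kills p k}) * (exp (-13) * ((real Z + 1) / (real l + 1)))
    \<le> real q ^ d / real q ^ k"
proof (cases "\<exists>E\<in>B k. E \<noteq> [] \<and> kills E d")
  case True
  then obtain E where E: "E \<in> B k" "E \<noteq> []" "kills E d" by blast
  have "{p\<in>irr. degree p = d \<and> kills p k} = {}"
    using no_irr_killed_if_degenerate[OF E d(1) _ _ _ nontriv(1)] nontriv(2) irr_Mon by blast
  hence "card {p\<in>irr. degree p = d \<and> kills p k} = 0" by (simp only: card.empty)
  thus ?thesis by simp
next
  case False
  hence nd: "\<And>E. E \<in> B k \<Longrightarrow> E \<noteq> [] \<Longrightarrow> \<not> kills E d" by blast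
  obtain E0 where E0: "E0 \<in> B (Suc m)" "E0 \<noteq> []" "kills E0 m" using exists_denominator by blast
  obtain Q where Q: "min_denominator Q m" "length Q \<le> length E0"
    using exists_min_denominator[OF B_closed[OF E0(1)] E0(2,3)] by blast
  have Qc: "Q \<in> carrier P" "Q \<noteq> []" using Q by (auto simp: min_denominator_def)
  define r where "r = degree Q"
  have rm: "degree Q \<le> m" "r \<le> m" using Q E0 by (auto simp: B_def r_def)
  \<comment> \<open>Orthogonality concerns unions of two moduli, hence half of the admissible degree
    \<open>r - k\<close> for the part composed of divisors of \<open>Q\<close>.\<close>
  define Y where "Y = min ((r - k) div 2) Z"
  define J where "J = irr_divisors Q"
  have J: "finite J" "J \<subseteq> irr" using irr_divisors[OF Qc] by (auto simp: J_def irr_divisors_def)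
  have degJ: "(\<Sum>p\<in>J. degree p) \<le> 6 * (Y + 1) + k"
  proof -
    have "(\<Sum>p\<in>J. degree p) \<le> r" unfolding J_def r_def by (rule irr_divisors(2)[OF Qc])
    also have "r \<le> 6 * (Y + 1) + k"
    proof (cases "(r - k) div 2 \<le> Z")
      case True
      hence "Y = (r - k) div 2" by (simp add: Y_def)
      thus ?thesis by presburger
    next
      case False
      hence "Y = Z" by (simp add: Y_def)
      thus ?thesis using rm(2) m(3) by presburger
    qed
    finally show ?thesis .
  qed
  define V where "V = {F\<in>Mon d. kills F k}"
  have count: "card {F\<in>V. \<forall>p\<in>w. p pdivides F} * q ^ (k + (\<Sum>p\<in>w. degree p)) = q ^ d"
    if w: "finite w" "w \<subseteq> irr" "(\<Sum>p\<in>w \<inter> J. degree p) \<le> 2 * Y" "(\<Sum>p\<in>w - J. degree p) \<le> 2 * Z" for w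
  proof -
    define e1 where "e1 = (\<Sum>p\<in>w \<inter> J. degree p)"
    define e2 where "e2 = (\<Sum>p\<in>w - J. degree p)"
    have e: "(\<Sum>p\<in>w. degree p) = e1 + e2"
      unfolding e1_def e2_def using w(1) by (simp add: sum.Int_Diff[of w _ J])
    have f: "finite (w \<inter> J)" "finite (w - J)" "w \<inter> J \<subseteq> irr" "w - J \<subseteq> irr" using w by auto
    have D: "prs (w \<inter> J) \<in> Mon e1" "prs (w - J) \<in> Mon e2"
      unfolding e1_def e2_def by (rule prs_Mon[OF f(1,3)], rule prs_Mon[OF f(2,4)])
    have eq: "prs w = prs (w \<inter> J) \<cdot> prs (w - J)"
      using prs_Un[OF f] by (simp add: Int_Diff_Un Int_Diff_disjoint)
    have Dw: "prs w \<in> Mon (e1 + e2)" unfolding eq using D by (rule Mon_mult)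
    have b: "e1 \<le> degree Q - k" "e1 + e2 + k \<le> m" "degree Q + e1 + e2 \<le> d"
    proof -
      have e12: "e1 \<le> 2 * Y" "e2 \<le> 2 * Z" using w(3,4) unfolding e1_def e2_def by blast+
      have Y: "2 * Y \<le> r - k" "Y \<le> Z" by (auto simp: Y_def)
      show "e1 \<le> degree Q - k" using e12 Y unfolding r_def by linarith
      \<comment> \<open>The second bound is
        \<open>m + 4 * Z \<le> 2 * m - k \<le> d\<close>.\<close>
      show "e1 + e2 + k \<le> m" "degree Q + e1 + e2 \<le> d" using e12 Y m(1,2) rm(1) by linarith+
    qed
    have "{F\<in>V. \<forall>p\<in>w. p pdivides F} = {F\<in>Mon d. kills F k \<and> prs w pdivides F}"
      using prs_dvd_iff[OF w(1,2)] Mon_closed by (auto simp: V_def)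
    moreover have "card {F\<in>Mon d. kills F k \<and> prs w pdivides F} * q ^ (k + (e1 + e2)) = q ^ d"
    proof (rule card_killed_multiples[OF Dw])
      show "e1 + e2 + k \<le> d" using b m d by linarith
      fix C assume C: "C \<in> B k" "C \<noteq> []"
      show "\<not> kills (prs w \<cdot> C) (d - (e1 + e2))"
        unfolding eq
      proof (rule nondegenerate_multiples[OF nd Q(1) rm(1) D(1) b(1) D(2) _ b(2,3) C])
        fix E assume "E \<in> carrier P" "Q pdivides prs (w - J) \<cdot> E"
        thus "Q pdivides E"
          using f Qc by (intro coprime_prs_cancel[of "w - J" Q E]) (auto simp: J_def irr_divisors_def)
      qed auto
    qed
    ultimately show ?thesis unfolding e by simp
  qed
  have fV: "finite V" by (simp add: V_def)
  have cV: "card V * q ^ k = q ^ d" using count[of "{}"] by simp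
  have "real (card {F\<in>V. \<forall>s\<in>PS.family J Y Z. \<forall>p\<in>s. \<not> p pdivides F}) * (\<Sum>s\<in>PS.family J Y Z. \<Prod>p\<in>s. 1 / (PS.nm p - 1))
      \<le> real (card V)"
  proof (rule bessel_sieve[OF fV])
    show "finite (PS.family J Y Z)"
      unfolding PS.family_def using J by (intro finite_imageI finite_cartesian_product PS.finite_sqf) auto
    fix s assume "s \<in> PS.family J Y Z"
    then obtain s1 s2 where s: "s = s1 \<union> s2" "finite s1" "finite s2" "s1 \<subseteq> J" "s2 \<subseteq> irr - J"
        "(\<Sum>p\<in>s1. degree p) \<le> Y" "(\<Sum>p\<in>s2. degree p) \<le> Z"
      by (auto simp: PS.family_def PS.sqf_def)
    thus "finite s" by simp
    show "PS.nm p > 1" if "p \<in> s" for p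
      using PS.nm_ge_2[of p] that s J by auto
    fix t w assume "t \<in> PS.family J Y Z" and w: "w \<subseteq> s \<union> t"
    then obtain t1 t2 where t: "t = t1 \<union> t2" "finite t1" "finite t2" "t1 \<subseteq> J" "t2 \<subseteq> irr - J"
        "(\<Sum>p\<in>t1. degree p) \<le> Y" "(\<Sum>p\<in>t2. degree p) \<le> Z"
      by (auto simp: PS.family_def PS.sqf_def)
    have w': "finite w" "w \<subseteq> irr"
      using finite_subset[OF w] s(1-3) t(1-3) by simp (use w s(1,4,5) t(1,4,5) J(2) in blast)
    have un: "(\<Sum>p\<in>x. degree p) \<le> (\<Sum>p\<in>a. degree p) + (\<Sum>p\<in>b. degree p)"
      if "finite a" "finite b" "x \<subseteq> a \<union> b" for x a b :: "'a list set"
    proof -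
      have "(\<Sum>p\<in>x. degree p) \<le> (\<Sum>p\<in>a \<union> b. degree p)" using that by (intro sum_mono2) auto
      also have "\<dots> \<le> (\<Sum>p\<in>a. degree p) + (\<Sum>p\<in>b. degree p)"
        using that by (subst sum.union_inter[symmetric]) auto
      finally show ?thesis .
    qed
    have "(\<Sum>p\<in>w \<inter> J. degree p) \<le> 2 * Y" "(\<Sum>p\<in>w - J. degree p) \<le> 2 * Z"
    proof -
      have "w \<inter> J \<subseteq> s1 \<union> t1" "w - J \<subseteq> s2 \<union> t2" using w s(1,4,5) t(1,4,5) by blast+
      thus "(\<Sum>p\<in>w \<inter> J. degree p) \<le> 2 * Y" "(\<Sum>p\<in>w - J. degree p) \<le> 2 * Z"
        using un[of s1 t1 "w \<inter> J"] un[of s2 t2 "w - J"] s(2,3,6,7) t(2,3,6,7) by linarith+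
    qed
    from count[OF w' this] have "card {F\<in>V. \<forall>p\<in>w. p pdivides F} * q ^ (\<Sum>p\<in>w. degree p) * q ^ k = card V * q ^ k"
      using cV by (simp add: power_add mult_ac)
    hence "card {F\<in>V. \<forall>p\<in>w. p pdivides F} * q ^ (\<Sum>p\<in>w. degree p) = card V"
      using q_ge_2 by simp
    from arg_cong[OF this, of real]
    have "real (card {F\<in>V. \<forall>p\<in>w. p pdivides F}) * real q ^ (\<Sum>p\<in>w. degree p) = real (card V)"
      by (simp only: of_nat_mult of_nat_power)
    thus "real (card {F\<in>V. \<forall>p\<in>w. p pdivides F}) * (\<Prod>p\<in>w. PS.nm p) = real (card V)"
      by (simp add: PS.nm_def power_sum)
  qed
  moreover have "card {p\<in>irr. degree p = d \<and> kills p k} \<le> card {F\<in>V. \<forall>s\<in>PS.family J Y Z. \<forall>p\<in>s. \<not> p pdivides F}"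
  proof (rule card_mono)
    show "{p\<in>irr. degree p = d \<and> kills p k} \<subseteq> {F\<in>V. \<forall>s\<in>PS.family J Y Z. \<forall>p\<in>s. \<not> p pdivides F}"
    proof clarify
      fix F assume F: "F \<in> irr" "kills F k" "d = degree F"
      have False if "s \<in> PS.family J Y Z" "p \<in> s" "p pdivides F" for s p
      proof -
        have "p \<in> irr" "degree p \<le> Z"
          using that(1,2) J PS.sqf_dg_le[of _ J Y p] PS.sqf_dg_le[of _ "irr - J" Z p]
          by (auto simp: PS.family_def PS.sqf_def Y_def)
        moreover have "p = F" using irr_dvd_irr[OF \<open>p \<in> irr\<close> F(1)] that by simp
        ultimately show False using F d by simp
      qed
      thus "F \<in> V \<and> (\<forall>s\<in>PS.family J Y Z. \<forall>p\<in>s. \<not> p pdivides F)"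
        using F irr_Mon by (auto simp: V_def)
    qed
  qed (use fV in auto)
  ultimately have "real (card {p\<in>irr. degree p = d \<and> kills p k}) * (exp (-13) * ((real Z + 1) / (real l + 1))) \<le> real (card V)"
  proof -
    have "exp (-13) * ((real Z + 1) / (real l + 1)) \<le> (\<Sum>s\<in>PS.family J Y Z. \<Prod>p\<in>s. 1 / (PS.nm p - 1))"
      by (rule PS.family_sum_ge[OF J degJ l])
    hence "real (card {p\<in>irr. degree p = d \<and> kills p k}) * (exp (-13) * ((real Z + 1) / (real l + 1)))
       \<le> real (card {F\<in>V. \<forall>s\<in>PS.family J Y Z. \<forall>p\<in>s. \<not> p pdivides F}) * (\<Sum>s\<in>PS.family J Y Z. \<Prod>p\<in>s. 1 / (PS.nm p - 1))"
      using \<open>card _ \<le> card _\<close> by (intro mult_mono) auto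
    thus ?thesis using \<open>real (card {F\<in>V. _ F}) * _ \<le> _\<close> by linarith
  qed
  also have "real (card V) = real q ^ d / real q ^ k"
  proof -
    have "real (card V) * real q ^ k = real q ^ d"
      using arg_cong[OF cV, of real] by (simp only: of_nat_mult of_nat_power)
    thus ?thesis using q_ge_2 by (simp add: field_simps)
  qed
  finally show ?thesis .
qed

end

subsection \<open>Counting solutions by averaging over functionals\<close>

lemma sum_of_bool_eq_card: "finite S \<Longrightarrow> (\<Sum>x\<in>S. of_bool (p x)) = real (card {x\<in>S. p x})"
  by (simp add: Int_def)

text \<open>Squared distance of the distribution of \<open>f\<close> on \<open>A\<close> from the
  uniform one; it stands in for the sum of the squared nontrivial Fourier coefficients.\<close>

definition fibre_variance :: "'k set \<Rightarrow> ('x \<Rightarrow> 'k) \<Rightarrow> 'x set \<Rightarrow> real" where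
  "fibre_variance K f A = (\<Sum>u\<in>K. (real (card {x\<in>A. f x = u}) - real (card A) / real (card K))\<^sup>2)"

lemma sum_card_fibres:
  assumes "finite K" "finite A" "f ` A \<subseteq> K"
  shows "(\<Sum>u\<in>K. real (card {x\<in>A. f x = u})) = real (card A)"
  using sum.group[OF assms(2,1,3), of "\<lambda>_. 1::real"] by simp

text \<open>Written through coincidences of values, the variance can be averaged over functionals:
  for each pair one only has to count the functionals that agree on it.\<close>

lemma fibre_variance_eq:
  assumes K: "finite K" "K \<noteq> {}" and A: "finite A" "f ` A \<subseteq> K"
  shows "fibre_variance K f A = (\<Sum>x\<in>A. \<Sum>y\<in>A. of_bool (f x = f y)) - (real (card A))\<^sup>2 / real (card K)"
proof -
  define a where "a = real (card A) / real (card K)"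
  have cK: "real (card K) > 0" using K by (simp add: card_gt_0_iff)
  have "fibre_variance K f A = (\<Sum>u\<in>K. (real (card {x\<in>A. f x = u}))\<^sup>2 - 2 * a * real (card {x\<in>A. f x = u}) + a\<^sup>2)"
    unfolding fibre_variance_def a_def by (intro sum.cong refl) (simp add: power2_eq_square algebra_simps)
  also have "\<dots> = (\<Sum>u\<in>K. (real (card {x\<in>A. f x = u}))\<^sup>2) - 2 * a * real (card A) + real (card K) * a\<^sup>2"
    using sum_card_fibres[OF K(1) A] by (simp add: sum.distrib sum_subtractf sum_distrib_left[symmetric])
  finally have 1: "fibre_variance K f A = (\<Sum>u\<in>K. (real (card {x\<in>A. f x = u}))\<^sup>2) - 2 * a * real (card A) + real (card K) * a\<^sup>2" .
  have 2: "- 2 * a * real (card A) + real (card K) * a\<^sup>2 = - ((real (card A))\<^sup>2 / real (card K))"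
    using cK by (simp add: a_def power2_eq_square field_simps)
  have 3: "(\<Sum>u\<in>K. (real (card {x\<in>A. f x = u}))\<^sup>2) = (\<Sum>x\<in>A. \<Sum>y\<in>A. of_bool (f x = f y))"
  proof -
    have "(\<Sum>x\<in>A. \<Sum>y\<in>A. of_bool (f x = f y)) = (\<Sum>x\<in>A. real (card {y\<in>A. f y = f x}))"
      using A by (intro sum.cong refl) (subst sum_of_bool_eq_card, auto intro!: arg_cong[of _ _ card])
    also have "\<dots> = (\<Sum>u\<in>K. \<Sum>x\<in>{x\<in>A. f x = u}. real (card {y\<in>A. f y = f x}))"
      by (rule sum.group[OF A(1) K(1) A(2), symmetric])
    also have "\<dots> = (\<Sum>u\<in>K. \<Sum>x\<in>{x\<in>A. f x = u}. real (card {y\<in>A. f y = u}))"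
      by (intro sum.cong refl) auto
    finally show ?thesis by (simp add: power2_eq_square)
  qed
  show ?thesis using 1 2 unfolding 3 by linarith
qed

text \<open>The deviations \<open>a\<close> and \<open>b\<close> from the mean fibre sizes sum to 0,
  so only the sum of \<open>a u * b (\<sigma> u)\<close> remains. It is split by the weighted
  inequality of arithmetic and geometric means rather than by Cauchy-Schwarz: with one
  \<open>t\<close> for all functionals the bound is linear in the variances and can be summed
  exactly.\<close>

lemma card_combination_fibre_ge:
  assumes K: "finite K" "K \<noteq> {}" and A: "finite A" "f ` A \<subseteq> K" and B: "finite B" "f ` B \<subseteq> K"
    and sol: "bij_betw \<sigma> K K" "\<And>u w. u \<in> K \<Longrightarrow> w \<in> K \<Longrightarrow> op u w = v \<longleftrightarrow> w = \<sigma> u"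
    and "t > 0"
  shows "\<bar>real (card {(x, y) \<in> A \<times> B. op (f x) (f y) = v}) - real (card A) * real (card B) / real (card K)\<bar>
     \<le> (t * fibre_variance K f A + fibre_variance K f B / t) / 2"
proof -
  define a where "a u = real (card {x\<in>A. f x = u}) - real (card A) / real (card K)" for u
  define b where "b u = real (card {x\<in>B. f x = u}) - real (card B) / real (card K)" for u
  have cK: "real (card K) > 0" using K by (simp add: card_gt_0_iff)
  have \<sigma>: "\<sigma> u \<in> K" if "u \<in> K" for u using sol(1) that by (auto simp: bij_betw_def)
  have "real (card {(x, y) \<in> A \<times> B. op (f x) (f y) = v}) = (\<Sum>u\<in>K. real (card {x\<in>A. f x = u}) * real (card {y\<in>B. f y = \<sigma> u}))"
  proof -
    have "{(x, y) \<in> A \<times> B. op (f x) (f y) = v} = (\<Union>u\<in>K. {x\<in>A. f x = u} \<times> {y\<in>B. f y = \<sigma> u})"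
    proof (intro equalityI subsetI)
      fix xy assume "xy \<in> {(x, y) \<in> A \<times> B. op (f x) (f y) = v}"
      then obtain x y where xy: "xy = (x, y)" "x \<in> A" "y \<in> B" "op (f x) (f y) = v" by blast
      moreover from this have "f x \<in> K" "f y \<in> K" using A(2) B(2) by auto
      ultimately show "xy \<in> (\<Union>u\<in>K. {x\<in>A. f x = u} \<times> {y\<in>B. f y = \<sigma> u})"
        using sol(2)[of "f x" "f y"] by auto
    next
      fix xy assume "xy \<in> (\<Union>u\<in>K. {x\<in>A. f x = u} \<times> {y\<in>B. f y = \<sigma> u})"
      then obtain x y where "xy = (x, y)" "x \<in> A" "y \<in> B" "f x \<in> K" "f y = \<sigma> (f x)" by blast
      thus "xy \<in> {(x, y) \<in> A \<times> B. op (f x) (f y) = v}"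
        using sol(2)[of "f x" "f y"] \<sigma> by auto
    qed
    also have "card \<dots> = (\<Sum>u\<in>K. card ({x\<in>A. f x = u} \<times> {y\<in>B. f y = \<sigma> u}))"
      using K A B by (intro card_UN_disjoint) auto
    finally show ?thesis by (simp add: card_cartesian_product)
  qed
  also have "\<dots> = (\<Sum>u\<in>K. a u * b (\<sigma> u) + real (card B) / real (card K) * real (card {x\<in>A. f x = u})
      + real (card A) / real (card K) * real (card {y\<in>B. f y = \<sigma> u}) - real (card A) * real (card B) / (real (card K))\<^sup>2)"
    unfolding a_def b_def using cK by (intro sum.cong refl) (simp add: field_simps power2_eq_square)
  also have "\<dots> = (\<Sum>u\<in>K. a u * b (\<sigma> u)) + real (card B) / real (card K) * (\<Sum>u\<in>K. real (card {x\<in>A. f x = u}))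
      + real (card A) / real (card K) * (\<Sum>u\<in>K. real (card {y\<in>B. f y = \<sigma> u})) - real (card K) * (real (card A) * real (card B) / (real (card K))\<^sup>2)"
    by (simp add: sum.distrib sum_subtractf sum_distrib_left)
  also have "(\<Sum>u\<in>K. real (card {y\<in>B. f y = \<sigma> u})) = (\<Sum>u\<in>K. real (card {y\<in>B. f y = u}))"
    by (rule sum.reindex_bij_betw[OF sol(1)])
  finally have eq: "real (card {(x, y) \<in> A \<times> B. op (f x) (f y) = v}) - real (card A) * real (card B) / real (card K)
      = (\<Sum>u\<in>K. a u * b (\<sigma> u))"
    using cK by (simp add: sum_card_fibres K A B power2_eq_square)
  have "\<bar>\<Sum>u\<in>K. a u * b (\<sigma> u)\<bar> \<le> (\<Sum>u\<in>K. \<bar>a u * b (\<sigma> u)\<bar>)" by (rule sum_abs)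
  also have "\<dots> \<le> (\<Sum>u\<in>K. (t * (a u)\<^sup>2 + (b (\<sigma> u))\<^sup>2 / t) / 2)"
  proof (rule sum_mono)
    fix u
    have "0 \<le> (t * \<bar>a u\<bar> - \<bar>b (\<sigma> u)\<bar>)\<^sup>2 / t" using \<open>t > 0\<close> by simp
    also have "\<dots> = t * (a u)\<^sup>2 + (b (\<sigma> u))\<^sup>2 / t - 2 * (\<bar>a u\<bar> * \<bar>b (\<sigma> u)\<bar>)"
      using \<open>t > 0\<close> by (simp add: power2_eq_square field_simps)
    finally show "\<bar>a u * b (\<sigma> u)\<bar> \<le> (t * (a u)\<^sup>2 + (b (\<sigma> u))\<^sup>2 / t) / 2" by (simp add: abs_mult)
  qed
  also have "\<dots> = (t * (\<Sum>u\<in>K. (a u)\<^sup>2) + (\<Sum>u\<in>K. (b (\<sigma> u))\<^sup>2) / t) / 2"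
    by (simp add: sum.distrib sum_distrib_left sum_divide_distrib add_divide_distrib)
  also have "(\<Sum>u\<in>K. (b (\<sigma> u))\<^sup>2) = (\<Sum>u\<in>K. (b u)\<^sup>2)"
    by (rule sum.reindex_bij_betw[OF sol(1)])
  finally show ?thesis unfolding eq fibre_variance_def a_def b_def .
qed

text \<open>
  A substitute for Fourier inversion: the solutions of \<open>comb x y = g p z\<close> are counted by averaging over
  the test functions \<open>ev c\<close>.  The set \<open>W c\<close> collects those \<open>p\<close> for which \<open>ev c (g p z)\<close> is independent
  of \<open>z\<close>; the other \<open>p\<close> contribute exactly the expected amount.
\<close>

lemma mixing:
  fixes ev :: "'c \<Rightarrow> 'x \<Rightarrow> 'k" and op :: "'k \<Rightarrow> 'k \<Rightarrow> 'k" and comb :: "'x \<Rightarrow> 'x \<Rightarrow> 'x" and g :: "'p \<Rightarrow> 'z \<Rightarrow> 'x"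
  assumes Q: "q \<ge> 2" "finite K" "card K = q" "finite \<Lambda>" "card \<Lambda> = q ^ n" "n \<ge> 1"
    and sub: "A \<subseteq> M" "B \<subseteq> M" "finite M" "\<And>x y. x \<in> M \<Longrightarrow> y \<in> M \<Longrightarrow> comb x y \<in> M"
    and ev: "\<And>c x. c \<in> \<Lambda> \<Longrightarrow> x \<in> M \<Longrightarrow> ev c x \<in> K"
    and sep: "\<And>x y. x \<in> M \<Longrightarrow> y \<in> M \<Longrightarrow> x \<noteq> y \<Longrightarrow> card {c\<in>\<Lambda>. ev c x = ev c y} = q ^ (n - 1)"
    and comb: "\<And>c x y. c \<in> \<Lambda> \<Longrightarrow> x \<in> M \<Longrightarrow> y \<in> M \<Longrightarrow> ev c (comb x y) = op (ev c x) (ev c y)"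
    and op: "\<And>v. v \<in> K \<Longrightarrow> \<exists>\<sigma>. bij_betw \<sigma> K K \<and> (\<forall>u\<in>K. \<forall>w\<in>K. op u w = v \<longleftrightarrow> w = \<sigma> u)"
    and PC: "finite \<P>" "finite \<C>" "\<And>p z. p \<in> \<P> \<Longrightarrow> z \<in> \<C> \<Longrightarrow> g p z \<in> M"
    and \<kappa>: "\<kappa> \<ge> 0"
    and triv: "z0 \<in> \<Lambda>" "\<And>x y. x \<in> M \<Longrightarrow> y \<in> M \<Longrightarrow> ev z0 x = ev z0 y"
    and dich: "\<And>c p v. c \<in> \<Lambda> \<Longrightarrow> p \<in> \<P> \<Longrightarrow> p \<notin> W c \<Longrightarrow> v \<in> K \<Longrightarrow> q * card {z\<in>\<C>. ev c (g p z) = v} = card \<C>"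
      "\<And>c p. c \<in> \<Lambda> \<Longrightarrow> p \<in> W c \<Longrightarrow> \<exists>v\<in>K. \<forall>z\<in>\<C>. ev c (g p z) = v"
    and W: "\<And>c. c \<in> \<Lambda> \<Longrightarrow> W c \<subseteq> \<P>"
      "\<And>c. c \<in> \<Lambda> \<Longrightarrow> (\<exists>x\<in>M. \<exists>y\<in>M. ev c x \<noteq> ev c y) \<Longrightarrow> real (card (W c)) \<le> \<kappa>"
  shows "real (card A) * real (card B) * real (card \<P>) * real (card \<C>) / real q ^ n
      - \<kappa> * real (card \<C>) * sqrt (real (card A) * real (card B))
    \<le> real (card {((x, y), (p, z)) \<in> (A \<times> B) \<times> (\<P> \<times> \<C>). comb x y = g p z})"
    (is "?main - ?err \<le> real ?N")
proof (cases "A = {} \<or> B = {}")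
  case True
  thus ?thesis by auto
next
  case False
  have fin: "finite A" "finite B" using sub finite_subset by blast+
  define nA where "nA = real (card A)"
  define nB where "nB = real (card B)"
  define nC where "nC = real (card \<C>)"
  define T where "T = nA * nB * real (card \<P>) * nC"
  define u where "u = real q ^ n"
  have pos: "nA > 0" "nB > 0" using False fin by (auto simp: nA_def nB_def card_gt_0_iff)
  have q0: "real q \<ge> 2" using Q(1) by simp
  have u0: "u > 0" using q0 by (simp add: u_def)
  have uq: "real (q ^ (n - 1)) = u / real q"
    using Q(6) q0 by (cases n) (auto simp: u_def)
  have Kne: "K \<noteq> {}" using Q by auto
  \<comment> \<open>The summed variances are proportional to \<open>nA\<close> and
    \<open>nB\<close>; this \<open>t\<close> makes \<open>t * nA\<close> and \<open>nB / t\<close>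
    both equal to \<open>sqrt (nA * nB)\<close>.\<close>
  define t where "t = sqrt (nB / nA)"
  have t0: "t > 0" using pos by (simp add: t_def)
  define \<H> where "\<H> c v = real (card {(x, y) \<in> A \<times> B. op (ev c x) (ev c y) = v})" for c v
  define var where "var c = (t * fibre_variance K (ev c) A + fibre_variance K (ev c) B / t) / 2" for c
  have var0: "var c \<ge> 0" for c
    unfolding var_def fibre_variance_def using t0
    by (auto intro!: add_nonneg_nonneg mult_nonneg_nonneg divide_nonneg_pos sum_nonneg)
  \<comment> \<open>\<open>U c\<close> counts the quadruples that look like solutions to the test
    function \<open>ev c\<close>. In the sum over \<open>c\<close> a true solution has weight
    \<open>u\<close> and any other quadruple \<open>u / q\<close>.\<close>
  define U where "U c = (\<Sum>p\<in>\<P>. \<Sum>z\<in>\<C>. \<H> c (ev c (g p z)))" for c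
  have evA: "ev c ` A \<subseteq> K" "ev c ` B \<subseteq> K" if "c \<in> \<Lambda>" for c using ev[OF that] sub by auto
  have U_ge: "U c \<ge> T / real q - real (card (W c)) * nC * var c" if c: "c \<in> \<Lambda>" for c
  proof -
    have good: "(\<Sum>z\<in>\<C>. \<H> c (ev c (g p z))) = nA * nB * nC / real q" if p: "p \<in> \<P>" "p \<notin> W c" for p
    proof -
      have cv: "real (card {z\<in>\<C>. ev c (g p z) = v}) = nC / real q" if "v \<in> K" for v
      proof -
        have "real (q * card {z\<in>\<C>. ev c (g p z) = v}) = nC"
          unfolding nC_def using dich(1)[OF c p that] by simp
        thus ?thesis using q0 by (simp add: field_simps)
      qed
      have "(\<Sum>z\<in>\<C>. \<H> c (ev c (g p z))) = (\<Sum>v\<in>K. \<Sum>z\<in>{z\<in>\<C>. ev c (g p z) = v}. \<H> c (ev c (g p z)))"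
        using ev[OF c] PC p by (intro sum.group[symmetric] Q(2)) auto
      also have "\<dots> = (\<Sum>v\<in>K. real (card {z\<in>\<C>. ev c (g p z) = v}) * \<H> c v)"
        by (intro sum.cong refl) simp
      also have "\<dots> = (\<Sum>v\<in>K. nC / real q * \<H> c v)"
        using cv by (intro sum.cong refl) simp
      also have "\<dots> = nC / real q * (\<Sum>v\<in>K. \<H> c v)" by (simp add: sum_distrib_left)
      also have "(\<Sum>v\<in>K. \<H> c v) = nA * nB"
      proof -
        have "(\<lambda>(x, y). op (ev c x) (ev c y)) ` (A \<times> B) \<subseteq> K"
        proof clarify
          fix x y assume "x \<in> A" "y \<in> B"
          hence "x \<in> M" "y \<in> M" using sub by auto
          thus "op (ev c x) (ev c y) \<in> K" using comb[OF c] ev[OF c] sub(4) by metis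
        qed
        hence "(\<Sum>v\<in>K. real (card {xy\<in>A \<times> B. (\<lambda>(x, y). op (ev c x) (ev c y)) xy = v})) = real (card (A \<times> B))"
          using Q(2) fin by (intro sum_card_fibres) auto
        moreover have "{xy\<in>A \<times> B. (\<lambda>(x, y). op (ev c x) (ev c y)) xy = v}
            = {(x, y) \<in> A \<times> B. op (ev c x) (ev c y) = v}" for v by auto
        ultimately show ?thesis by (simp add: \<H>_def nA_def nB_def card_cartesian_product)
      qed
      finally show ?thesis by (simp add: mult_ac)
    qed
    have bad: "(\<Sum>z\<in>\<C>. \<H> c (ev c (g p z))) \<ge> nA * nB * nC / real q - nC * var c" if p: "p \<in> W c" for p
    proof -
      obtain v where v: "v \<in> K" "\<And>z. z \<in> \<C> \<Longrightarrow> ev c (g p z) = v" using dich(2)[OF c p] by blast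
      obtain \<sigma> where \<sigma>: "bij_betw \<sigma> K K" "\<And>u w. u \<in> K \<Longrightarrow> w \<in> K \<Longrightarrow> op u w = v \<longleftrightarrow> w = \<sigma> u"
        using op[OF v(1)] by blast
      have "\<bar>\<H> c v - nA * nB / real q\<bar> \<le> var c"
        unfolding \<H>_def nA_def nB_def var_def Q(3)[symmetric]
        by (rule card_combination_fibre_ge[OF Q(2) Kne fin(1) evA(1)[OF c] fin(2) evA(2)[OF c] \<sigma> t0])
      hence "\<H> c v \<ge> nA * nB / real q - var c" by linarith
      hence "nC * (nA * nB / real q - var c) \<le> nC * \<H> c v" by (intro mult_left_mono) (auto simp: nC_def)
      also have "nC * \<H> c v = (\<Sum>z\<in>\<C>. \<H> c (ev c (g p z)))" by (simp add: v nC_def)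
      finally show ?thesis by (simp add: algebra_simps)
    qed
    have "(\<Sum>p\<in>\<P>. nA * nB * nC / real q - of_bool (p \<in> W c) * (nC * var c)) \<le> U c"
      unfolding U_def
    proof (rule sum_mono)
      fix p assume "p \<in> \<P>"
      thus "nA * nB * nC / real q - of_bool (p \<in> W c) * (nC * var c) \<le> (\<Sum>z\<in>\<C>. \<H> c (ev c (g p z)))"
        using good[of p] bad[of p] by (cases "p \<in> W c") simp_all
    qed
    moreover have "(\<Sum>p\<in>\<P>. nA * nB * nC / real q - of_bool (p \<in> W c) * (nC * var c))
        = T / real q - real (card (W c)) * (nC * var c)"
    proof -
      have "{p\<in>\<P>. p \<in> W c} = W c" using W(1)[OF c] by auto
      hence "(\<Sum>p\<in>\<P>. of_bool (p \<in> W c)) = real (card (W c))"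
        using sum_of_bool_eq_card[OF PC(1), of "\<lambda>p. p \<in> W c"] by simp
      thus ?thesis by (simp add: sum_subtractf sum_distrib_right[symmetric] T_def del: sum_of_bool_eq)
    qed
    ultimately show ?thesis by simp
  qed
  have U_all: "U c \<ge> T / real q - \<kappa> * nC * var c" if c: "c \<in> \<Lambda>" for c
  proof (cases "\<exists>x\<in>M. \<exists>y\<in>M. ev c x \<noteq> ev c y")
    case True
    have "real (card (W c)) * (nC * var c) \<le> \<kappa> * (nC * var c)"
      using W(2)[OF c True] var0[of c] by (intro mult_right_mono) (auto simp: nC_def)
    thus ?thesis using U_ge[OF c] by simp
  next
    case False
    \<comment> \<open>A test function that is constant on \<open>M\<close> accepts every quadruple,
      which is even more than the expected \<open>T / q\<close>.\<close>
    have "U c = T"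
    proof -
      have "\<H> c (ev c (g p z)) = nA * nB" if "p \<in> \<P>" "z \<in> \<C>" for p z
      proof -
        have "op (ev c x) (ev c y) = ev c (g p z)" if "x \<in> A" "y \<in> B" for x y
        proof -
          have "x \<in> M" "y \<in> M" using that sub by auto
          thus ?thesis using False comb[OF c] sub(4) PC(3)[OF \<open>p \<in> \<P>\<close> \<open>z \<in> \<C>\<close>] by metis
        qed
        hence "{(x, y) \<in> A \<times> B. op (ev c x) (ev c y) = ev c (g p z)} = A \<times> B" by auto
        thus ?thesis by (simp add: \<H>_def card_cartesian_product nA_def nB_def)
      qed
      thus ?thesis by (simp add: U_def T_def nC_def)
    qed
    moreover have "T / real q \<le> T / 1" using q0 pos by (intro divide_left_mono) (auto simp: T_def nC_def)
    moreover have "0 \<le> \<kappa> * nC * var c" using \<kappa> var0 by (simp add: nC_def)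
    ultimately show ?thesis unfolding div_by_1 by linarith
  qed
  have U_triv: "U z0 = T"
  proof -
    have "\<H> z0 (ev z0 (g p z)) = nA * nB" if "p \<in> \<P>" "z \<in> \<C>" for p z
    proof -
      have "op (ev z0 x) (ev z0 y) = ev z0 (g p z)" if "x \<in> A" "y \<in> B" for x y
      proof -
        have "x \<in> M" "y \<in> M" using that sub by auto
        thus ?thesis using triv comb sub(4) PC(3)[OF \<open>p \<in> \<P>\<close> \<open>z \<in> \<C>\<close>] by metis
      qed
      hence "{(x, y) \<in> A \<times> B. op (ev z0 x) (ev z0 y) = ev z0 (g p z)} = A \<times> B" by auto
      thus ?thesis by (simp add: \<H>_def card_cartesian_product nA_def nB_def)
    qed
    thus ?thesis by (simp add: U_def T_def nC_def)
  qed
  have sum_pairs: "(\<Sum>c\<in>\<Lambda>. \<Sum>x\<in>S. \<Sum>y\<in>S'. of_bool (ev c (h x) = ev c (h' y)))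
      = (\<Sum>x\<in>S. \<Sum>y\<in>S'. u / real q + of_bool (h x = h' y) * (u - u / real q))"
    if "h ` S \<subseteq> M" "h' ` S' \<subseteq> M" for S S' and h :: "'s \<Rightarrow> 'x" and h' :: "'t \<Rightarrow> 'x"
  proof -
    have "(\<Sum>c\<in>\<Lambda>. \<Sum>x\<in>S. \<Sum>y\<in>S'. of_bool (ev c (h x) = ev c (h' y)))
        = (\<Sum>x\<in>S. \<Sum>y\<in>S'. \<Sum>c\<in>\<Lambda>. (of_bool (ev c (h x) = ev c (h' y)) :: real))"
      by (subst sum.swap) (intro sum.cong refl sum.swap)
    also have "\<dots> = (\<Sum>x\<in>S. \<Sum>y\<in>S'. u / real q + of_bool (h x = h' y) * (u - u / real q))"
    proof (intro sum.cong refl)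
      fix x y assume "x \<in> S" "y \<in> S'"
      hence xy: "h x \<in> M" "h' y \<in> M" using that by auto
      have "(\<Sum>c\<in>\<Lambda>. of_bool (ev c (h x) = ev c (h' y))) = real (card {c\<in>\<Lambda>. ev c (h x) = ev c (h' y)})"
        by (rule sum_of_bool_eq_card[OF Q(4)])
      also have "\<dots> = u / real q + of_bool (h x = h' y) * (u - u / real q)"
        using sep[OF xy] uq Q(5) by (cases "h x = h' y") (simp_all add: u_def)
      finally show "(\<Sum>c\<in>\<Lambda>. of_bool (ev c (h x) = ev c (h' y))) = u / real q + of_bool (h x = h' y) * (u - u / real q)" .
    qed
    finally show ?thesis .
  qed
  have var_sum: "(\<Sum>c\<in>\<Lambda>. fibre_variance K (ev c) S) = (u - u / real q) * real (card S)"
    if S: "finite S" "S \<subseteq> M" for S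
  proof -
    have "(\<Sum>c\<in>\<Lambda>. fibre_variance K (ev c) S)
        = (\<Sum>c\<in>\<Lambda>. (\<Sum>x\<in>S. \<Sum>y\<in>S. of_bool (ev c x = ev c y)) - (real (card S))\<^sup>2 / real q)"
      using S ev by (intro sum.cong refl, subst fibre_variance_eq[OF Q(2) Kne]) (auto simp: Q(3))
    also have "\<dots> = (\<Sum>x\<in>S. \<Sum>y\<in>S. u / real q + of_bool (x = y) * (u - u / real q)) - u * ((real (card S))\<^sup>2 / real q)"
      using sum_pairs[of "\<lambda>x. x" S "\<lambda>x. x" S] S by (simp add: sum_subtractf Q(5) u_def)
    also have "(\<Sum>x\<in>S. \<Sum>y\<in>S. u / real q + of_bool (x = y) * (u - u / real q))
        = (real (card S))\<^sup>2 * (u / real q) + real (card S) * (u - u / real q)"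
    proof -
      have "(\<Sum>y\<in>S. u / real q + of_bool (x = y) * (u - u / real q)) = real (card S) * (u / real q) + (u - u / real q)"
        if "x \<in> S" for x
      proof -
        have "{y\<in>S. x = y} = {x}" using that by auto
        hence "(\<Sum>y\<in>S. of_bool (x = y)) = (1::real)" using sum_of_bool_eq_card[OF S(1), of "\<lambda>y. x = y"] by simp
        thus ?thesis by (simp add: sum.distrib sum_distrib_right[symmetric] del: sum_of_bool_eq)
      qed
      hence "(\<Sum>x\<in>S. \<Sum>y\<in>S. u / real q + of_bool (x = y) * (u - u / real q))
          = (\<Sum>x\<in>S. real (card S) * (u / real q) + (u - u / real q))"
        by (intro sum.cong refl)
      thus ?thesis by (simp add: power2_eq_square algebra_simps)
    qed
    finally show ?thesis by (simp add: mult_ac)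
  qed
  have sum_var: "(\<Sum>c\<in>\<Lambda>. var c) = (u - u / real q) * sqrt (nA * nB)"
  proof -
    have "(\<Sum>c\<in>\<Lambda>. var c) = (t * (\<Sum>c\<in>\<Lambda>. fibre_variance K (ev c) A) + (\<Sum>c\<in>\<Lambda>. fibre_variance K (ev c) B) / t) / 2"
      by (simp add: var_def sum.distrib sum_distrib_left sum_divide_distrib add_divide_distrib)
    also have "\<dots> = (u - u / real q) * ((t * nA + nB / t) / 2)"
    proof -
      have "(t * (v * nA) + v * nB / t) / 2 = v * ((t * nA + nB / t) / 2)" for v
        by (simp add: algebra_simps)
      thus ?thesis unfolding var_sum[OF fin(1) sub(1)] var_sum[OF fin(2) sub(2)] nA_def nB_def .
    qed
    also have "t * nA = sqrt (nA * nB)"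
    proof -
      have "t * nA = sqrt nB / sqrt nA * (sqrt nA * sqrt nA)"
        using pos by (simp add: t_def real_sqrt_divide)
      also have "\<dots> = sqrt nA * sqrt nB" using pos by (simp add: field_simps del: real_sqrt_mult_self)
      finally show ?thesis by (simp add: real_sqrt_mult)
    qed
    also have "nB / t = sqrt (nA * nB)"
    proof -
      have "nB / t = (sqrt nB * sqrt nB) / (sqrt nB / sqrt nA)"
        using pos by (simp add: t_def real_sqrt_divide)
      also have "\<dots> = sqrt nA * sqrt nB" using pos by (simp add: field_simps del: real_sqrt_mult_self)
      finally show ?thesis by (simp add: real_sqrt_mult)
    qed
    finally show ?thesis by simp
  qed
  have sum_U: "(\<Sum>c\<in>\<Lambda>. U c) = T * (u / real q) + real ?N * (u - u / real q)"
  proof -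
    define S where "S = A \<times> B"
    define S' where "S' = \<P> \<times> \<C>"
    define h where "h = (\<lambda>(x, y). comb x y)"
    define h' where "h' = (\<lambda>(p, z). g p z)"
    have hM: "h ` S \<subseteq> M" "h' ` S' \<subseteq> M"
      using sub PC by (auto simp: h_def S_def h'_def S'_def)
    have fS: "finite S" "finite S'" using fin PC by (auto simp: S_def S'_def)
    have "(\<Sum>c\<in>\<Lambda>. U c) = (\<Sum>c\<in>\<Lambda>. \<Sum>a\<in>S. \<Sum>b\<in>S'. of_bool (ev c (h a) = ev c (h' b)))"
    proof (rule sum.cong[OF refl])
      fix c assume c: "c \<in> \<Lambda>"
      have "U c = (\<Sum>b\<in>S'. \<H> c (ev c (h' b)))"
        unfolding U_def S'_def h'_def by (simp add: sum.cartesian_product case_prod_unfold)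
      also have "\<dots> = (\<Sum>b\<in>S'. \<Sum>a\<in>S. of_bool (ev c (h a) = ev c (h' b)))"
      proof (rule sum.cong[OF refl])
        fix b assume "b \<in> S'"
        have "ev c (comb x y) = op (ev c x) (ev c y)" if "x \<in> A" "y \<in> B" for x y
          using comb[OF c] that sub by blast
        hence "{(x, y) \<in> A \<times> B. op (ev c x) (ev c y) = ev c (h' b)} = {a\<in>S. ev c (h a) = ev c (h' b)}"
          by (auto simp: S_def h_def)
        thus "\<H> c (ev c (h' b)) = (\<Sum>a\<in>S. of_bool (ev c (h a) = ev c (h' b)))"
          by (subst sum_of_bool_eq_card[OF fS(1)]) (simp add: \<H>_def)
      qed
      also have "\<dots> = (\<Sum>a\<in>S. \<Sum>b\<in>S'. of_bool (ev c (h a) = ev c (h' b)))" by (rule sum.swap)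
      finally show "U c = \<dots>" .
    qed
    also have "\<dots> = (\<Sum>a\<in>S. \<Sum>b\<in>S'. u / real q + of_bool (h a = h' b) * (u - u / real q))"
      by (rule sum_pairs[OF hM])
    also have "\<dots> = real (card S) * real (card S') * (u / real q) + (\<Sum>a\<in>S. \<Sum>b\<in>S'. of_bool (h a = h' b)) * (u - u / real q)"
      by (simp add: sum.distrib sum_distrib_right[symmetric] del: sum_of_bool_eq)
    also have "(\<Sum>a\<in>S. \<Sum>b\<in>S'. of_bool (h a = h' b)) = (\<Sum>ab\<in>S \<times> S'. of_bool (h (fst ab) = h' (snd ab)) :: real)"
      by (simp add: sum.cartesian_product case_prod_unfold del: sum_of_bool_eq)
    also have "\<dots> = real (card {ab\<in>S \<times> S'. h (fst ab) = h' (snd ab)})"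
      using fS by (intro sum_of_bool_eq_card) auto
    also have "{ab\<in>S \<times> S'. h (fst ab) = h' (snd ab)} = {((x, y), (p, z)) \<in> (A \<times> B) \<times> (\<P> \<times> \<C>). comb x y = g p z}"
      by (auto simp: S_def S'_def h_def h'_def)
    also have "real (card S) * real (card S') = T"
      by (simp add: S_def S'_def T_def nA_def nB_def nC_def card_cartesian_product)
    finally show ?thesis .
  qed
  \<comment> \<open>Only \<open>z0\<close> is credited with the full \<open>T\<close>. Its excess
    \<open>T * (1 - 1 / q)\<close> over the expected value becomes the main term
    \<open>T / u\<close> after division by \<open>u * (1 - 1 / q)\<close>.\<close>
  have "(\<Sum>c\<in>\<Lambda>. U c) = T + (\<Sum>c\<in>\<Lambda>-{z0}. U c)"
    using Q(4) triv(1) by (subst sum.remove[of _ z0]) (auto simp: U_triv)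
  moreover have "(\<Sum>c\<in>\<Lambda>-{z0}. T / real q - \<kappa> * nC * var c) \<le> (\<Sum>c\<in>\<Lambda>-{z0}. U c)"
    using U_all by (intro sum_mono) auto
  moreover have "(\<Sum>c\<in>\<Lambda>-{z0}. T / real q - \<kappa> * nC * var c) = (u - 1) * (T / real q) - \<kappa> * nC * (\<Sum>c\<in>\<Lambda>-{z0}. var c)"
  proof -
    have "real (card (\<Lambda> - {z0})) = u - 1"
      using triv(1) Q u0 by (simp add: card_Diff_singleton u_def of_nat_diff)
    thus ?thesis by (simp add: sum_subtractf sum_distrib_left)
  qed
  moreover have "\<kappa> * nC * (\<Sum>c\<in>\<Lambda>-{z0}. var c) \<le> \<kappa> * nC * (\<Sum>c\<in>\<Lambda>. var c)"
    using var0 Q(4) \<kappa> by (intro mult_left_mono sum_mono2) (auto simp: nC_def)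
  ultimately have "T + ((u - 1) * (T / real q) - \<kappa> * nC * ((u - u / real q) * sqrt (nA * nB)))
      \<le> T * (u / real q) + real ?N * (u - u / real q)"
    unfolding sum_U sum_var by linarith
  hence "T * (1 - 1 / real q) - \<kappa> * nC * sqrt (nA * nB) * (u * (1 - 1 / real q)) \<le> real ?N * (u * (1 - 1 / real q))"
    by (simp add: algebra_simps diff_divide_distrib)
  moreover have "u * (1 - 1 / real q) > 0" "1 - 1 / real q > 0" using u0 q0 by auto
  ultimately have "(T / u - \<kappa> * nC * sqrt (nA * nB)) * (u * (1 - 1 / real q)) \<le> real ?N * (u * (1 - 1 / real q))"
    using u0 by (simp add: left_diff_distrib)
  hence "T / u - \<kappa> * nC * sqrt (nA * nB) \<le> real ?N"
    using \<open>u * (1 - 1 / real q) > 0\<close> by (rule mult_right_le_imp_le)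
  thus ?thesis by (simp add: T_def u_def nA_def nB_def nC_def)
qed

section \<open>Polynomial solutions with a large irreducible factor\<close>

context finite_field_poly
begin

text \<open>With \<open>c\<close> ranging over all vectors these are all functionals on
  \<open>B n\<close>. The leading coefficient of an element of \<open>Mon n\<close> is ignored,
  which is harmless because only differences, which lie in \<open>B n\<close>, have to be
  separated.\<close>

definition dot :: "nat \<Rightarrow> (nat \<Rightarrow> 'a) \<Rightarrow> 'a list \<Rightarrow> 'a" where
  "dot n c p = (\<Oplus>i\<in>{..<n}. c i \<otimes> coeff p i)"

lemma dot_functional:
  assumes "c \<in> {..<n} \<rightarrow>\<^sub>E carrier R"
  shows "poly_functional R q (dot n c)"
proof unfold_locales
  have c: "c i \<in> carrier R" if "i < n" for i using assms that by auto
  fix p assume p: "p \<in> carrier P"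
  have cl: "(\<lambda>i. c i \<otimes> coeff p i) \<in> {..<n} \<rightarrow> carrier R" if "p \<in> carrier P" for p
    using c that by auto
  show "dot n c p \<in> carrier R" unfolding dot_def by (rule finsum_closed[OF cl[OF p]])
  show "dot n c (p \<^bold>+ p') = dot n c p \<oplus> dot n c p'" if p': "p' \<in> carrier P" for p'
  proof -
    have "dot n c (p \<^bold>+ p') = (\<Oplus>i\<in>{..<n}. c i \<otimes> coeff p i \<oplus> c i \<otimes> coeff p' i)"
      unfolding dot_def using c p p' by (intro finsum_cong') (auto simp: coeff_add r_distr)
    thus ?thesis unfolding dot_def using finsum_addf[OF cl[OF p] cl[OF p']] by simp
  qed
  show "dot n c (poly_of_const a \<cdot> p) = a \<otimes> dot n c p" if a: "a \<in> carrier R" for a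
  proof -
    have "dot n c (poly_of_const a \<cdot> p) = (\<Oplus>i\<in>{..<n}. a \<otimes> (c i \<otimes> coeff p i))"
      unfolding dot_def using c p a by (intro finsum_cong') (auto simp: coeff_const_mult m_lcomm)
    thus ?thesis unfolding dot_def using finsum_rdistr[OF _ a cl[OF p]] by simp
  qed
qed

text \<open>Varying the entry of \<open>c\<close> at a nonzero coefficient of \<open>z\<close> moves
  the value through the whole field.\<close>

lemma card_dot_zero:
  assumes z: "z \<in> B n" "z \<noteq> []"
  shows "q * card {c \<in> {..<n} \<rightarrow>\<^sub>E carrier R. dot n c z = \<zero>} = q ^ n"
proof -
  have zc: "z \<in> carrier P" using z by (simp add: B_closed)
  obtain i where i: "i < n" "coeff z i \<noteq> \<zero>"
  proof -
    obtain i where "coeff z i \<noteq> \<zero>"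
      using z(2) length_le_iff[OF zc, of 0] by auto
    moreover from this have "i < n" using z(1) unfolding B_iff by (metis not_le)
    ultimately show ?thesis using that by blast
  qed
  define b where "b = inv (coeff z i)"
  have b: "b \<in> carrier R" "b \<otimes> coeff z i = \<one>"
    using i zc by (auto simp: b_def field_Units)
  define \<tau> where "\<tau> a c = c(i := c i \<oplus> a \<otimes> b)" for a and c :: "nat \<Rightarrow> 'a"
  have "card (carrier R) * card {c \<in> {..<n} \<rightarrow>\<^sub>E carrier R. dot n c z = \<zero>} = card ({..<n} \<rightarrow>\<^sub>E carrier R)"
  proof (rule equidistribution_of_translates[where \<phi> = "\<lambda>c. dot n c z" and \<tau> = \<tau>])
    show "abelian_group R" ..
    show "finite ({..<n} \<rightarrow>\<^sub>E carrier R)" by (intro finite_PiE) (auto simp: finite_carrier)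
    fix a assume a: "a \<in> carrier R"
    show "inj_on (\<tau> a) ({..<n} \<rightarrow>\<^sub>E carrier R)"
    proof (rule inj_onI, rule ext)
      fix c c' j assume c: "c \<in> {..<n} \<rightarrow>\<^sub>E carrier R" "c' \<in> {..<n} \<rightarrow>\<^sub>E carrier R" "\<tau> a c = \<tau> a c'"
      have ci: "c i \<in> carrier R" "c' i \<in> carrier R" using c i by auto
      show "c j = c' j"
        using fun_cong[OF c(3), of j] ci a b by (cases "j = i") (auto simp: \<tau>_def)
    qed
    fix c assume c: "c \<in> {..<n} \<rightarrow>\<^sub>E carrier R"
    have cc: "c j \<in> carrier R" if "j < n" for j using c that by auto
    show "\<tau> a c \<in> {..<n} \<rightarrow>\<^sub>E carrier R"
      using c i a b by (auto simp: \<tau>_def PiE_iff extensional_def)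
    have "dot n (\<tau> a c) z = (\<Oplus>j\<in>{..<n}. c j \<otimes> coeff z j \<oplus> (if i = j then a else \<zero>))"
      unfolding dot_def
      by (intro finsum_cong') (use cc a b zc i in \<open>auto simp: \<tau>_def l_distr m_assoc\<close>)
    also have "\<dots> = dot n c z \<oplus> (\<Oplus>j\<in>{..<n}. if i = j then a else \<zero>)"
      unfolding dot_def by (intro finsum_addf) (use cc a zc in auto)
    also have "(\<Oplus>j\<in>{..<n}. if i = j then a else \<zero>) = a"
      using i a by (intro add.finprod_singleton) auto
    finally show "dot n (\<tau> a c) z = dot n c z \<oplus> a" .
  next
    fix c assume "c \<in> {..<n} \<rightarrow>\<^sub>E carrier R"
    then interpret poly_functional R q "dot n c" by (rule dot_functional)
    show "dot n c z \<in> carrier R" using zc by simp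
  qed (auto simp: finite_carrier)
  thus ?thesis by (simp add: card_carrier card_PiE)
qed

lemma lin_comb_Mon:
  assumes "\<alpha> \<in> carrier R" "\<beta> \<in> carrier R" "\<alpha> \<oplus> \<beta> = \<one>" "x \<in> Mon n" "y \<in> Mon n"
  shows "lin_comb R \<alpha> x \<beta> y \<in> Mon n"
  using assms by (auto simp: Mon_iff lin_comb_def coeff_add coeff_const_mult)

lemma card_solutions_ge:
  assumes ab: "\<alpha> \<in> carrier R - {\<zero>}" "\<beta> \<in> carrier R - {\<zero>}" "\<alpha> \<oplus> \<beta> = \<one>"
    and sub: "\<A> \<subseteq> Mon n" "\<B> \<subseteq> Mon n" and n: "n = d + k" "n \<ge> 1"
    and m: "2 * m \<le> n" "4 * Z + k \<le> m" "m \<le> 6 * (Z + 1)"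
    and d: "k \<le> d" "Z < d" and l: "k + 1 \<le> q ^ l"
  defines "\<kappa> \<equiv> (real q ^ d / real q ^ k) / (exp (-13) * ((real Z + 1) / (real l + 1)))"
  shows "real (card \<A>) * real (card \<B>) * real (PS.num d) * real q ^ k / real q ^ n
      - \<kappa> * real q ^ k * sqrt (real (card \<A>) * real (card \<B>))
    \<le> real (card {((x, y), (p, z)) \<in> (\<A> \<times> \<B>) \<times> ({p\<in>irr. degree p = d} \<times> Mon k). lin_comb R \<alpha> x \<beta> y = p \<cdot> z})"
proof -
  define \<Lambda> where "\<Lambda> = ({..<n} \<rightarrow>\<^sub>E carrier R)"
  define W where "W c = {p\<in>irr. degree p = d \<and> (\<forall>F\<in>B k. dot n c (p \<cdot> F) = \<zero>)}" for c
  have lf: "poly_functional R q (dot n c)" if "c \<in> \<Lambda>" for c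
    using that dot_functional by (simp add: \<Lambda>_def)
  have Wk: "W c = {p\<in>irr. degree p = d \<and> poly_functional.kills R (dot n c) p k}" if "c \<in> \<Lambda>" for c
    unfolding W_def poly_functional.kills_def[OF lf[OF that]] ..
  have "real (card \<A>) * real (card \<B>) * real (card {p\<in>irr. degree p = d}) * real (card (Mon k)) / real q ^ n
      - \<kappa> * real (card (Mon k)) * sqrt (real (card \<A>) * real (card \<B>))
    \<le> real (card {((x, y), (p, z)) \<in> (\<A> \<times> \<B>) \<times> ({p\<in>irr. degree p = d} \<times> Mon k). lin_comb R \<alpha> x \<beta> y = p \<cdot> z})"
  proof (rule mixing[where K = "carrier R" and \<Lambda> = \<Lambda> and M = "Mon n" and ev = "dot n" and W = W
        and op = "\<lambda>u v. \<alpha> \<otimes> u \<oplus> \<beta> \<otimes> v" and ?z0.0 = "\<lambda>i\<in>{..<n}. \<zero>" and q = q and n = n])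
    show "q \<ge> 2" by (rule q_ge_2)
    show "finite (carrier R)" by (rule finite_carrier)
    show "card (carrier R) = q" by (rule card_carrier)
    show "finite \<Lambda>" unfolding \<Lambda>_def by (intro finite_PiE) (auto simp: finite_carrier)
    show "card \<Lambda> = q ^ n" by (simp add: \<Lambda>_def card_PiE card_carrier)
    show "\<And>x y. x \<in> Mon n \<Longrightarrow> y \<in> Mon n \<Longrightarrow> lin_comb R \<alpha> x \<beta> y \<in> Mon n"
      using ab by (intro lin_comb_Mon) auto
    show "\<kappa> \<ge> 0" by (simp add: \<kappa>_def)
    show "(\<lambda>i\<in>{..<n}. \<zero>) \<in> \<Lambda>" by (simp add: \<Lambda>_def)
    have "dot n (\<lambda>i\<in>{..<n}. \<zero>) x = \<zero>" if "x \<in> Mon n" for x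
    proof -
      have "dot n (\<lambda>i\<in>{..<n}. \<zero>) x = (\<Oplus>i\<in>{..<n}. \<zero>)"
        unfolding dot_def using Mon_closed[OF that] by (intro finsum_cong') auto
      thus ?thesis by simp
    qed
    thus "\<And>x y. x \<in> Mon n \<Longrightarrow> y \<in> Mon n \<Longrightarrow> dot n (\<lambda>i\<in>{..<n}. \<zero>) x = dot n (\<lambda>i\<in>{..<n}. \<zero>) y"
      by simp
    show "finite {p \<in> irr. degree p = d}" by (rule PS.finite_degree_eq)
    show "\<And>p z. p \<in> {p \<in> irr. degree p = d} \<Longrightarrow> z \<in> Mon k \<Longrightarrow> p \<cdot> z \<in> Mon n"
      using Mon_mult[OF irr_Mon] n by auto
    show "\<exists>\<sigma>. bij_betw \<sigma> (carrier R) (carrier R) \<and> (\<forall>u\<in>carrier R. \<forall>w\<in>carrier R. \<alpha> \<otimes> u \<oplus> \<beta> \<otimes> w = v \<longleftrightarrow> w = \<sigma> u)"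
      if v: "v \<in> carrier R" for v
    proof (intro exI conjI ballI)
      have inv: "inv \<alpha> \<in> carrier R" "inv \<beta> \<in> carrier R" "\<beta> \<otimes> inv \<beta> = \<one>" "\<alpha> \<otimes> inv \<alpha> = \<one>"
        using ab by (auto simp: field_Units)
      have al: "\<alpha> \<in> carrier R" "\<beta> \<in> carrier R" using ab by auto
      \<comment> \<open>Solving for \<open>w\<close> requires \<open>\<beta> \<noteq> 0\<close>;
        that the solution permutes the field requires \<open>\<alpha> \<noteq> 0\<close>.\<close>
      define \<sigma> where "\<sigma> u = inv \<beta> \<otimes> (v \<ominus> \<alpha> \<otimes> u)" for u
      show iff: "\<alpha> \<otimes> u \<oplus> \<beta> \<otimes> w = v \<longleftrightarrow> w = \<sigma> u" if "u \<in> carrier R" "w \<in> carrier R" for u w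
      proof
        assume "\<alpha> \<otimes> u \<oplus> \<beta> \<otimes> w = v"
        hence "\<sigma> u = inv \<beta> \<otimes> ((\<alpha> \<otimes> u \<oplus> \<beta> \<otimes> w) \<ominus> \<alpha> \<otimes> u)" by (simp add: \<sigma>_def)
        also have "\<dots> = (\<beta> \<otimes> inv \<beta>) \<otimes> w" using that al inv(1,2) by algebra
        finally show "w = \<sigma> u" using inv that by simp
      next
        assume "w = \<sigma> u"
        hence "\<alpha> \<otimes> u \<oplus> \<beta> \<otimes> w = \<alpha> \<otimes> u \<oplus> (\<beta> \<otimes> inv \<beta>) \<otimes> (v \<ominus> \<alpha> \<otimes> u)"
          unfolding \<sigma>_def using that al inv(1,2) v by algebra
        also have "\<dots> = v" unfolding inv(3) using that al v by algebra
        finally show "\<alpha> \<otimes> u \<oplus> \<beta> \<otimes> w = v" .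
      qed
      show "bij_betw \<sigma> (carrier R) (carrier R)"
      proof (rule bij_betw_byWitness[where f' = "\<lambda>w. inv \<alpha> \<otimes> (v \<ominus> \<beta> \<otimes> w)"])
        have \<sigma>c: "\<sigma> u \<in> carrier R" if "u \<in> carrier R" for u
          using that al inv v by (simp add: \<sigma>_def)
        show "\<sigma> ` carrier R \<subseteq> carrier R" using \<sigma>c by auto
        show "(\<lambda>w. inv \<alpha> \<otimes> (v \<ominus> \<beta> \<otimes> w)) ` carrier R \<subseteq> carrier R" using al inv v by auto
        show "\<forall>u\<in>carrier R. inv \<alpha> \<otimes> (v \<ominus> \<beta> \<otimes> \<sigma> u) = u"
        proof
          fix u assume u: "u \<in> carrier R"
          have "\<alpha> \<otimes> u \<oplus> \<beta> \<otimes> \<sigma> u = v" using iff[OF u \<sigma>c[OF u]] by simp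
          hence "inv \<alpha> \<otimes> (v \<ominus> \<beta> \<otimes> \<sigma> u) = inv \<alpha> \<otimes> ((\<alpha> \<otimes> u \<oplus> \<beta> \<otimes> \<sigma> u) \<ominus> \<beta> \<otimes> \<sigma> u)" by simp
          also have "\<dots> = (\<alpha> \<otimes> inv \<alpha>) \<otimes> u" using u \<sigma>c[OF u] al inv(1) by algebra
          finally show "inv \<alpha> \<otimes> (v \<ominus> \<beta> \<otimes> \<sigma> u) = u" using inv u by simp
        qed
        show "\<forall>w\<in>carrier R. \<sigma> (inv \<alpha> \<otimes> (v \<ominus> \<beta> \<otimes> w)) = w"
        proof
          fix w assume w: "w \<in> carrier R"
          define u where "u = inv \<alpha> \<otimes> (v \<ominus> \<beta> \<otimes> w)"
          have u: "u \<in> carrier R" using w al inv v by (simp add: u_def)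
          have "\<alpha> \<otimes> u \<oplus> \<beta> \<otimes> w = (\<alpha> \<otimes> inv \<alpha>) \<otimes> (v \<ominus> \<beta> \<otimes> w) \<oplus> \<beta> \<otimes> w"
            unfolding u_def using w al inv(1) v by algebra
          also have "\<dots> = v" unfolding inv(4) using w al v by algebra
          finally have "w = \<sigma> u" using iff[OF u w] by simp
          thus "\<sigma> (inv \<alpha> \<otimes> (v \<ominus> \<beta> \<otimes> w)) = w" by (simp add: u_def)
        qed
      qed
    qed
    show "card {c\<in>\<Lambda>. dot n c x = dot n c y} = q ^ (n - 1)"
      if xy: "x \<in> Mon n" "y \<in> Mon n" "x \<noteq> y" for x y
    proof -
      define z where "z = x \<^bold>- y"
      have c: "x \<in> carrier P" "y \<in> carrier P" using xy Mon_closed by auto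
      have z: "z \<in> B n" "z \<noteq> []"
        using xy Mon_minus P.r_right_minus_eq[OF c] by (auto simp: z_def)
      have "dot n c x = dot n c y \<longleftrightarrow> dot n c z = \<zero>" if "c' \<in> \<Lambda>" "c = c'" for c c'
      proof -
        interpret poly_functional R q "dot n c" using lf that by simp
        show ?thesis using c by (simp add: z_def L_minus)
      qed
      hence "{c\<in>\<Lambda>. dot n c x = dot n c y} = {c\<in>\<Lambda>. dot n c z = \<zero>}" by auto
      moreover have "q * card {c\<in>\<Lambda>. dot n c z = \<zero>} = q * q ^ (n - 1)"
        using card_dot_zero[OF z] n(2) by (simp add: \<Lambda>_def power_eq_if)
      ultimately show ?thesis using q_ge_2 by simp
    qed
    show "\<And>c. c \<in> \<Lambda> \<Longrightarrow> W c \<subseteq> {p \<in> irr. degree p = d}" by (auto simp: W_def)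
  next
    fix c x assume c: "c \<in> \<Lambda>" and x: "x \<in> Mon n"
    interpret poly_functional R q "dot n c" using c by (rule lf)
    show "dot n c x \<in> carrier R" using Mon_closed[OF x] by simp
  next
    fix c x y assume c: "c \<in> \<Lambda>" and xy: "x \<in> Mon n" "y \<in> Mon n"
    interpret poly_functional R q "dot n c" using c by (rule lf)
    show "dot n c (lin_comb R \<alpha> x \<beta> y) = \<alpha> \<otimes> dot n c x \<oplus> \<beta> \<otimes> dot n c y"
      using ab Mon_closed[OF xy(1)] Mon_closed[OF xy(2)] by (simp add: lin_comb_def L_add L_const)
  next
    fix c p v assume c: "c \<in> \<Lambda>" and p: "p \<in> {p \<in> irr. degree p = d}" "p \<notin> W c" and v: "v \<in> carrier R"
    interpret poly_functional R q "dot n c" using c by (rule lf)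
    show "q * card {z \<in> Mon k. dot n c (p \<cdot> z) = v} = card (Mon k)"
      using equidistribution_Mon[OF _ _ v, of p k] p irr_closed by (auto simp: Wk[OF c] card_Mon)
  next
    fix c p assume c: "c \<in> \<Lambda>" and p: "p \<in> W c"
    interpret poly_functional R q "dot n c" using c by (rule lf)
    obtain F0 where F0: "F0 \<in> Mon k" using Mon_nonempty by blast
    have pc: "p \<in> carrier P" using p irr_closed by (simp add: W_def)
    show "\<exists>v\<in>carrier R. \<forall>z\<in>Mon k. dot n c (p \<cdot> z) = v"
    proof (intro bexI ballI)
      show "dot n c (p \<cdot> F0) \<in> carrier R" using pc Mon_closed[OF F0] by simp
      fix z assume z: "z \<in> Mon k"
      have zc: "z \<in> carrier P" "F0 \<in> carrier P" using z F0 Mon_closed by auto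
      have "p \<cdot> z = p \<cdot> F0 \<^bold>+ p \<cdot> (z \<^bold>- F0)" using pc zc by algebra
      hence "dot n c (p \<cdot> z) = dot n c (p \<cdot> F0) \<oplus> dot n c (p \<cdot> (z \<^bold>- F0))"
        using pc zc by (simp add: L_add)
      moreover have "dot n c (p \<cdot> (z \<^bold>- F0)) = \<zero>"
        using p Mon_minus[OF z F0] by (auto simp: W_def)
      ultimately show "dot n c (p \<cdot> z) = dot n c (p \<cdot> F0)" using pc zc by simp
    qed
  next
    fix c assume c: "c \<in> \<Lambda>" and nt: "\<exists>x\<in>Mon n. \<exists>y\<in>Mon n. dot n c x \<noteq> dot n c y"
    interpret poly_functional R q "dot n c" using c by (rule lf)
    obtain x y where xy: "x \<in> Mon n" "y \<in> Mon n" "dot n c x \<noteq> dot n c y" using nt by blast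
    have xyc: "x \<in> carrier P" "y \<in> carrier P" using xy Mon_closed by auto
    \<comment> \<open>Two monic polynomials with different values provide the witness of
      nontriviality that the sieve bound demands.\<close>
    have "x \<^bold>- y \<in> B (d + k)" using Mon_minus[OF xy(1,2)] n by simp
    moreover have "dot n c (x \<^bold>- y) \<noteq> \<zero>" using xy(3) xyc by (simp add: L_minus)
    ultimately have "real (card (W c)) * (exp (-13) * ((real Z + 1) / (real l + 1))) \<le> real q ^ d / real q ^ k"
      unfolding Wk[OF c] using m d l n by (intro card_irr_killed_le) auto
    moreover have "exp (-13) * ((real Z + 1) / (real l + 1)) > 0" by simp
    ultimately show "real (card (W c)) \<le> \<kappa>" unfolding \<kappa>_def using pos_le_divide_eq by blast
  qed (use sub n in auto)
  thus ?thesis by (simp only: PS.num_def card_Mon of_nat_power)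
qed

lemma max_irred_degree_ge:
  assumes G: "G \<in> Mon n" "n \<ge> 1" and p: "p \<in> irr" "p pdivides G"
  shows "degree p \<le> max_irred_degree R G"
proof -
  have Gc: "G \<in> carrier P" "G \<noteq> []" "degree G = n"
    using Mon_closed[OF G(1)] Mon_nonzero[OF G(1)] Mon_length[OF G(1)] by auto
  define S where "S = {degree x | x. x \<in> carrier P \<and> pirreducible (carrier R) x \<and> x pdivides G}"
  have "S \<subseteq> {..n}"
  proof
    fix j assume "j \<in> S"
    then obtain x where x: "j = degree x" "x \<in> carrier P" "x pdivides G" by (auto simp: S_def)
    hence "length x \<le> length G" using Gc by (intro pdivides_length_le)
    thus "j \<in> {..n}" using x Mon_length[OF G(1)] by auto
  qed
  hence "finite S" by (rule finite_subset) simp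
  moreover have "degree p \<in> S" using p by (auto simp: S_def irr_def)
  ultimately have "degree p \<le> Max S" by (rule Max_ge)
  thus ?thesis using Gc G(2) by (simp add: max_irred_degree_def S_def)
qed

lemma card_pairs_with_large_irr_ge:
  assumes ab: "\<alpha> \<in> carrier R - {\<zero>}" "\<beta> \<in> carrier R - {\<zero>}" "\<alpha> \<oplus> \<beta> = \<one>"
    and sub: "\<A> \<subseteq> Mon n" "\<B> \<subseteq> Mon n" and n: "n = d + k" "n < 2 * d"
  shows "card {((x, y), (p, z)) \<in> (\<A> \<times> \<B>) \<times> ({p\<in>irr. degree p = d} \<times> Mon k). lin_comb R \<alpha> x \<beta> y = p \<cdot> z}
    \<le> card {(x, y) \<in> \<A> \<times> \<B>. d \<le> max_irred_degree R (lin_comb R \<alpha> x \<beta> y)}"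
proof (rule card_inj_on_le[where f = fst])
  have fin: "finite \<A>" "finite \<B>" using sub finite_subset[OF _ finite_Mon] by blast+
  show "finite {(x, y) \<in> \<A> \<times> \<B>. d \<le> max_irred_degree R (lin_comb R \<alpha> x \<beta> y)}"
    by (rule finite_subset[of _ "\<A> \<times> \<B>"]) (use fin in auto)
  have uniq: "p = p' \<and> z = z'"
    if "G \<in> Mon n" "p \<in> irr" "degree p = d" "z \<in> Mon k" "G = p \<cdot> z"
      "p' \<in> irr" "degree p' = d" "z' \<in> Mon k" "G = p' \<cdot> z'" for G p z p' z'
  proof -
    have c: "p \<in> carrier P" "p' \<in> carrier P" "z \<in> carrier P" "z' \<in> carrier P" "p \<noteq> []"
      using irr_closed[OF that(2)] irr_closed[OF that(6)] Mon_closed[OF that(4)] Mon_closed[OF that(8)]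
        Mon_nonzero[OF irr_Mon[OF that(2)]] by blast+
    have "p = p'"
    proof (rule ccontr)
      assume ne: "p \<noteq> p'"
      have "p pdivides G" "p' pdivides G" using that(5,9) c(3,4) by (auto intro: pdividesI)
      hence "prs {p, p'} pdivides G"
        using that(2,6) Mon_closed[OF that(1)] by (subst prs_dvd_iff) auto
      moreover have "prs {p, p'} \<in> Mon (d + d)"
        using prs_Mon[of "{p, p'}"] that ne by simp
      ultimately have "length (prs {p, p'}) \<le> length G"
        using that(1) Mon_closed Mon_nonzero by (intro pdivides_length_le) blast+
      thus False using Mon_length[OF \<open>prs {p, p'} \<in> Mon (d + d)\<close>] Mon_length[OF that(1)] n by simp
    qed
    moreover from this have "p \<cdot> z = p \<cdot> z'" using that(5,9) by blast
    hence "z = z'" using c P.m_lcancel[of p z z'] by simp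
    ultimately show ?thesis by blast
  qed
  have lc: "lin_comb R \<alpha> x \<beta> y \<in> Mon n" if "x \<in> \<A>" "y \<in> \<B>" for x y
    using that sub ab by (intro lin_comb_Mon) auto
  show "inj_on fst {((x, y), (p, z)) \<in> (\<A> \<times> \<B>) \<times> ({p\<in>irr. degree p = d} \<times> Mon k). lin_comb R \<alpha> x \<beta> y = p \<cdot> z}"
  proof (rule inj_onI)
    fix s t assume s: "s \<in> {((x, y), (p, z)) \<in> (\<A> \<times> \<B>) \<times> ({p\<in>irr. degree p = d} \<times> Mon k). lin_comb R \<alpha> x \<beta> y = p \<cdot> z}"
      and t: "t \<in> {((x, y), (p, z)) \<in> (\<A> \<times> \<B>) \<times> ({p\<in>irr. degree p = d} \<times> Mon k). lin_comb R \<alpha> x \<beta> y = p \<cdot> z}"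
      and eq: "fst s = fst t"
    from s obtain x y p z where S: "s = ((x, y), (p, z))" "x \<in> \<A>" "y \<in> \<B>" "p \<in> irr" "degree p = d" "z \<in> Mon k"
      "lin_comb R \<alpha> x \<beta> y = p \<cdot> z" by blast
    from t eq S(1) obtain p' z' where T: "t = ((x, y), (p', z'))" "p' \<in> irr" "degree p' = d" "z' \<in> Mon k"
      "lin_comb R \<alpha> x \<beta> y = p' \<cdot> z'" by auto
    show "s = t" using uniq[OF lc[OF S(2,3)] S(4-7) T(2-5)] S T by simp
  qed
  show "fst ` {((x, y), (p, z)) \<in> (\<A> \<times> \<B>) \<times> ({p\<in>irr. degree p = d} \<times> Mon k). lin_comb R \<alpha> x \<beta> y = p \<cdot> z}
     \<subseteq> {(x, y) \<in> \<A> \<times> \<B>. d \<le> max_irred_degree R (lin_comb R \<alpha> x \<beta> y)}"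
  proof (intro image_subsetI)
    fix s assume "s \<in> {((x, y), (p, z)) \<in> (\<A> \<times> \<B>) \<times> ({p\<in>irr. degree p = d} \<times> Mon k). lin_comb R \<alpha> x \<beta> y = p \<cdot> z}"
    then obtain x y p z where S: "s = ((x, y), (p, z))" "x \<in> \<A>" "y \<in> \<B>" "p \<in> irr" "degree p = d" "z \<in> Mon k"
      "lin_comb R \<alpha> x \<beta> y = p \<cdot> z" by blast
    have "p pdivides lin_comb R \<alpha> x \<beta> y" using S(7) Mon_closed[OF S(6)] by (intro pdividesI)
    hence "d \<le> max_irred_degree R (lin_comb R \<alpha> x \<beta> y)"
      using max_irred_degree_ge[OF lc[OF S(2,3)] _ S(4)] S(5) n by auto
    thus "fst s \<in> {(x, y) \<in> \<A> \<times> \<B>. d \<le> max_irred_degree R (lin_comb R \<alpha> x \<beta> y)}" using S by simp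
  qed
qed

end

subsection \<open>Choice of the parameters\<close>

text \<open>Collects the constants of the error term. 48 is 12 times 4: 12 from
  \<open>n \<le> 12 * (Z + 1)\<close>, 4 from the permitted error \<open>s * s / (4 * n)\<close>. 13
  is the exponent in \<open>family_sum_ge\<close>, and 29 bounds the ratio of \<open>k + 1\<close>
  to \<open>log_q \<rho>\<close>.\<close>

lemma exp_25_ge: "48 * exp 13 * (3 + ln 29) \<le> exp (25::real)"
proof -
  have "ln (29::real) \<le> 28" using ln_le_minus_one[of "29::real"] by simp
  hence "48 * (3 + ln 29) \<le> (2::real) ^ 12" by simp
  also have "\<dots> \<le> exp 1 ^ 12" using exp_ge_add_one_self[of "1::real"] by (intro power_mono) auto
  also have "\<dots> = exp (12::real)" by (simp add: exp_of_nat_mult[symmetric])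
  finally have "exp 13 * (48 * (3 + ln 29)) \<le> exp 13 * exp (12::real)" by (intro mult_left_mono) auto
  thus ?thesis by (simp add: exp_add[symmetric] mult_ac)
qed

lemma tlog_ge_1: "tlog a x \<ge> 1" by (simp add: tlog_def)

lemma le_powr_tlog:
  assumes "q \<ge> 3" "x > 0"
  shows "x \<le> real q powr tlog (real q) x"
proof -
  have "ln (real q) > 0" using assms by simp
  have "x = real q powr (ln x / ln (real q))"
    using assms by (simp add: powr_def)
  also have "\<dots> \<le> real q powr tlog (real q) x"
    using assms by (intro powr_mono) (auto simp: tlog_def)
  finally show ?thesis .
qed

lemma ln_ge_1: "q \<ge> 3 \<Longrightarrow> ln (real q) \<ge> 1"
proof -
  assume "q \<ge> 3"
  hence "exp 1 \<le> real q" using exp_le by linarith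
  thus ?thesis using ln_ge_iff[of "real q" 1] \<open>q \<ge> 3\<close> by simp
qed

lemma tlog_le:
  assumes "q \<ge> 3" "x \<ge> 1"
  shows "tlog (real q) x \<le> x"
proof -
  have "ln x / ln (real q) \<le> ln x / 1" using ln_ge_1[OF assms(1)] assms by (intro divide_left_mono) auto
  also have "\<dots> \<le> x" using ln_le_minus_one[of x] assms by simp
  finally show ?thesis using assms by (simp add: tlog_def)
qed

text \<open>The error is small once \<open>q ^ k\<close> beats \<open>(l + 1) * \<rho>\<close>,
  where \<open>l\<close> is about \<open>log_q (k + 1)\<close>. Since \<open>k\<close> is of order
  \<open>t1\<close>, \<open>l\<close> is of order at most \<open>t2\<close>, and adding
  \<open>t3 = log_q t2\<close> to the exponent compensates for it; \<open>c\<close> compensates for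
  the constants.\<close>

lemma cofactor_degree_choice:
  fixes \<rho> :: real
  assumes q: "q \<ge> 3" and \<rho>: "0 < \<rho>" "\<rho> \<le> real q powr (real n / 7)" and n: "n > 10000"
  obtains k l :: nat where
    "real k \<le> tlog q \<rho> + tlog q (tlog q (tlog q \<rho>)) + 25 / ln q + 1"
    "6 * k + 6 \<le> n" "k + 1 \<le> q ^ l" "48 * exp 13 * (real l + 1) * \<rho> \<le> real q ^ k"
proof -
  define t1 where "t1 = tlog q \<rho>"
  define t2 where "t2 = tlog q t1"
  define t3 where "t3 = tlog q t2"
  have t: "t1 \<ge> 1" "t2 \<ge> 1" "t3 \<ge> 1" by (auto simp: t1_def t2_def t3_def tlog_ge_1)
  have lq: "ln (real q) \<ge> 1" by (rule ln_ge_1[OF q])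
  have t21: "t2 \<le> t1" "t3 \<le> t2"
    using tlog_le[OF q] t by (auto simp: t2_def t3_def)
  define c where "c = 25 / ln (real q)"
  have c: "0 < c" "c \<le> 25" using lq by (auto simp: c_def field_simps)
  \<comment> \<open>Adding 1 before rounding down keeps \<open>k \<ge> t1 + t3 + c\<close>. This is
    the final 1 in the bound of the theorem.\<close>
  define k where "k = nat \<lfloor>t1 + t3 + c + 1\<rfloor>"
  have k1: "real k \<le> t1 + t3 + c + 1" and k2: "t1 + t3 + c \<le> real k"
    using t c by (auto simp: k_def)
  have t1n: "t1 \<le> real n / 7"
  proof -
    have "ln \<rho> \<le> ln (real q powr (real n / 7))" using \<rho> q by (subst ln_le_cancel_iff) auto
    also have "\<dots> = real n / 7 * ln (real q)" using q by (simp add: ln_powr)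
    finally have "ln \<rho> / ln (real q) \<le> real n / 7" using lq by (simp add: pos_divide_le_eq)
    thus ?thesis using n by (simp add: t1_def tlog_def)
  qed
  \<comment> \<open>\<open>1/7 + 1/84 = 13/84\<close> is still below \<open>1/6 = 14/84\<close>; the
    spare \<open>n / 84\<close> exceeds all the additive constants for
    \<open>n > 10000\<close>.\<close>
  have t2n: "t2 \<le> real n / 84 + 82"
  proof -
    have "ln t1 / ln (real q) \<le> ln t1 / 1" using lq t by (intro divide_left_mono) auto
    also have "ln t1 \<le> ln (real n)" using t1n t n by (subst ln_le_cancel_iff) auto
    also have "ln (real n) = ln (real n / 84) + ln 84" using n by (simp add: ln_div)
    also have "\<dots> \<le> (real n / 84 - 1) + (84 - 1)"
      using n by (intro add_mono ln_le_minus_one) auto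
    finally show ?thesis by (simp add: t2_def tlog_def)
  qed
  have "6 * real k + 6 \<le> real n" using k1 t1n t2n t21 c n by linarith
  hence kn: "6 * k + 6 \<le> n" by linarith
  define l where "l = nat \<lceil>ln (real k + 1) / ln (real q)\<rceil>"
  have l1: "ln (real k + 1) / ln (real q) \<le> real l" unfolding l_def by (rule real_nat_ceiling_ge)
  have l2: "real l \<le> ln (real k + 1) / ln (real q) + 1"
  proof -
    have "0 \<le> ln (real k + 1) / ln (real q)" using lq by simp
    thus ?thesis unfolding l_def by linarith
  qed
  have "ln (real k + 1) \<le> real l * ln (real q)" using l1 lq by (simp add: pos_divide_le_eq)
  also have "\<dots> = ln (real q ^ l)" using q by (simp add: ln_realpow)
  finally have "real k + 1 \<le> real q ^ l" using q by (subst (asm) ln_le_cancel_iff) auto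
  hence "real (k + 1) \<le> real (q ^ l)" by simp
  hence kl: "k + 1 \<le> q ^ l" by (simp only: of_nat_le_iff)
  \<comment> \<open>\<open>t1 + t3 + c + 2\<close> is at most \<open>2 * t1 + 27\<close>, and
    \<open>t1 \<ge> 1\<close>.\<close>
  have "real k + 1 \<le> 29 * t1" using k1 c t t21 by linarith
  hence "ln (real k + 1) \<le> ln (29 * t1)" using t by (subst ln_le_cancel_iff) auto
  also have "\<dots> = ln 29 + ln t1" using t by (simp add: ln_mult)
  finally have "ln (real k + 1) / ln (real q) \<le> (ln 29 + ln t1) / ln (real q)"
    using lq by (intro divide_right_mono) auto
  also have "\<dots> = ln 29 / ln (real q) + ln t1 / ln (real q)" by (simp add: add_divide_distrib)
  also have "ln 29 / ln (real q) \<le> ln 29 / 1" using lq by (intro divide_left_mono) auto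
  also have "ln t1 / ln (real q) \<le> t2" by (simp add: t2_def tlog_def)
  finally have "real l + 1 \<le> (2 + ln 29) * 1 + t2" using l2 by simp
  also have "(2 + ln 29) * 1 \<le> (2 + ln 29) * t2" using t by (intro mult_left_mono) auto
  finally have l3: "real l + 1 \<le> (3 + ln 29) * t2" by (simp add: algebra_simps)
  have "48 * exp 13 * (real l + 1) * \<rho> \<le> 48 * exp 13 * ((3 + ln 29) * t2) * \<rho>"
    using l3 \<rho> by (intro mult_right_mono mult_left_mono) auto
  also have "\<dots> = (48 * exp 13 * (3 + ln 29)) * (t2 * \<rho>)" by simp
  also have "\<dots> \<le> exp 25 * (real q powr t3 * real q powr t1)"
  proof (intro mult_mono exp_25_ge)
    show "t2 \<le> real q powr t3" unfolding t3_def using t by (intro le_powr_tlog q) auto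
    show "\<rho> \<le> real q powr t1" unfolding t1_def using \<rho> by (intro le_powr_tlog q) auto
  qed (use t \<rho> in auto)
  also have "exp 25 = real q powr c" using q lq by (simp add: powr_def c_def)
  also have "real q powr c * (real q powr t3 * real q powr t1) = real q powr (t1 + t3 + c)"
    by (simp add: powr_add)
  also have "\<dots> \<le> real q powr real k" using k2 q by (intro powr_mono) auto
  also have "\<dots> = real q ^ k" using q by (simp add: powr_realpow)
  finally have "48 * exp 13 * (real l + 1) * \<rho> \<le> real q ^ k" .
  with that[of k l] k1 kn kl show ?thesis by (simp add: t1_def t2_def t3_def c_def)
qed

text \<open>In terms of \<open>s\<close>, with \<open>s * s = #A #B\<close>, the main term is at
  least \<open>s * s / (2 * n)\<close> by \<open>num_ge\<close>. The choice of \<open>k\<close>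
  keeps the error below half of this, which leaves the constant 1/4.\<close>

lemma (in finite_field_poly) card_large_irr_divisor_ge:
  assumes ab: "\<alpha> \<in> carrier R - {\<zero>}" "\<beta> \<in> carrier R - {\<zero>}" "\<alpha> \<oplus> \<beta> = \<one>"
    and sub: "\<A> \<subseteq> Mon n" "\<B> \<subseteq> Mon n" and n: "n > 10000"
    and large: "sqrt (real (card \<A>) * real (card \<B>)) \<ge> real q powr (6 / 7 * real n)"
  defines "\<rho> \<equiv> real q ^ n / sqrt (real (card \<A>) * real (card \<B>))"
  shows "1 / 4 * real (card \<A>) * real (card \<B>) / real n \<le>
    real (card {(x, y) \<in> \<A> \<times> \<B>. real n - tlog q \<rho> - tlog q (tlog q (tlog q \<rho>)) - 25 / ln q - 1
      \<le> real (max_irred_degree R (lin_comb R \<alpha> x \<beta> y))})"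
proof -
  define s where "s = sqrt (real (card \<A>) * real (card \<B>))"
  \<comment> \<open>In the field with two elements two nonzero elements never add up to 1. Hence
    \<open>ln q \<ge> 1\<close>, on which the estimates of \<open>tlog\<close> rest.\<close>
  have q3: "q \<ge> 3"
  proof -
    have "\<alpha> \<noteq> \<one>"
    proof
      assume "\<alpha> = \<one>"
      hence "\<one> \<oplus> \<beta> = \<one> \<oplus> \<zero>" using ab by simp
      thus False using ab by (simp add: add.l_cancel del: r_zero)
    qed
    hence "card {\<zero>, \<one>, \<alpha>} = 3" using ab by auto
    moreover have "card {\<zero>, \<one>, \<alpha>} \<le> card (carrier R)"
      using ab by (intro card_mono finite_carrier) auto
    ultimately show ?thesis by (simp add: card_carrier)
  qed
  have "0 < real q powr (6 / 7 * real n)" using q3 by simp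
  also have "\<dots> \<le> s" using large by (simp add: s_def)
  finally have s0: "s > 0" .
  have ss: "s * s = real (card \<A>) * real (card \<B>)" by (simp add: s_def)
  have \<rho>: "\<rho> = real q ^ n / s" "\<rho> > 0" using s0 q3 by (auto simp: \<rho>_def s_def)
  have "\<rho> \<le> real q ^ n / (real q powr (6 / 7 * real n))"
    unfolding \<rho>(1) using large q3 s0 by (intro divide_left_mono) (auto simp: s_def)
  also have "\<dots> = real q powr (real n - 6 / 7 * real n)"
  proof -
    have "real q ^ n = real q powr real n" using q3 by (simp add: powr_realpow)
    thus ?thesis by (simp only: powr_diff)
  qed
  also have "real n - 6 / 7 * real n = real n / 7" by simp
  finally have \<rho>7: "\<rho> \<le> real q powr (real n / 7)" .
  obtain k l where k: "real k \<le> tlog q \<rho> + tlog q (tlog q (tlog q \<rho>)) + 25 / ln q + 1"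
    "6 * k + 6 \<le> n" and kl: "k + 1 \<le> q ^ l" "48 * exp 13 * (real l + 1) * \<rho> \<le> real q ^ k"
    using cofactor_degree_choice[OF q3 \<rho>(2) \<rho>7 n] by blast
  define d where "d = n - k"
  \<comment> \<open>\<open>4 * Z \<le> n / 3\<close> and \<open>m\<close> about \<open>n / 2\<close>
    leave \<open>n / 6\<close> for \<open>k\<close>, as provided by
    \<open>6 * k + 6 \<le> n\<close>.\<close>
  define Z where "Z = n div 12"
  define m where "m = n div 2"
  have dn: "n = d + k" "d \<le> n" using k by (auto simp: d_def)
  define N where "N = card {(x, y) \<in> \<A> \<times> \<B>. d \<le> max_irred_degree R (lin_comb R \<alpha> x \<beta> y)}"
  have Zm: "12 * Z \<le> n" "n \<le> 12 * Z + 11" "2 * m \<le> n" "n \<le> 2 * m + 1"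
    unfolding Z_def m_def by linarith+
  define \<kappa> where "\<kappa> = (real q ^ d / real q ^ k) / (exp (-13) * ((real Z + 1) / (real l + 1)))"
  have "real (card \<A>) * real (card \<B>) * real (PS.num d) * real q ^ k / real q ^ n - \<kappa> * real q ^ k * s
    \<le> real (card {((x, y), (p, z)) \<in> (\<A> \<times> \<B>) \<times> ({p\<in>irr. degree p = d} \<times> Mon k). lin_comb R \<alpha> x \<beta> y = p \<cdot> z})"
    unfolding \<kappa>_def s_def
  proof (rule card_solutions_ge[OF ab sub dn(1), where m = m])
    show "m \<le> 6 * (Z + 1)" unfolding distrib_left using Zm by linarith
    show "4 * Z + k \<le> m" "Z < d" "k \<le> d" using Zm k(2) n dn(1) by linarith+
  qed (use n kl Zm in auto)
  also have "\<dots> \<le> real N"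
    unfolding N_def using card_pairs_with_large_irr_ge[OF ab sub dn(1)] k(2) by (simp add: d_def)
  finally have main: "s * s * real (PS.num d) * real q ^ k / real q ^ n - \<kappa> * real q ^ k * s \<le> real N"
    by (simp add: ss)
  have qp: "real q > 0" using q3 by simp
  have "1 / (2 * real n) * (s * s) \<le> s * s * real (PS.num d) * real q ^ k / real q ^ n"
  proof -
    have "real (q ^ d) \<le> real (2 * (d * PS.num d))"
      using k(2) n by (intro of_nat_mono PS.num_ge) (simp add: d_def)
    also have "\<dots> = 2 * real d * real (PS.num d)" by simp
    also have "\<dots> \<le> 2 * real n * real (PS.num d)" using dn by (intro mult_right_mono) auto
    finally have "real q ^ d / (2 * real n) \<le> real (PS.num d)" using n by (simp add: field_simps)
    hence "s * s * (real q ^ d / (2 * real n)) * (real q ^ k / real q ^ n) \<le> s * s * real (PS.num d) * (real q ^ k / real q ^ n)"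
      by (intro mult_right_mono mult_left_mono) auto
    moreover have "s * s * (real q ^ d / (2 * real n)) * (real q ^ k / real q ^ n) = 1 / (2 * real n) * (s * s)"
      using qp by (simp add: dn(1) power_add)
    ultimately show ?thesis by simp
  qed
  moreover have "\<kappa> * real q ^ k * s \<le> 1 / (4 * real n) * (s * s)"
  proof -
    have nZ: "real n \<le> 12 * (real Z + 1)" using Zm(2) by simp
    have "\<kappa> * real q ^ k * s = real q ^ d * exp 13 * (real l + 1) * s / (real Z + 1)"
    proof -
      have gen: "a / b / (inverse e * (z / y)) * b * s = a * e * y * s / z"
        if "b > 0" "e > 0" "z > 0" "y > 0" for a b e z y :: real
        using that by (simp add: field_simps)
      show ?thesis unfolding \<kappa>_def exp_minus by (rule gen) (use qp in auto)
    qed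
    also have "\<dots> \<le> real q ^ d * exp 13 * (real l + 1) * s / (real n / 12)"
      using nZ n s0 by (intro divide_left_mono mult_pos_pos) auto
    \<comment> \<open>\<open>\<rho>\<close> enters through
      \<open>q ^ d = \<rho> * s / q ^ k\<close>, and 12 is written as \<open>48 / 4\<close>.\<close>
    also have "\<dots> = 1 / (4 * real n) * (48 * exp 13 * (real l + 1) * \<rho>) * (s * s) / real q ^ k"
    proof -
      have gen: "a * e * y * s / (N / 12) = 1 / (4 * N) * (48 * e * y * (a * b / s)) * (s * s) / b"
        if "b > 0" "N > 0" for a b e y N :: real
        using that s0 by (simp add: field_simps)
      have "real q ^ n = real q ^ d * real q ^ k" by (simp add: dn(1) power_add)
      thus ?thesis unfolding \<rho>(1) by (simp only:) (rule gen, use qp n in auto)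
    qed
    also have "\<dots> \<le> 1 / (4 * real n) * real q ^ k * (s * s) / real q ^ k"
      using kl(2) s0 by (intro divide_right_mono mult_right_mono mult_left_mono) auto
    finally show ?thesis using qp by simp
  qed
  ultimately have "1 / (2 * real n) * (s * s) - 1 / (4 * real n) * (s * s) \<le> real N" using main by linarith
  moreover have "1 / (2 * real n) * (s * s) - 1 / (4 * real n) * (s * s) = 1 / 4 * (s * s) / real n"
    using n by (simp add: field_simps)
  ultimately have "1 / 4 * real (card \<A>) * real (card \<B>) / real n \<le> real N"
    unfolding ss mult.assoc by simp
  also have "N \<le> card {(x, y) \<in> \<A> \<times> \<B>. real n - tlog q \<rho> - tlog q (tlog q (tlog q \<rho>)) - 25 / ln q - 1
      \<le> real (max_irred_degree R (lin_comb R \<alpha> x \<beta> y))}"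
    unfolding N_def
  proof (rule card_mono)
    have "finite \<A>" "finite \<B>" using sub finite_subset[OF _ finite_Mon] by blast+
    thus "finite {(x, y) \<in> \<A> \<times> \<B>. real n - tlog q \<rho> - tlog q (tlog q (tlog q \<rho>)) - 25 / ln q - 1
      \<le> real (max_irred_degree R (lin_comb R \<alpha> x \<beta> y))}"
      by (intro finite_subset[OF _ finite_cartesian_product[of \<A> \<B>]]) auto
    have "real n - tlog q \<rho> - tlog q (tlog q (tlog q \<rho>)) - 25 / ln q - 1 \<le> real d"
      using k(1) dn(1) by simp
    thus "{(x, y) \<in> \<A> \<times> \<B>. d \<le> max_irred_degree R (lin_comb R \<alpha> x \<beta> y)}
      \<subseteq> {(x, y) \<in> \<A> \<times> \<B>. real n - tlog q \<rho> - tlog q (tlog q (tlog q \<rho>)) - 25 / ln q - 1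
      \<le> real (max_irred_degree R (lin_comb R \<alpha> x \<beta> y))}"
      by fastforce
  qed
  finally show ?thesis by simp
qed

theorem theorem1:
  fixes \<epsilon> :: real
  assumes "\<epsilon> > 0"
  shows "\<exists>(n0::nat) (c1::real) (c2::real). c1 > 0 \<and> c2 > 0 \<and>
    (\<forall>(R :: 'a ring) (q::nat) \<alpha> \<beta>.
       field R \<and> finite (carrier R) \<and> order R = q \<and>
       \<alpha> \<in> carrier R - {\<zero>\<^bsub>R\<^esub>} \<and> \<beta> \<in> carrier R - {\<zero>\<^bsub>R\<^esub>} \<and> \<alpha> \<oplus>\<^bsub>R\<^esub> \<beta> = \<one>\<^bsub>R\<^esub> \<longrightarrow>
       (\<forall>(n::nat) \<A> \<B>.
          n > n0 \<and> \<A> \<subseteq> monic_polys R n \<and> \<B> \<subseteq> monic_polys R n \<and>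
          sqrt (real (card \<A>) * real (card \<B>)) \<ge> real q powr ((6/7 + \<epsilon>) * real n) \<longrightarrow>
          (let \<rho> = real q ^ n / sqrt (real (card \<A>) * real (card \<B>)) in
             real (card {(A, B) \<in> \<A> \<times> \<B>.
                 real (max_irred_degree R (lin_comb R \<alpha> A \<beta> B)) \<ge>
                   real n - tlog q \<rho> - tlog q (tlog q (tlog q \<rho>)) - c2 / ln q - 1})
               \<ge> c1 * real (card \<A>) * real (card \<B>) / real n)))"
proof (rule exI[of _ 10000], rule exI[of _ "1/4"], rule exI[of _ 25], intro conjI allI impI)
  fix R :: "'a ring" and q \<alpha> \<beta> n \<A> \<B>
  assume R: "field R \<and> finite (carrier R) \<and> order R = q \<and>
       \<alpha> \<in> carrier R - {\<zero>\<^bsub>R\<^esub>} \<and> \<beta> \<in> carrier R - {\<zero>\<^bsub>R\<^esub>} \<and> \<alpha> \<oplus>\<^bsub>R\<^esub> \<beta> = \<one>\<^bsub>R\<^esub>"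
    and n: "10000 < n \<and> \<A> \<subseteq> monic_polys R n \<and> \<B> \<subseteq> monic_polys R n \<and>
          sqrt (real (card \<A>) * real (card \<B>)) \<ge> real q powr ((6/7 + \<epsilon>) * real n)"
  interpret F: finite_field_poly R q
    using R by (intro finite_field_poly.intro finite_field_poly_axioms.intro) (auto simp: order_def)
  have "real q powr (6 / 7 * real n) \<le> real q powr ((6/7 + \<epsilon>) * real n)"
    using F.q_ge_2 assms by (intro powr_mono mult_right_mono) auto
  hence "real q powr (6 / 7 * real n) \<le> sqrt (real (card \<A>) * real (card \<B>))" using n by linarith
  thus "let \<rho> = real q ^ n / sqrt (real (card \<A>) * real (card \<B>)) in
             real (card {(A, B) \<in> \<A> \<times> \<B>.
                 real (max_irred_degree R (lin_comb R \<alpha> A \<beta> B)) \<ge>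
                   real n - tlog q \<rho> - tlog q (tlog q (tlog q \<rho>)) - 25 / ln q - 1})
               \<ge> 1/4 * real (card \<A>) * real (card \<B>) / real n"
    unfolding Let_def using R n by (intro F.card_large_irr_divisor_ge) auto
qed auto

end
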